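(* Let $(M,\mathsf{g})$ be a Riemannian manifold, let $r,s\ge0$ be integers, and let $T\in\mathcal{T}^{(r,s)}(M)$ and $S\in\mathcal{T}^{(s+1,r)}(M)$ be smooth tensor fields with compact support. Then $$\langle\nabla T,S\rangle_{\mathcal{T}}=\langle T,-\mathrm{div}_\mu(S)\rangle_{\mathcal{T}},$$ where $\langle\cdot,\cdot\rangle_{\mathcal{T}}$ is the $L^2$-inner product of tensor fields of opposite type, $\langle T_1,T_2\rangle_{\mathcal{T}}=\int_M(T_1:T_2)\,d\mu$.
   Context: $(M,\mathsf{g})$ is an $n$-dimensional smooth Riemannian manifold with Riemannian volume form $\mu$ and Levi-Civita connection $\nabla$. $\mathcal{T}^{(r,s)}(M)$ denotes the smooth tensor fields of type $(r,s)$: $C^\infty(M)$-multilinear maps taking $r$ one-forms and $s$ vector fields to $C^\infty(M)$ ($r$ contravariant, $s$ covariant indices). Covariant derivative: for $T\in\mathcal{T}^{(r,s)}(M)$, $\nabla T\in\mathcal{T}^{(r,s+1)}(M)$ is $$(\nabla T)(\alpha^1,\ldots,\alpha^r,v_1,\ldots,v_s,X)=(\nabla_XT)(\alpha^1,\ldots,\alpha^r,v_1,\ldots,v_s)$$ $$=X[T(\alpha^1,\ldots,v_s)]-\sum_{j=1}^rT(\alpha^1,\ldots,\nabla_X\alpha^j,\ldots,\alpha^r,v_1,\ldots,v_s)-\sum_{i=1}^sT(\alpha^1,\ldots,\alpha^r,v_1,\ldots,\nabla_Xv_i,\ldots,v_s),$$ so the new covariant slot is the last one. Divergence: for $T\in\mathcal{T}^{(r,s)}(M)$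 with $r\ge1$, $\mathrm{div}_\mu T\in\mathcal{T}^{(r-1,s)}(M)$ is obtained by contracting the last contravariant slot with the derivative slot: $$(\mathrm{div}_\mu T)(\alpha^1,\ldots,\alpha^{r-1},v_1,\ldots,v_s)=\sum_{i=1}^n(\nabla_{E_i}T)(\alpha^1,\ldots,\alpha^{r-1},E^i,v_1,\ldots,v_s),$$ where $\{E_i\}$ is a local orthonormal frame and $\{E^i\}$ its dual coframe. Contraction: for $T_1\in\mathcal{T}^{(r,s)}(M)$ and $T_2\in\mathcal{T}^{(s,r)}(M)$, $T_1:T_2\in C^\infty(M)$ is the full contraction pairing the slots in order, $T_1:T_2=(T_1)^{i_1\cdots i_r}{}_{j_1\cdots j_s}(T_2)^{j_1\cdots j_s}{}_{i_1\cdots i_r}$ (Einstein summation). *)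

theory Defs
  imports "HOL-Analysis.Analysis"
begin

section \<open>Smooth functions on open subsets of Euclidean space\<close>

fun Ck_on :: "nat \<Rightarrow> 'e::real_normed_vector set \<Rightarrow> ('e \<Rightarrow> 'f::real_normed_vector) \<Rightarrow> bool" where
  "Ck_on 0 S f \<longleftrightarrow> continuous_on S f"
| "Ck_on (Suc k) S f \<longleftrightarrow>
     (\<forall>x\<in>S. f differentiable (at x)) \<and> (\<forall>v. Ck_on k S (\<lambda>x. frechet_derivative f (at x) v))"

definition smooth_on :: "'e::real_normed_vector set \<Rightarrow> ('e \<Rightarrow> 'f::real_normed_vector) \<Rightarrow> bool" where
  "smooth_on S f \<longleftrightarrow> (\<forall>k. Ck_on k S f)"


section \<open>Smooth manifolds\<close>

text \<open>
  The manifold is the whole type \<open>'a\<close>, and its dimension is \<open>CARD('n)\<close>. A chart is a pair of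
  its domain and its coordinate map (whose values off the domain are irrelevant); the inverse of
  \<open>(U, \<phi>)\<close> is \<open>inv_into U \<phi>\<close>. The smooth structure is given by any smooth atlas, not
  necessarily a maximal one.
\<close>

type_synonym ('a, 'n) chart = "'a set \<times> ('a \<Rightarrow> real ^ 'n)"

locale smooth_manifold =
  fixes A :: "('a::{t2_space, second_countable_topology}, 'n::finite) chart set"
  assumes charts_cover: "(\<Union>(U, \<phi>)\<in>A. U) = UNIV"
    and chart_open: "\<And>U \<phi>. (U, \<phi>) \<in> A \<Longrightarrow> open U \<and> open (\<phi> ` U)"
    and chart_homeomorphism:
      "\<And>U \<phi>. (U, \<phi>) \<in> A \<Longrightarrow> homeomorphism U (\<phi> ` U) \<phi> (inv_into U \<phi>)"
    and chart_compatible: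
      "\<And>U \<phi> V \<psi>. (U, \<phi>) \<in> A \<Longrightarrow> (V, \<psi>) \<in> A \<Longrightarrow> smooth_on (\<phi> ` (U \<inter> V)) (\<psi> \<circ> inv_into U \<phi>)"

definition smooth_functions ::
  "('a::topological_space, 'n::finite) chart set \<Rightarrow> ('a \<Rightarrow> real) set" where
  "smooth_functions A = {f. \<forall>(U, \<phi>)\<in>A. smooth_on (\<phi> ` U) (f \<circ> inv_into U \<phi>)}"


section \<open>Vector fields, one-forms and tensor fields\<close>

text \<open>
  A vector field is a derivation of the algebra of smooth functions, and a one-form is a linear map
  over the smooth functions from vector fields to smooth functions. Both are totalised by the value
  zero outside of their proper domain, so that every such object has exactly one representation.
\<close>

type_synonym 'a vfield = "('a \<Rightarrow> real) \<Rightarrow> 'a \<Rightarrow> real"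
type_synonym 'a oneform = "'a vfield \<Rightarrow> 'a \<Rightarrow> real"
type_synonym 'a tensor = "'a oneform list \<Rightarrow> 'a vfield list \<Rightarrow> 'a \<Rightarrow> real"

text \<open>The module operations, for vector fields as well as for one-forms.\<close>

definition fadd :: "('b \<Rightarrow> 'a \<Rightarrow> real) \<Rightarrow> ('b \<Rightarrow> 'a \<Rightarrow> real) \<Rightarrow> 'b \<Rightarrow> 'a \<Rightarrow> real" where
  "fadd X Y = (\<lambda>b p. X b p + Y b p)"

definition fscale :: "('a \<Rightarrow> real) \<Rightarrow> ('b \<Rightarrow> 'a \<Rightarrow> real) \<Rightarrow> 'b \<Rightarrow> 'a \<Rightarrow> real" where
  "fscale f X = (\<lambda>b p. f p * X b p)"

definition vector_fields ::
  "('a::topological_space, 'n::finite) chart set \<Rightarrow> 'a vfield set" where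
  "vector_fields A = {X.
     (\<forall>h\<in>smooth_functions A. X h \<in> smooth_functions A) \<and>
     (\<forall>h. h \<notin> smooth_functions A \<longrightarrow> X h = (\<lambda>p. 0)) \<and>
     (\<forall>h\<in>smooth_functions A. \<forall>k\<in>smooth_functions A.
        X (\<lambda>p. h p + k p) = (\<lambda>p. X h p + X k p)) \<and>
     (\<forall>c. \<forall>h\<in>smooth_functions A. X (\<lambda>p. c * h p) = (\<lambda>p. c * X h p)) \<and>
     (\<forall>h\<in>smooth_functions A. \<forall>k\<in>smooth_functions A.
        X (\<lambda>p. h p * k p) = (\<lambda>p. X h p * k p + h p * X k p))}"

definition one_forms ::
  "('a::topological_space, 'n::finite) chart set \<Rightarrow> 'a oneform set" where
  "one_forms A = {\<alpha>.
     (\<forall>X\<in>vector_fields A. \<alpha> X \<in> smooth_functions A) \<and>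
     (\<forall>X. X \<notin> vector_fields A \<longrightarrow> \<alpha> X = (\<lambda>p. 0)) \<and>
     (\<forall>X\<in>vector_fields A. \<forall>Y\<in>vector_fields A. \<alpha> (fadd X Y) = (\<lambda>p. \<alpha> X p + \<alpha> Y p)) \<and>
     (\<forall>f\<in>smooth_functions A. \<forall>X\<in>vector_fields A. \<alpha> (fscale f X) = (\<lambda>p. f p * \<alpha> X p))}"

definition tensor_args ::
  "('a::topological_space, 'n::finite) chart set \<Rightarrow> nat \<Rightarrow> nat \<Rightarrow>
     ('a oneform list \<times> 'a vfield list) set" where
  "tensor_args A r s = {(\<alpha>s, vs).
     length \<alpha>s = r \<and> set \<alpha>s \<subseteq> one_forms A \<and> length vs = s \<and> set vs \<subseteq> vector_fields A}"

text \<open>The values of a tensor field outside of \<open>tensor_args A r s\<close> are irrelevant.\<close>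

definition tensor_fields ::
  "('a::topological_space, 'n::finite) chart set \<Rightarrow> nat \<Rightarrow> nat \<Rightarrow> 'a tensor set" where
  "tensor_fields A r s = {T. \<forall>(\<alpha>s, vs)\<in>tensor_args A r s.
     T \<alpha>s vs \<in> smooth_functions A \<and>
     (\<forall>j<r. \<forall>\<beta>\<in>one_forms A.
        T (\<alpha>s[j := fadd (\<alpha>s ! j) \<beta>]) vs = (\<lambda>p. T \<alpha>s vs p + T (\<alpha>s[j := \<beta>]) vs p)) \<and>
     (\<forall>j<r. \<forall>f\<in>smooth_functions A.
        T (\<alpha>s[j := fscale f (\<alpha>s ! j)]) vs = (\<lambda>p. f p * T \<alpha>s vs p)) \<and>
     (\<forall>i<s. \<forall>w\<in>vector_fields A.
        T \<alpha>s (vs[i := fadd (vs ! i) w]) = (\<lambda>p. T \<alpha>s vs p + T \<alpha>s (vs[i := w]) p)) \<and>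
     (\<forall>i<s. \<forall>f\<in>smooth_functions A.
        T \<alpha>s (vs[i := fscale f (vs ! i)]) = (\<lambda>p. f p * T \<alpha>s vs p))}"

definition tensor_support ::
  "('a::topological_space, 'n::finite) chart set \<Rightarrow> nat \<Rightarrow> nat \<Rightarrow> 'a tensor \<Rightarrow> 'a set" where
  "tensor_support A r s T = closure {p. \<exists>(\<alpha>s, vs)\<in>tensor_args A r s. T \<alpha>s vs p \<noteq> 0}"


section \<open>Frames and contraction\<close>

text \<open>
  A local frame near \<open>p\<close> with its dual coframe, represented by global fields: only their germs at
  \<open>p\<close> matter, and every local frame near \<open>p\<close> can be extended by a cut-off after shrinking its
  domain. Since there are \<open>CARD('n)\<close> fields, duality makes \<open>E\<close> a frame on the neighbourhood.
\<close>

definition local_frame ::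
  "('a::topological_space, 'n::finite) chart set \<Rightarrow> 'a \<Rightarrow>
     ('n \<Rightarrow> 'a vfield) \<Rightarrow> ('n \<Rightarrow> 'a oneform) \<Rightarrow> bool" where
  "local_frame A p E F \<longleftrightarrow>
     (\<forall>i. E i \<in> vector_fields A) \<and> (\<forall>i. F i \<in> one_forms A) \<and>
     (\<exists>U. open U \<and> p \<in> U \<and> (\<forall>q\<in>U. \<forall>i j. F i (E j) q = (if i = j then 1 else 0)))"

definition local_orthonormal_frame ::
  "('a::topological_space, 'n::finite) chart set \<Rightarrow> 'a tensor \<Rightarrow> 'a \<Rightarrow>
     ('n \<Rightarrow> 'a vfield) \<Rightarrow> ('n \<Rightarrow> 'a oneform) \<Rightarrow> bool" where
  "local_orthonormal_frame A g p E F \<longleftrightarrow>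
     local_frame A p E F \<and>
     (\<exists>U. open U \<and> p \<in> U \<and> (\<forall>q\<in>U. \<forall>i j. g [] [E i, E j] q = (if i = j then 1 else 0)))"

text \<open>
  The full contraction of \<open>T\<^sub>1\<close> of type \<open>(r,s)\<close> with \<open>T\<^sub>2\<close> of type \<open>(s,r)\<close>, in components with
  respect to a local frame; it does not depend on the frame. The lists \<open>is\<close> and \<open>js\<close> are
  multi-indices.
\<close>

definition contraction ::
  "('a::topological_space, 'n::finite) chart set \<Rightarrow> nat \<Rightarrow> nat \<Rightarrow>
     'a tensor \<Rightarrow> 'a tensor \<Rightarrow> 'a \<Rightarrow> real" where
  "contraction A r s T\<^sub>1 T\<^sub>2 p =
     (let (E, F) = (SOME (E, F). local_frame A p E F)
      in \<Sum>is\<in>{is :: 'n list. length is = r}. \<Sum>js\<in>{js :: 'n list. length js = s}.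
           T\<^sub>1 (map F is) (map E js) p * T\<^sub>2 (map F js) (map E is) p)"


section \<open>Riemannian metric, Levi-Civita connection and Riemannian volume\<close>

definition riemannian_metric ::
  "('a::topological_space, 'n::finite) chart set \<Rightarrow> 'a tensor \<Rightarrow> bool" where
  "riemannian_metric A g \<longleftrightarrow>
     g \<in> tensor_fields A 0 2 \<and>
     (\<forall>X\<in>vector_fields A. \<forall>Y\<in>vector_fields A. g [] [X, Y] = g [] [Y, X]) \<and>
     (\<forall>X\<in>vector_fields A. \<forall>p. (\<exists>h. X h p \<noteq> 0) \<longrightarrow> g [] [X, X] p > 0)"

definition affine_connection ::
  "('a::topological_space, 'n::finite) chart set \<Rightarrow>
     ('a vfield \<Rightarrow> 'a vfield \<Rightarrow> 'a vfield) \<Rightarrow> bool" where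
  "affine_connection A nabla \<longleftrightarrow>
     (\<forall>X\<in>vector_fields A. \<forall>Y\<in>vector_fields A.
        nabla X Y \<in> vector_fields A \<and>
        (\<forall>Z\<in>vector_fields A. nabla (fadd X Z) Y = fadd (nabla X Y) (nabla Z Y)) \<and>
        (\<forall>f\<in>smooth_functions A. nabla (fscale f X) Y = fscale f (nabla X Y)) \<and>
        (\<forall>Z\<in>vector_fields A. nabla X (fadd Y Z) = fadd (nabla X Y) (nabla X Z)) \<and>
        (\<forall>f\<in>smooth_functions A.
           nabla X (fscale f Y) = fadd (fscale f (nabla X Y)) (fscale (X f) Y)))"

definition levi_civita_connection ::
  "('a::topological_space, 'n::finite) chart set \<Rightarrow> 'a tensor \<Rightarrow>
     ('a vfield \<Rightarrow> 'a vfield \<Rightarrow> 'a vfield) \<Rightarrow> bool" where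
  "levi_civita_connection A g nabla \<longleftrightarrow>
     affine_connection A nabla \<and>
     (\<forall>X\<in>vector_fields A. \<forall>Y\<in>vector_fields A. \<forall>h\<in>smooth_functions A. \<forall>p.
        nabla X Y h p - nabla Y X h p = X (Y h) p - Y (X h) p) \<and>
     (\<forall>X\<in>vector_fields A. \<forall>Y\<in>vector_fields A. \<forall>Z\<in>vector_fields A. \<forall>p.
        X (g [] [Y, Z]) p = g [] [nabla X Y, Z] p + g [] [Y, nabla X Z] p)"

text \<open>
  A global vector field whose value at \<open>p\<close> is the \<open>i\<close>-th coordinate vector of the chart; as \<open>g\<close> is
  tensorial, \<open>metric_matrix\<close> does not depend on the extension.
\<close>

definition coordinate_vector ::
  "('a::topological_space, 'n::finite) chart set \<Rightarrow> ('a, 'n) chart \<Rightarrow> 'a \<Rightarrow> 'n \<Rightarrow> 'a vfield" where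
  "coordinate_vector A c p i =
     (case c of (U, \<phi>) \<Rightarrow> SOME X. X \<in> vector_fields A \<and>
        (\<forall>h\<in>smooth_functions A.
           X h p = frechet_derivative (h \<circ> inv_into U \<phi>) (at (\<phi> p)) (axis i 1)))"

definition metric_matrix ::
  "('a::topological_space, 'n::finite) chart set \<Rightarrow> 'a tensor \<Rightarrow> ('a, 'n) chart \<Rightarrow> 'a \<Rightarrow>
     real ^ 'n ^ 'n" where
  "metric_matrix A g c p =
     (\<chi> i j. g [] [coordinate_vector A c p i, coordinate_vector A c p j] p)"

text \<open>
  The Borel measure given by integration against the Riemannian volume form. It is determined by
  its density \<open>sqrt (det g\<^sub>i\<^sub>j)\<close> in the charts of an atlas; no orientation is needed.
\<close>

definition riemannian_volume ::
  "('a::topological_space, 'n::finite) chart set \<Rightarrow> 'a tensor \<Rightarrow> 'a measure \<Rightarrow> bool" where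
  "riemannian_volume A g \<mu> \<longleftrightarrow>
     sets \<mu> = sets borel \<and>
     (\<forall>(U, \<phi>)\<in>A. \<forall>B\<in>sets borel. B \<subseteq> U \<longrightarrow>
        emeasure \<mu> B =
          (\<integral>\<^sup>+x\<in>\<phi> ` B. ennreal (sqrt (det (metric_matrix A g (U, \<phi>) (inv_into U \<phi> x)))) \<partial>lborel))"

locale riemannian_manifold = smooth_manifold A
  for A :: "('a::{t2_space, second_countable_topology}, 'n::finite) chart set" +
  fixes g :: "'a tensor"
    and nabla :: "'a vfield \<Rightarrow> 'a vfield \<Rightarrow> 'a vfield"
    and \<mu> :: "'a measure"
  assumes metric: "riemannian_metric A g"
    and levi_civita: "levi_civita_connection A g nabla"
    and volume: "riemannian_volume A g \<mu>"


section \<open>Covariant derivative, divergence and the pairing of tensor fields\<close>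

definition nabla_form ::
  "('a::topological_space, 'n::finite) chart set \<Rightarrow> ('a vfield \<Rightarrow> 'a vfield \<Rightarrow> 'a vfield) \<Rightarrow>
     'a vfield \<Rightarrow> 'a oneform \<Rightarrow> 'a oneform" where
  "nabla_form A nabla X \<alpha> =
     (\<lambda>Y p. if Y \<in> vector_fields A then X (\<alpha> Y) p - \<alpha> (nabla X Y) p else 0)"

definition nabla_tensor ::
  "('a::topological_space, 'n::finite) chart set \<Rightarrow> ('a vfield \<Rightarrow> 'a vfield \<Rightarrow> 'a vfield) \<Rightarrow>
     'a vfield \<Rightarrow> 'a tensor \<Rightarrow> 'a tensor" where
  "nabla_tensor A nabla X T = (\<lambda>\<alpha>s vs p.
     X (T \<alpha>s vs) p
     - (\<Sum>j<length \<alpha>s. T (\<alpha>s[j := nabla_form A nabla X (\<alpha>s ! j)]) vs p)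
     - (\<Sum>i<length vs. T \<alpha>s (vs[i := nabla X (vs ! i)]) p))"

definition covariant_derivative ::
  "('a::topological_space, 'n::finite) chart set \<Rightarrow> ('a vfield \<Rightarrow> 'a vfield \<Rightarrow> 'a vfield) \<Rightarrow>
     'a tensor \<Rightarrow> 'a tensor" where
  "covariant_derivative A nabla T =
     (\<lambda>\<alpha>s ws. nabla_tensor A nabla (last ws) T \<alpha>s (butlast ws))"

text \<open>The value at \<open>p\<close> does not depend on the orthonormal frame.\<close>

definition divergence ::
  "('a::topological_space, 'n::finite) chart set \<Rightarrow> 'a tensor \<Rightarrow>
     ('a vfield \<Rightarrow> 'a vfield \<Rightarrow> 'a vfield) \<Rightarrow> 'a tensor \<Rightarrow> 'a tensor" where
  "divergence A g nabla T = (\<lambda>\<alpha>s vs p.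
     let (E, F) = (SOME (E, F). local_orthonormal_frame A g p E F)
     in \<Sum>i\<in>UNIV. nabla_tensor A nabla (E i) T (\<alpha>s @ [F i]) vs p)"

definition tensor_pairing ::
  "('a::topological_space, 'n::finite) chart set \<Rightarrow> 'a measure \<Rightarrow> nat \<Rightarrow> nat \<Rightarrow>
     'a tensor \<Rightarrow> 'a tensor \<Rightarrow> real" where
  "tensor_pairing A \<mu> r s T\<^sub>1 T\<^sub>2 = (\<integral>p. contraction A r s T\<^sub>1 T\<^sub>2 p \<partial>\<mu>)"

end

theory Submission
  imports Defs
begin

text \<open>
  Let \<open>W\<close> be the vector field that is left when \<open>T\<close> is contracted with \<open>S\<close> in all slots except the
  last contravariant slot of \<open>S\<close>; in other words \<open>\<alpha>(W) = T : S(\<dots>, \<alpha>)\<close> for every one-form \<open>\<alpha>\<close>.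
  The Leibniz rule \<open>X(T\<^sub>1 : T\<^sub>2) = (\<nabla>\<^sub>X T\<^sub>1) : T\<^sub>2 + T\<^sub>1 : (\<nabla>\<^sub>X T\<^sub>2)\<close>, applied along each vector \<open>E\<^sub>k\<close> of a
  frame to \<open>T\<close> and \<open>S(\<dots>, F\<^sub>k)\<close> and summed over \<open>k\<close>, gives the pointwise identity
  \<open>\<nabla>T : S + T : div S = div W\<close> (\<open>contraction_covariant_derivative_divergence\<close>). As \<open>W\<close> vanishes
  outside of the support of \<open>T\<close>, integrating this identity reduces the claim to
  \<open>\<integral> div W d\<mu> = 0\<close> (\<open>divergence_theorem\<close>), together with the integrability of the two summands.

  The Leibniz rule (\<open>contraction_derivative\<close>) holds because the connection coefficients of a frame
  and those of its dual coframe are opposite to each other, so that the correction terms of \<open>\<nabla>T\<^sub>1\<close>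
  cancel against those of \<open>\<nabla>T\<^sub>2\<close>, slot by slot.

  The divergence theorem is additive in \<open>W\<close>, so after cutting \<open>W\<close> into pieces with bump functions
  (\<open>smooth_partition_induct\<close>) one may assume that \<open>W\<close> is supported in one chart. If \<open>G\<close> is the matrix
  of the metric there and \<open>C\<^sub>k\<close> the matrix of the connection in direction \<open>k\<close>, metric compatibility
  says \<open>\<partial>\<^sub>k G = C\<^sub>k G + G C\<^sub>k\<^sup>T\<close>, and Jacobi's formula turns this into
  \<open>\<partial>\<^sub>k \<surd>(det G) = trace C\<^sub>k \<cdot> \<surd>(det G)\<close> (\<open>density_derivative\<close>). As the connection is torsion-free,
  \<open>div W = \<Sum>\<^sub>k \<partial>\<^sub>k W\<^sup>k + W\<^sup>k trace C\<^sub>k\<close>, hence \<open>\<surd>(det G) div W = \<Sum>\<^sub>k \<partial>\<^sub>k (\<surd>(det G) W\<^sup>k)\<close>, and the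
  integral of a partial derivative of a compactly supported function over Euclidean space is zero
  (\<open>integral_directional_derivative\<close>).

  Vector fields are given as derivations of the global smooth functions. That they are local, and
  that they are combinations of coordinate fields, rests on bump functions and on Hadamard's lemma
  (\<open>vector_field_coordinates\<close>). It follows that all maps that are linear over the smooth functions
  are determined pointwise by their values on a frame (\<open>frame_flinear_vector\<close>,
  \<open>frame_flinear_form\<close>). Hence contractions and divergences, which are defined by an arbitrary
  choice of frames, can be computed in any frame; that there is an orthonormal frame to choose is
  the Gram-Schmidt process (\<open>local_orthonormal_frame_exists\<close>).
\<close>

section \<open>Smooth functions on Euclidean space\<close>

text \<open>
  On open sets the derivative is determined by the values, so the recursion that defines
  \<open>Ck_on\<close> never sees values outside of the set.
\<close>
lemma Ck_on_cong:
  assumes "Ck_on k S f" "open S" "\<And>x. x \<in> S \<Longrightarrow> f x = g x"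
  shows "Ck_on k S g"
  using assms
proof (induction k arbitrary: f g)
  case 0
  then show ?case by (simp cong: continuous_on_cong)
next
  case (Suc k)
  have *: "(g has_derivative frechet_derivative f (at x)) (at x)" if "x \<in> S" for x
  proof (rule has_derivative_transform_within_open[of f _ x UNIV S])
    show "(f has_derivative frechet_derivative f (at x)) (at x)"
      using Suc.prems(1) that by (simp add: frechet_derivative_works)
  qed (use Suc.prems that in auto)
  have eq: "frechet_derivative g (at x) = frechet_derivative f (at x)" if "x \<in> S" for x
    by (rule frechet_derivative_at[OF *[OF that], symmetric])
  have "Ck_on k S (\<lambda>x. frechet_derivative g (at x) v)" for v
    by (rule Suc.IH[of "\<lambda>x. frechet_derivative f (at x) v"]) (use Suc.prems eq in auto)
  then show ?case
    using * by (auto simp: differentiable_def)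
qed

lemma Ck_on_subset: "Ck_on k S f \<Longrightarrow> T \<subseteq> S \<Longrightarrow> Ck_on k T f"
  by (induction k arbitrary: f) (auto intro: continuous_on_subset)

lemma Ck_on_Suc_lower: "Ck_on (Suc k) S f \<Longrightarrow> Ck_on k S f"
proof (induction k arbitrary: f)
  case 0
  then show ?case
    by (auto intro!: differentiable_imp_continuous_on differentiable_at_imp_differentiable_on)
next
  case (Suc k)
  then show ?case
    by (metis Ck_on.simps(2))
qed

lemma Ck_on_local:
  assumes "\<And>x. x \<in> S \<Longrightarrow> \<exists>N. open N \<and> x \<in> N \<and> Ck_on k N f"
  shows "Ck_on k S f"
  using assms
proof (induction k arbitrary: f)
  case 0
  show ?case
  proof (simp, rule continuous_at_imp_continuous_on, rule)
    fix x assume "x \<in> S"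
    then obtain N where "open N" "x \<in> N" "Ck_on 0 N f" using 0 by blast
    then show "isCont f x"
      by (simp add: continuous_on_eq_continuous_at)
  qed
next
  case (Suc k)
  have "f differentiable (at x)" if "x \<in> S" for x
    using Suc.prems[OF that] by auto
  moreover have "Ck_on k S (\<lambda>x. frechet_derivative f (at x) v)" for v
    by (rule Suc.IH) (use Suc.prems in force)
  ultimately show ?case by simp
qed

lemma Ck_on_const: "Ck_on k S (\<lambda>x. c)"
proof (induction k arbitrary: c)
  case (Suc k)
  then show ?case by (simp add: frechet_derivative_const)
qed simp

text \<open>
  In the proofs below the derivative of a composite expression is found by a differentiation
  rule rather than as \<open>frechet_derivative\<close>; this rule takes it in that form.
\<close>
lemma Ck_on_SucI:
  assumes "open S" "\<And>x. x \<in> S \<Longrightarrow> (f has_derivative D x) (at x)" "\<And>v. Ck_on k S (\<lambda>x. D x v)"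
  shows "Ck_on (Suc k) S f"
proof -
  have "Ck_on k S (\<lambda>x. frechet_derivative f (at x) v)" for v
    by (rule Ck_on_cong[OF assms(3) assms(1)])
      (simp add: frechet_derivative_at[OF assms(2), symmetric])
  then show ?thesis using differentiableI[OF assms(2)] by simp
qed

lemma Ck_on_derivative:
  assumes "Ck_on (Suc k) S f"
  shows "x \<in> S \<Longrightarrow> (f has_derivative frechet_derivative f (at x)) (at x)"
    and "Ck_on k S (\<lambda>x. frechet_derivative f (at x) v)"
  using assms by (simp_all add: frechet_derivative_works)

lemma Ck_on_bounded_linear:
  assumes "bounded_linear f" "open S"
  shows "Ck_on k S f"
proof (cases k)
  case 0
  then show ?thesis using assms by (simp add: linear_continuous_on)
next
  case (Suc m)
  show ?thesis
    unfolding Suc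
    by (rule Ck_on_SucI[where D="\<lambda>x. f"])
      (simp_all add: assms Ck_on_const bounded_linear_imp_has_derivative)
qed

lemma Ck_on_linear_compose:
  assumes "bounded_linear L" "Ck_on k S f" "open S"
  shows "Ck_on k S (\<lambda>x. L (f x))"
  using assms(2)
proof (induction k arbitrary: f)
  case 0
  then show ?case
    using assms(1) bounded_linear.continuous_on by auto
next
  case (Suc k)
  show ?case
    by (rule Ck_on_SucI[OF assms(3) bounded_linear.has_derivative[OF assms(1) Ck_on_derivative(1)[OF Suc.prems]]])
      (auto intro: Suc.IH[OF Ck_on_derivative(2)[OF Suc.prems]])
qed

lemma Ck_on_add:
  assumes "Ck_on k S f" "Ck_on k S g" "open S"
  shows "Ck_on k S (\<lambda>x. f x + g x)"
  using assms(1,2)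
proof (induction k arbitrary: f g)
  case 0
  then show ?case by (auto intro: continuous_on_add)
next
  case (Suc k)
  note f = Ck_on_derivative[OF Suc.prems(1)] and g = Ck_on_derivative[OF Suc.prems(2)]
  show ?case
    by (rule Ck_on_SucI[OF assms(3) has_derivative_add[OF f(1) g(1)]]) (auto intro: Suc.IH[OF f(2) g(2)])
qed

text \<open>
  The product rule needs \<open>f\<close> and \<open>g\<close> themselves one order lower, whence the appeal to
  \<open>Ck_on_Suc_lower\<close>.
\<close>
lemma Ck_on_scaleR:
  fixes f :: "'e::real_normed_vector \<Rightarrow> real"
  assumes "Ck_on k S f" "Ck_on k S g" "open S"
  shows "Ck_on k S (\<lambda>x. f x *\<^sub>R g x)"
  using assms(1,2)
proof (induction k arbitrary: f g)
  case 0
  then show ?case by (auto intro: continuous_on_scaleR)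
next
  case (Suc k)
  note f = Ck_on_derivative[OF Suc.prems(1)] and g = Ck_on_derivative[OF Suc.prems(2)]
  note lower = Suc.prems[THEN Ck_on_Suc_lower]
  show ?case
    by (rule Ck_on_SucI[OF assms(3) has_derivative_scaleR[OF f(1) g(1)]])
      (auto intro: Ck_on_add[OF Suc.IH[OF lower(1) g(2)] Suc.IH[OF f(2) lower(2)] assms(3)])
qed

lemma Ck_on_sum:
  assumes "\<And>i. i \<in> I \<Longrightarrow> Ck_on k S (f i)" "open S"
  shows "Ck_on k S (\<lambda>x. \<Sum>i\<in>I. f i x)"
  using assms by (induction I rule: infinite_finite_induct) (auto intro: Ck_on_add Ck_on_const)

lemma linear_Basis_expansion:
  fixes L :: "'b::euclidean_space \<Rightarrow> 'c::real_vector"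
  assumes "linear L"
  shows "L w = (\<Sum>b\<in>Basis. (w \<bullet> b) *\<^sub>R L b)"
  using linear_sum[OF assms, of "\<lambda>b. (w \<bullet> b) *\<^sub>R b" Basis]
  by (simp add: euclidean_representation linear_scale[OF assms])

text \<open>
  Expanding the chain rule in the standard basis turns the derivative of \<open>f \<circ> h\<close> into a sum of
  products of lower order composites with derivatives of \<open>h\<close>, so induction over the order applies.
\<close>
lemma Ck_on_compose:
  fixes h :: "'e::real_normed_vector \<Rightarrow> 'b::euclidean_space"
  assumes "Ck_on k T f" "Ck_on k S h" "h ` S \<subseteq> T" "open S" "open T"
  shows "Ck_on k S (\<lambda>x. f (h x))"
  using assms(1,2)
proof (induction k arbitrary: f)
  case 0
  then show ?case
    using assms(3) continuous_on_compose2 by (auto simp del: image_subset_iff)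
next
  case (Suc k)
  note f = Ck_on_derivative[OF Suc.prems(1)] and h = Ck_on_derivative[OF Suc.prems(2)]
  let ?D = "\<lambda>x v. \<Sum>b\<in>Basis. (frechet_derivative h (at x) v \<bullet> b) *\<^sub>R frechet_derivative f (at (h x)) b"
  show ?case
  proof (rule Ck_on_SucI[OF assms(4), where D="?D"])
    fix x assume "x \<in> S"
    then have hx: "h x \<in> T" using assms(3) by blast
    have "((\<lambda>x. f (h x)) has_derivative (\<lambda>v. frechet_derivative f (at (h x)) (frechet_derivative h (at x) v))) (at x)"
      using diff_chain_at[OF h(1)[OF \<open>x \<in> S\<close>] f(1)[OF hx]] by (simp add: o_def)
    moreover have "(\<lambda>v. frechet_derivative f (at (h x)) (frechet_derivative h (at x) v)) = ?D x"
      by (rule ext, rule linear_Basis_expansion[OF has_derivative_linear[OF f(1)[OF hx]]])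
    ultimately show "((\<lambda>x. f (h x)) has_derivative ?D x) (at x)" by simp
  next
    fix v
    show "Ck_on k S (\<lambda>x. ?D x v)"
      by (intro Ck_on_sum Ck_on_scaleR assms(4) Suc.IH[OF f(2) Ck_on_Suc_lower[OF Suc.prems(2)]]
          Ck_on_linear_compose[OF bounded_linear_inner_left h(2)])
  qed
qed

lemma smooth_on_cong:
  "smooth_on S f \<Longrightarrow> open S \<Longrightarrow> (\<And>x. x \<in> S \<Longrightarrow> f x = g x) \<Longrightarrow> smooth_on S g"
  unfolding smooth_on_def by (blast intro: Ck_on_cong)

lemma smooth_on_subset: "smooth_on S f \<Longrightarrow> T \<subseteq> S \<Longrightarrow> smooth_on T f"
  unfolding smooth_on_def by (blast intro: Ck_on_subset)

lemma smooth_on_local: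
  "(\<And>x. x \<in> S \<Longrightarrow> \<exists>N. open N \<and> x \<in> N \<and> smooth_on N f) \<Longrightarrow> smooth_on S f"
  unfolding smooth_on_def by (intro allI Ck_on_local) blast

lemma smooth_on_const: "smooth_on S (\<lambda>x. c)"
  by (simp add: smooth_on_def Ck_on_const)

lemma smooth_on_bounded_linear: "bounded_linear f \<Longrightarrow> open S \<Longrightarrow> smooth_on S f"
  by (simp add: smooth_on_def Ck_on_bounded_linear)

lemma smooth_on_add:
  "smooth_on S f \<Longrightarrow> smooth_on S g \<Longrightarrow> open S \<Longrightarrow> smooth_on S (\<lambda>x. f x + g x)"
  by (simp add: smooth_on_def Ck_on_add)

lemma smooth_on_mult:
  fixes f :: "'e::real_normed_vector \<Rightarrow> real"
  shows "smooth_on S f \<Longrightarrow> smooth_on S g \<Longrightarrow> open S \<Longrightarrow> smooth_on S (\<lambda>x. f x * g x)"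
  using Ck_on_scaleR[of _ S f g] by (simp add: smooth_on_def)

lemma smooth_on_compose:
  fixes h :: "'e::real_normed_vector \<Rightarrow> 'b::euclidean_space"
  shows "smooth_on T f \<Longrightarrow> smooth_on S h \<Longrightarrow> h ` S \<subseteq> T \<Longrightarrow> open S \<Longrightarrow> open T \<Longrightarrow>
    smooth_on S (\<lambda>x. f (h x))"
  unfolding smooth_on_def using Ck_on_compose[of _ T f S h] by blast

lemma smooth_on_differentiable: "smooth_on S f \<Longrightarrow> x \<in> S \<Longrightarrow> f differentiable (at x)"
  unfolding smooth_on_def by (metis Ck_on.simps(2))

lemma smooth_on_has_derivative:
  "smooth_on S f \<Longrightarrow> x \<in> S \<Longrightarrow> (f has_derivative frechet_derivative f (at x)) (at x)"
  using smooth_on_differentiable by (simp add: frechet_derivative_works)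

lemma smooth_on_derivative: "smooth_on S f \<Longrightarrow> smooth_on S (\<lambda>x. frechet_derivative f (at x) v)"
  unfolding smooth_on_def by (metis Ck_on.simps(2))

lemma smooth_on_continuous_on: "smooth_on S f \<Longrightarrow> continuous_on S f"
  unfolding smooth_on_def by (metis Ck_on.simps(1))

section \<open>Bump functions on Euclidean space\<close>

text \<open>
  The function \<open>exp (- 1 / x)\<close>, extended by zero, all of whose derivatives vanish at zero. The
  factor \<open>(1 / x) ^ m\<close> makes the family closed under differentiation, up to linear combinations.
\<close>
definition flat :: "nat \<Rightarrow> real \<Rightarrow> real" where
  "flat m x = (if x > 0 then (1 / x) ^ m * exp (- (1 / x)) else 0)"

lemma power_exp_inverse_tendsto_0: "((\<lambda>x::real. (1 / x) ^ m * exp (- (1 / x))) \<longlongrightarrow> 0) (at_right 0)"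
proof -
  have "((\<lambda>y::real. y ^ m / exp y) \<longlongrightarrow> 0) at_top"
    by (rule tendsto_power_div_exp_0)
  then have "((\<lambda>x::real. (inverse x) ^ m / exp (inverse x)) \<longlongrightarrow> 0) (at_right 0)"
    by (rule filterlim_compose) (rule filterlim_inverse_at_top_right)
  then show ?thesis by (simp add: inverse_eq_divide exp_minus divide_simps)
qed

text \<open>
  At zero the difference quotient of \<open>flat m\<close> is \<open>flat (Suc m)\<close>, which tends to zero because the
  exponential beats every power.
\<close>
lemma flat_has_derivative:
  "(flat m has_real_derivative - real m * flat (Suc m) x + flat (m + 2) x) (at x)"
proof (cases x "0::real" rule: linorder_cases)
  case greater
  have "((\<lambda>x. (1 / x) ^ m * exp (- (1 / x))) has_real_derivative
      - real m * ((1 / x) ^ Suc m * exp (- (1 / x))) + (1 / x) ^ (m + 2) * exp (- (1 / x))) (at x)"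
  proof -
    have eq: "real m * (1 / x) ^ (m - Suc 0) * (- (1 / x ^ 2)) = - real m * (1 / x) ^ Suc m"
      by (cases m) (simp_all add: power2_eq_square add_divide_distrib diff_divide_distrib ring_distribs)
    have "((\<lambda>x. (1 / x) ^ m * exp (- (1 / x))) has_real_derivative
      real m * (1 / x) ^ (m - Suc 0) * (- (1 / x ^ 2)) * exp (- (1 / x)) +
      (1 / x) ^ m * (exp (- (1 / x)) * (1 / x ^ 2))) (at x)"
      using greater by (auto intro!: derivative_eq_intros simp: power2_eq_square)
    then show ?thesis
      unfolding eq using greater by (simp add: power_add power2_eq_square algebra_simps)
  qed
  then have "(flat m has_real_derivative
      - real m * ((1 / x) ^ Suc m * exp (- (1 / x))) + (1 / x) ^ (m + 2) * exp (- (1 / x))) (at x)"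
    by (rule has_field_derivative_transform_within_open[where S="{0<..}"])
      (use greater in \<open>auto simp: flat_def\<close>)
  then show ?thesis using greater by (simp add: flat_def)
next
  case less
  have "((\<lambda>x. 0) has_real_derivative 0) (at x)" by simp
  then have "(flat m has_real_derivative 0) (at x)"
    by (rule has_field_derivative_transform_within_open[where S="{..<0}"])
      (use less in \<open>auto simp: flat_def\<close>)
  then show ?thesis using less by (simp add: flat_def)
next
  case equal
  have "((\<lambda>h. flat m h / h) \<longlongrightarrow> 0) (at_right 0)"
    by (rule Lim_transform_eventually[OF power_exp_inverse_tendsto_0[of "Suc m"]])
      (auto simp: flat_def eventually_at_filter intro!: always_eventually)
  moreover have "((\<lambda>h. flat m h / h) \<longlongrightarrow> 0) (at_left 0)"
    by (rule Lim_transform_eventually[OF tendsto_const])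
      (auto simp: flat_def eventually_at_filter intro!: always_eventually)
  ultimately have "((\<lambda>h. flat m h / h) \<longlongrightarrow> 0) (at 0)"
    using filterlim_split_at by blast
  then show ?thesis using equal by (simp add: DERIV_def flat_def)
qed

lemma Ck_on_flat: "Ck_on k UNIV (flat m)"
proof (induction k arbitrary: m)
  case 0
  then show ?case
    by (auto intro!: continuous_at_imp_continuous_on DERIV_isCont flat_has_derivative)
next
  case (Suc k)
  show ?case
  proof (rule Ck_on_SucI)
    show "(flat m has_derivative (\<lambda>v. v *\<^sub>R ((- real m) *\<^sub>R flat (Suc m) x + flat (m + 2) x))) (at x)" for x
      using flat_has_derivative[of m x] by (simp add: has_field_derivative_def mult_commute_abs)
    show "Ck_on k UNIV (\<lambda>x. v *\<^sub>R ((- real m) *\<^sub>R flat (Suc m) x + flat (m + 2) x))" for v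
      by (intro Ck_on_scaleR Ck_on_add Ck_on_const Suc.IH open_UNIV)
  qed simp
qed

text \<open>
  Differentiation only changes the exponent and adds a constant factor. The exponents \<open>- 1\<close> and
  \<open>- 1 / 2\<close> are used, for division and for normalising vectors.
\<close>
lemma smooth_on_powr: "smooth_on {0<..} (\<lambda>x::real. x powr a)"
proof -
  have "Ck_on k {0<..} (\<lambda>x::real. x powr a)" for k
  proof (induction k arbitrary: a)
    case 0
    then show ?case by (auto intro!: continuous_intros)
  next
    case (Suc k)
    show ?case
    proof (rule Ck_on_SucI)
      show "((\<lambda>x. x powr a) has_derivative (\<lambda>v. (v * a) *\<^sub>R x powr (a - 1))) (at x)" if "x \<in> {0<..}" for x :: real
        using has_real_derivative_powr[of x a] that
        by (simp add: has_field_derivative_def mult_commute_abs mult.assoc mult.left_commute)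
      show "Ck_on k {0<..} (\<lambda>x::real. (v * a) *\<^sub>R x powr (a - 1))" for v :: real
        by (intro Ck_on_scaleR Ck_on_const Suc.IH open_greaterThan)
    qed simp
  qed
  then show ?thesis by (simp add: smooth_on_def)
qed

text \<open>
  The two summands of the denominator are never zero at the same time, so the step is smooth; it
  climbs from 0 to 1 on the unit interval.
\<close>
definition smooth_step :: "real \<Rightarrow> real" where
  "smooth_step x = flat 0 x / (flat 0 x + flat 0 (1 - x))"

lemma smooth_step_denominator_pos: "flat 0 x + flat 0 (1 - x) > 0"
  by (simp add: flat_def add_pos_pos)

lemma smooth_step_bounds: "0 \<le> smooth_step x" "smooth_step x \<le> 1"
  using smooth_step_denominator_pos[of x]
  by (auto simp: smooth_step_def flat_def divide_simps)

lemma smooth_step_eq_0: "x \<le> 0 \<Longrightarrow> smooth_step x = 0"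
  by (simp add: smooth_step_def flat_def)

lemma smooth_step_eq_1: "x \<ge> 1 \<Longrightarrow> smooth_step x = 1"
  by (simp add: smooth_step_def flat_def)

lemma smooth_on_smooth_step: "smooth_on UNIV smooth_step"
proof -
  have f: "smooth_on UNIV (flat 0)"
    by (simp add: smooth_on_def Ck_on_flat)
  have "smooth_on UNIV (\<lambda>x::real. 1 + (-1) * x)"
    by (intro smooth_on_add smooth_on_const smooth_on_mult open_UNIV smooth_on_bounded_linear bounded_linear_ident)
  then have "smooth_on UNIV (\<lambda>x::real. 1 - x)"
    by simp
  then have "smooth_on UNIV (\<lambda>x. flat 0 (1 - x))"
    using smooth_on_compose[OF f] by auto
  then have d: "smooth_on UNIV (\<lambda>x. flat 0 x + flat 0 (1 - x))"
    using f by (intro smooth_on_add) auto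
  have "smooth_on UNIV (\<lambda>x. (flat 0 x + flat 0 (1 - x)) powr - 1)"
    by (rule smooth_on_compose[OF smooth_on_powr d]) (use smooth_step_denominator_pos in auto)
  then have "smooth_on UNIV (\<lambda>x. inverse (flat 0 x + flat 0 (1 - x)))"
    by (rule smooth_on_cong) (simp_all add: powr_minus smooth_step_denominator_pos less_imp_le)
  with f have "smooth_on UNIV (\<lambda>x. flat 0 x * inverse (flat 0 x + flat 0 (1 - x)))"
    by (intro smooth_on_mult) auto
  then show ?thesis by (simp add: smooth_step_def[abs_def] divide_inverse)
qed

lemma smooth_on_inner_self: "smooth_on UNIV (\<lambda>x::'e::euclidean_space. (x - a) \<bullet> (x - a))"
proof -
  have "Ck_on k UNIV (\<lambda>x::'e. (\<Sum>b\<in>Basis. (x \<bullet> b + - (a \<bullet> b)) *\<^sub>R (x \<bullet> b + - (a \<bullet> b))))" for k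
    by (intro Ck_on_sum Ck_on_scaleR Ck_on_add Ck_on_const open_UNIV Ck_on_bounded_linear
        bounded_linear_inner_left)
  then show ?thesis
    unfolding smooth_on_def by (subst euclidean_inner) (simp add: inner_diff_left)
qed

text \<open>
  The smooth step is applied to the squared distance, which unlike the distance is smooth at
  \<open>a\<close>.
\<close>
lemma euclidean_bump:
  fixes a :: "'e::euclidean_space"
  assumes "e > 0"
  obtains b :: "'e \<Rightarrow> real" where
    "smooth_on UNIV b" "\<And>x. 0 \<le> b x" "\<And>x. b x \<le> 1"
    "\<And>x. dist a x \<le> e \<Longrightarrow> b x = 1" "\<And>x. dist a x \<ge> 2 * e \<Longrightarrow> b x = 0"
proof
  \<comment> \<open>This is at least 1 within distance \<open>e\<close> and negative beyond distance \<open>2 * e\<close>.\<close>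
  let ?q = "\<lambda>x. 2 + (- (1 / e\<^sup>2)) * ((x - a) \<bullet> (x - a))"
  have "smooth_on UNIV ?q"
    by (intro smooth_on_add smooth_on_mult smooth_on_const smooth_on_inner_self open_UNIV)
  then show "smooth_on UNIV (\<lambda>x. smooth_step (?q x))"
    using smooth_on_compose[OF smooth_on_smooth_step] by auto
  have d: "(x - a) \<bullet> (x - a) = (dist a x)\<^sup>2" for x
    by (simp add: dist_norm norm_minus_commute[of a] power2_norm_eq_inner)
  show "smooth_step (?q x) = 1" if "dist a x \<le> e" for x
  proof (rule smooth_step_eq_1)
    have "(dist a x)\<^sup>2 \<le> e\<^sup>2" using that by (simp add: power_mono)
    then show "?q x \<ge> 1" using assms by (simp add: d field_simps)
  qed
  show "smooth_step (?q x) = 0" if "dist a x \<ge> 2 * e" for x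
  proof (rule smooth_step_eq_0)
    have "(2 * e)\<^sup>2 \<le> (dist a x)\<^sup>2" using that assms by (intro power_mono) auto
    then have "4 * e\<^sup>2 \<le> (dist a x)\<^sup>2"
      by (simp add: power_mult_distrib)
    then have "2 * e\<^sup>2 \<le> (dist a x)\<^sup>2"
      using zero_le_power2[of e] by linarith
    then show "?q x \<le> 0" using assms by (simp add: d field_simps)
  qed
qed (auto simp: smooth_step_bounds)

section \<open>Hadamard's lemma\<close>

lemma ray_in_ball:
  fixes a x :: "'e::real_normed_vector"
  assumes "x \<in> ball a e" "t \<in> {0..1}"
  shows "a + t *\<^sub>R (x - a) \<in> ball a e"
proof -
  have "t * norm (x - a) \<le> norm (x - a)"
    using assms by (intro mult_left_le_one_le) auto
  then show ?thesis using assms by (simp add: dist_norm norm_minus_commute)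
qed

text \<open>
  Differentiating under the integral replaces \<open>F\<close> by a partial derivative and raises the power of
  \<open>t\<close> by one. Allowing an arbitrary power makes the induction over the order go through.
\<close>
lemma Ck_on_ray_integral:
  fixes F :: "'e::euclidean_space \<Rightarrow> real"
  assumes "smooth_on (ball a e) F"
  shows "Ck_on k (ball a e) (\<lambda>x. integral {0..1} (\<lambda>t. t ^ m * F (a + t *\<^sub>R (x - a))))"
  using assms
proof (induction k arbitrary: m F)
  case (0 m F)
  have inb: "a + t *\<^sub>R (x - a) \<in> ball a e" if "x \<in> ball a e" "t \<in> {0..1}" for x t
    using that by (rule ray_in_ball)
  have cF: "continuous_on (ball a e) F" using 0 smooth_on_continuous_on by blast
  have "continuous_on (ball a e) (\<lambda>x. integral (cbox 0 1) (\<lambda>t. t ^ m * F (a + t *\<^sub>R (x - a))))"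
  proof (rule integral_continuous_on_param)
    show "continuous_on (ball a e \<times> cbox 0 1) (\<lambda>(x, t). t ^ m * F (a + t *\<^sub>R (x - a)))"
      unfolding split_beta
      by (intro continuous_intros continuous_on_compose2[OF cF]) (use inb in auto)
  qed
  then show ?case by simp
next
  case (Suc k m F)
  have inb: "a + t *\<^sub>R (x - a) \<in> ball a e" if "x \<in> ball a e" "t \<in> {0..1}" for x t
    using that by (rule ray_in_ball)
  have cF: "continuous_on (ball a e) F" using Suc smooth_on_continuous_on by blast
  let ?D = "\<lambda>b x. frechet_derivative F (at x) b"
  let ?L = "\<lambda>x t v. \<Sum>b\<in>Basis. t ^ Suc m * ?D b (a + t *\<^sub>R (x - a)) * (v \<bullet> b)"
  \<comment> \<open>The derivative as a bounded linear function, the form in which \<open>leibniz_rule\<close> takes it.\<close>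
  let ?fx = "\<lambda>x t. \<Sum>b\<in>Basis. (t ^ Suc m * ?D b (a + t *\<^sub>R (x - a))) *\<^sub>R blinfun_inner_left b"
  let ?I = "\<lambda>x. integral {0..1} (\<lambda>t. t ^ m * F (a + t *\<^sub>R (x - a)))"
  have cD: "continuous_on (ball a e) (?D b)" for b
    using Suc.prems smooth_on_derivative smooth_on_continuous_on by blast
  have fx: "blinfun_apply (?fx x t) = ?L x t" for x t
    by (simp add: fun_eq_iff blinfun.bilinear_simps blinfun_inner_left.rep_eq inner_commute)
  have der: "((\<lambda>x. t ^ m * F (a + t *\<^sub>R (x - a))) has_derivative ?L x t) (at x)"
    if "x \<in> ball a e" "t \<in> {0..1}" for x t
  proof -
    have F: "(F has_derivative frechet_derivative F (at (a + t *\<^sub>R (x - a)))) (at (a + t *\<^sub>R (x - a)))"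
      using smooth_on_has_derivative[OF Suc.prems inb[OF that]] .
    have rep: "frechet_derivative F (at (a + t *\<^sub>R (x - a))) w = (\<Sum>b\<in>Basis. (w \<bullet> b) * ?D b (a + t *\<^sub>R (x - a)))" for w
      by (subst linear_Basis_expansion[OF has_derivative_linear[OF F]]) (simp only: real_scaleR_def)
    have "((\<lambda>x. F (a + t *\<^sub>R (x - a))) has_derivative
       (\<lambda>v. frechet_derivative F (at (a + t *\<^sub>R (x - a))) (t *\<^sub>R v))) (at x)"
      by (rule has_derivative_compose[where f="\<lambda>x. a + t *\<^sub>R (x - a)" and g=F, OF _ F])
        (auto intro!: derivative_eq_intros)
    then have "((\<lambda>x. t ^ m * F (a + t *\<^sub>R (x - a))) has_derivative
       (\<lambda>v. t ^ m * frechet_derivative F (at (a + t *\<^sub>R (x - a))) (t *\<^sub>R v))) (at x)"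
      by (rule has_derivative_mult_right)
    moreover have "(\<lambda>v. t ^ m * frechet_derivative F (at (a + t *\<^sub>R (x - a))) (t *\<^sub>R v)) = ?L x t"
      by (rule ext, subst rep) (simp add: sum_distrib_left mult_ac)
    ultimately show ?thesis by metis
  qed
  have c1: "continuous_on (ball a e \<times> cbox 0 (1::real)) (\<lambda>(x, t). ?fx x t)"
    unfolding split_beta
    by (intro continuous_intros continuous_on_compose2[OF cD]) (use inb in auto)
  have *: "(?I has_derivative (\<lambda>v. \<Sum>b\<in>Basis. (v \<bullet> b) * integral {0..1} (\<lambda>t. t ^ Suc m * ?D b (a + t *\<^sub>R (x - a))))) (at x)"
    if x: "x \<in> ball a e" for x
  proof -
    have "((\<lambda>x. integral (cbox 0 1) (\<lambda>t. t ^ m * F (a + t *\<^sub>R (x - a)))) has_derivative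
        integral (cbox 0 1) (?fx x)) (at x within ball a e)"
    proof (rule leibniz_rule)
      show "((\<lambda>x. t ^ m * F (a + t *\<^sub>R (x - a))) has_derivative blinfun_apply (?fx x t)) (at x within ball a e)"
        if "x \<in> ball a e" "t \<in> cbox 0 1" for x t
        unfolding fx by (rule has_derivative_at_withinI[OF der]) (use that in auto)
      show "(\<lambda>t. t ^ m * F (a + t *\<^sub>R (x - a))) integrable_on cbox 0 1" if "x \<in> ball a e" for x
        by (intro integrable_continuous continuous_intros continuous_on_compose2[OF cF])
          (use inb that in auto)
    qed (use c1 x in auto)
    moreover have "integral (cbox 0 1) (?fx x) v =
       (\<Sum>b\<in>Basis. (v \<bullet> b) * integral {0..1} (\<lambda>t. t ^ Suc m * ?D b (a + t *\<^sub>R (x - a))))" for v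
    proof -
      have ci: "continuous_on (cbox 0 1) (\<lambda>t. t ^ Suc m * ?D b (a + t *\<^sub>R (x - a)))" for b
        by (intro continuous_intros continuous_on_compose2[OF cD]) (use inb x in auto)
      have cfx: "continuous_on (cbox 0 1) (?fx x)"
        by (intro continuous_on_sum continuous_on_scaleR ci continuous_on_const)
      have "blinfun_apply (integral (cbox 0 1) (?fx x)) v = integral (cbox 0 1) (\<lambda>t. blinfun_apply (?fx x t) v)"
        using blinfun_apply_integral[OF integrable_continuous[OF cfx]] by blast
      also have "\<dots> = integral (cbox 0 1) (\<lambda>t. \<Sum>b\<in>Basis. (v \<bullet> b) * (t ^ Suc m * ?D b (a + t *\<^sub>R (x - a))))"
        unfolding fx by (simp add: algebra_simps)
      also have "\<dots> = (\<Sum>b\<in>Basis. integral (cbox 0 1) (\<lambda>t. (v \<bullet> b) * (t ^ Suc m * ?D b (a + t *\<^sub>R (x - a)))))"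
        by (intro integral_sum integrable_continuous continuous_on_mult continuous_on_const ci) auto
      finally show ?thesis by simp
    qed
    ultimately have "((\<lambda>x. integral (cbox 0 1) (\<lambda>t. t ^ m * F (a + t *\<^sub>R (x - a)))) has_derivative
      (\<lambda>v. \<Sum>b\<in>Basis. (v \<bullet> b) * integral {0..1} (\<lambda>t. t ^ Suc m * ?D b (a + t *\<^sub>R (x - a))))) (at x within ball a e)"
      by (metis (no_types, lifting) has_derivative_eq_rhs ext)
    then show ?thesis
      using x by (simp add: at_within_open[OF x])
  qed
  show ?case
  proof (rule Ck_on_SucI[OF open_ball *])
    have "Ck_on k (ball a e) (\<lambda>x. \<Sum>b\<in>Basis. (v \<bullet> b) *\<^sub>R integral {0..1} (\<lambda>t. t ^ Suc m * ?D b (a + t *\<^sub>R (x - a))))" for v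
      by (intro Ck_on_sum Ck_on_scaleR Ck_on_const Suc.IH open_ball smooth_on_derivative Suc.prems)
    then show "Ck_on k (ball a e) (\<lambda>x. \<Sum>b\<in>Basis. (v \<bullet> b) * integral {0..1} (\<lambda>t. t ^ Suc m * ?D b (a + t *\<^sub>R (x - a))))" for v
      by simp
  qed
qed

lemma linear_axis_expansion:
  fixes L :: "real ^ 'n::finite \<Rightarrow> real"
  assumes "linear L"
  shows "L w = (\<Sum>i\<in>UNIV. w $ i * L (axis i 1))"
proof -
  have "L w = L (\<Sum>i\<in>UNIV. w $ i *\<^sub>R axis i 1)"
    using basis_expansion[of w] by (simp add: scalar_mult_eq_scaleR)
  also have "\<dots> = (\<Sum>i\<in>UNIV. w $ i * L (axis i 1))"
    by (simp add: linear_sum[OF assms] linear_scale[OF assms])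
  finally show ?thesis .
qed

text \<open>
  Integrate the derivative of \<open>f\<close> along the ray from \<open>a\<close> to \<open>x\<close>. The point of the lemma is that
  the coefficients \<open>G i\<close> are again smooth, so that a derivation can be applied to the product
  \<open>(x $ i - a $ i) * G i x\<close>.
\<close>
lemma hadamard:
  fixes f :: "real ^ 'n::finite \<Rightarrow> real"
  assumes "smooth_on (ball a e) f" "e > 0"
  obtains G where "\<And>i. smooth_on (ball a e) (G i)"
    "\<And>x. x \<in> ball a e \<Longrightarrow> f x = f a + (\<Sum>i\<in>UNIV. (x $ i - a $ i) * G i x)"
    "\<And>i. G i a = frechet_derivative f (at a) (axis i 1)"
proof
  let ?D = "\<lambda>i x. frechet_derivative f (at x) (axis i 1)"
  let ?G = "\<lambda>i x. integral {0..1} (\<lambda>t. t ^ 0 * ?D i (a + t *\<^sub>R (x - a)))"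
  show "smooth_on (ball a e) (?G i)" for i
    unfolding smooth_on_def
    using Ck_on_ray_integral[OF smooth_on_derivative[OF assms(1)], of _ 0] by blast
  show "?G i a = ?D i a" for i by simp
  fix x assume x: "x \<in> ball a e"
  have inb: "a + t *\<^sub>R (x - a) \<in> ball a e" if "t \<in> {0..1}" for t
    using x that by (rule ray_in_ball)
  have cD: "continuous_on (ball a e) (?D b)" for b
    using assms(1) smooth_on_derivative smooth_on_continuous_on by blast
  have ci: "continuous_on {0..1} (\<lambda>t. ?D i (a + t *\<^sub>R (x - a)))" for i
    by (intro continuous_intros continuous_on_compose2[OF cD]) (use inb in auto)
  have "((\<lambda>t. f (a + t *\<^sub>R (x - a))) has_vector_derivative
     (\<Sum>i\<in>UNIV. (x $ i - a $ i) * ?D i (a + t *\<^sub>R (x - a)))) (at t within {0..1})"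
    if "t \<in> {0..1}" for t
  proof -
    let ?y = "a + t *\<^sub>R (x - a)"
    have F: "(f has_derivative frechet_derivative f (at ?y)) (at ?y)"
      using smooth_on_has_derivative[OF assms(1) inb[OF that]] .
    have lin: "linear (frechet_derivative f (at ?y))"
      using F has_derivative_linear by blast
    have rep: "frechet_derivative f (at ?y) (x - a) = (\<Sum>i\<in>UNIV. (x $ i - a $ i) * ?D i ?y)"
      by (subst linear_axis_expansion[OF lin]) simp
    have "((\<lambda>t. f (a + t *\<^sub>R (x - a))) has_derivative
       (\<lambda>h. frechet_derivative f (at ?y) (h *\<^sub>R (x - a)))) (at t)"
      by (rule has_derivative_compose[where f="\<lambda>t. a + t *\<^sub>R (x - a)" and g=f, OF _ F])
        (auto intro!: derivative_eq_intros)
    then show ?thesis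
      unfolding has_vector_derivative_def linear_scale[OF lin] rep
      by (rule has_derivative_at_withinI)
  qed
  then have "((\<lambda>t. \<Sum>i\<in>UNIV. (x $ i - a $ i) * ?D i (a + t *\<^sub>R (x - a))) has_integral
     f (a + 1 *\<^sub>R (x - a)) - f (a + 0 *\<^sub>R (x - a))) {0..1}"
    by (intro fundamental_theorem_of_calculus) auto
  then have "f x - f a = integral {0..1} (\<lambda>t. \<Sum>i\<in>UNIV. (x $ i - a $ i) * ?D i (a + t *\<^sub>R (x - a)))"
    by (simp add: integral_unique)
  also have "\<dots> = (\<Sum>i\<in>UNIV. integral {0..1} (\<lambda>t. (x $ i - a $ i) * ?D i (a + t *\<^sub>R (x - a))))"
    by (intro integral_sum integrable_continuous_real continuous_on_mult continuous_on_const ci) auto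
  finally show "f x = f a + (\<Sum>i\<in>UNIV. (x $ i - a $ i) * ?G i x)" by simp
qed

section \<open>Smooth functions and bump functions on a manifold\<close>

context smooth_manifold
begin

lemma inj_on_chart: "(U, \<phi>) \<in> A \<Longrightarrow> inj_on \<phi> U"
  by (rule inj_on_inverseI[where g="inv_into U \<phi>"]) (rule homeomorphism_apply1[OF chart_homeomorphism])

lemma chart_inverse [simp]: "(U, \<phi>) \<in> A \<Longrightarrow> p \<in> U \<Longrightarrow> inv_into U \<phi> (\<phi> p) = p"
  using inj_on_chart by simp

lemma open_chart_image:
  assumes "(U, \<phi>) \<in> A" "open W" "W \<subseteq> U"
  shows "open (\<phi> ` W)"
proof -
  have "openin (top_of_set U) W"
    using assms by (simp add: open_subset)
  then have "openin (top_of_set (\<phi> ` U)) (\<phi> ` W)"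
    using homeomorphism_imp_open_map[OF chart_homeomorphism[OF assms(1)]] by blast
  then show ?thesis
    using chart_open[OF assms(1)] openin_open_trans by blast
qed

lemma open_chart_preimage:
  assumes "(U, \<phi>) \<in> A" "open X"
  shows "open (U \<inter> \<phi> -` X)"
  using chart_homeomorphism[OF assms(1)] chart_open[OF assms(1)] assms(2)
  by (metis continuous_on_open_vimage homeomorphism_cont1 inf_commute)

lemma chart_at: obtains U \<phi> where "(U, \<phi>) \<in> A" "p \<in> U"
  using charts_cover by (metis (no_types, lifting) UNIV_I UN_iff case_prodE split_conv prod.collapse)

lemma smooth_function_chart:
  "f \<in> smooth_functions A \<Longrightarrow> (U, \<phi>) \<in> A \<Longrightarrow> smooth_on (\<phi> ` U) (f \<circ> inv_into U \<phi>)"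
  by (auto simp: smooth_functions_def)

text \<open>
  Composition with the transition map, which is smooth as the atlas is compatible.
\<close>
lemma smooth_on_change_chart:
  assumes "(U, \<phi>) \<in> A" "(V, \<psi>) \<in> A" "open W" "W \<subseteq> U" "W \<subseteq> V"
    and "smooth_on (\<phi> ` W) (f \<circ> inv_into U \<phi>)"
  shows "smooth_on (\<psi> ` W) (f \<circ> inv_into V \<psi>)"
proof -
  have "smooth_on (\<psi> ` W) (\<phi> \<circ> inv_into V \<psi>)"
    using chart_compatible[OF assms(2,1)] smooth_on_subset assms(4,5) by blast
  then have "smooth_on (\<psi> ` W) (\<lambda>x. (f \<circ> inv_into U \<phi>) ((\<phi> \<circ> inv_into V \<psi>) x))"
  proof (rule smooth_on_compose[OF assms(6)])
    show "(\<phi> \<circ> inv_into V \<psi>) ` \<psi> ` W \<subseteq> \<phi> ` W"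
      using assms by (auto simp: subset_eq)
    show "open (\<psi> ` W)" "open (\<phi> ` W)"
      using assms open_chart_image by blast+
  qed
  then show ?thesis
    by (rule smooth_on_cong) (use assms open_chart_image in \<open>auto simp: subset_eq\<close>)
qed

text \<open>
  Smoothness is local and does not depend on the chart, so one chart around each point will do; the
  definition of \<open>smooth_functions\<close> asks for all charts.
\<close>
lemma smooth_functionI_chartwise:
  assumes "\<And>p. \<exists>U \<phi> W. (U, \<phi>) \<in> A \<and> open W \<and> p \<in> W \<and> W \<subseteq> U \<and> smooth_on (\<phi> ` W) (f \<circ> inv_into U \<phi>)"
  shows "f \<in> smooth_functions A"
proof -
  have "smooth_on (\<psi> ` V) (f \<circ> inv_into V \<psi>)" if V: "(V, \<psi>) \<in> A" for V \<psi>
  proof (rule smooth_on_local)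
    fix y assume "y \<in> \<psi> ` V"
    then obtain p where p: "p \<in> V" "y = \<psi> p" by blast
    obtain U \<phi> W where W: "(U, \<phi>) \<in> A" "open W" "p \<in> W" "W \<subseteq> U" "smooth_on (\<phi> ` W) (f \<circ> inv_into U \<phi>)"
      using assms by blast
    have "open (W \<inter> V)" using W chart_open[OF V] by blast
    moreover have "smooth_on (\<psi> ` (W \<inter> V)) (f \<circ> inv_into V \<psi>)"
      by (rule smooth_on_change_chart[OF W(1) V])
        (use W \<open>open (W \<inter> V)\<close> in \<open>auto intro: smooth_on_subset\<close>)
    ultimately show "\<exists>N. open N \<and> y \<in> N \<and> smooth_on N (f \<circ> inv_into V \<psi>)"
      using p W open_chart_image[OF V] by (intro exI[of _ "\<psi> ` (W \<inter> V)"]) auto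
  qed
  then show ?thesis unfolding smooth_functions_def by blast
qed

lemma smooth_functionI_local:
  assumes "\<And>p. \<exists>W h. open W \<and> p \<in> W \<and> h \<in> smooth_functions A \<and> (\<forall>q\<in>W. f q = h q)"
  shows "f \<in> smooth_functions A"
proof (rule smooth_functionI_chartwise)
  fix p
  obtain W h where W: "open W" "p \<in> W" "h \<in> smooth_functions A" "\<forall>q\<in>W. f q = h q"
    using assms[of p] by blast
  obtain U \<phi> where U: "(U, \<phi>) \<in> A" "p \<in> U" by (rule chart_at)
  have o: "open (W \<inter> U)" using W chart_open[OF U(1)] by blast
  have "smooth_on (\<phi> ` (W \<inter> U)) (h \<circ> inv_into U \<phi>)"
    using smooth_function_chart[OF W(3) U(1)] by (rule smooth_on_subset) auto
  then have "smooth_on (\<phi> ` (W \<inter> U)) (f \<circ> inv_into U \<phi>)"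
    by (rule smooth_on_cong) (use W U o open_chart_image in auto)
  then show "\<exists>U \<phi> W. (U, \<phi>) \<in> A \<and> open W \<and> p \<in> W \<and> W \<subseteq> U \<and> smooth_on (\<phi> ` W) (f \<circ> inv_into U \<phi>)"
    using U W o by blast
qed

lemma smooth_function_const [simp]: "(\<lambda>p. c) \<in> smooth_functions A"
  by (auto simp: smooth_functions_def o_def smooth_on_const)

lemma smooth_function_add [intro]:
  "f \<in> smooth_functions A \<Longrightarrow> h \<in> smooth_functions A \<Longrightarrow> (\<lambda>p. f p + h p) \<in> smooth_functions A"
  using chart_open by (auto simp: smooth_functions_def o_def intro!: smooth_on_add)

lemma smooth_function_mult [intro]:
  "f \<in> smooth_functions A \<Longrightarrow> h \<in> smooth_functions A \<Longrightarrow> (\<lambda>p. f p * h p) \<in> smooth_functions A"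
  using chart_open by (auto simp: smooth_functions_def o_def intro!: smooth_on_mult)

lemma smooth_function_diff [intro]:
  assumes "f \<in> smooth_functions A" "h \<in> smooth_functions A"
  shows "(\<lambda>p. f p - h p) \<in> smooth_functions A"
  using smooth_function_add[OF assms(1) smooth_function_mult[OF smooth_function_const[of "-1"] assms(2)]]
  by simp

lemma smooth_function_sum [intro]:
  "(\<And>i. i \<in> I \<Longrightarrow> f i \<in> smooth_functions A) \<Longrightarrow> (\<lambda>p. \<Sum>i\<in>I. f i p) \<in> smooth_functions A"
  by (induction I rule: infinite_finite_induct) auto

lemma smooth_function_prod [intro]:
  "(\<And>i. i \<in> I \<Longrightarrow> f i \<in> smooth_functions A) \<Longrightarrow> (\<lambda>p. \<Prod>i\<in>I. f i p) \<in> smooth_functions A"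
  by (induction I rule: infinite_finite_induct) auto

lemma smooth_function_continuous:
  assumes "f \<in> smooth_functions A"
  shows "continuous_on UNIV f"
proof (rule continuous_at_imp_continuous_on, rule)
  fix p
  obtain U \<phi> where U: "(U, \<phi>) \<in> A" "p \<in> U" by (rule chart_at)
  have "continuous_on U \<phi>"
    using chart_homeomorphism[OF U(1)] by (rule homeomorphism_cont1)
  then have "continuous_on U (\<lambda>q. (f \<circ> inv_into U \<phi>) (\<phi> q))"
    by (rule continuous_on_compose2[OF smooth_on_continuous_on[OF smooth_function_chart[OF assms U(1)]]]) auto
  then have "continuous_on U f"
    by (rule continuous_on_eq) (use U in auto)
  then show "isCont f p"
    using U chart_open[OF U(1)] by (simp add: continuous_on_eq_continuous_at)
qed

text \<open>
  The complement of the support has to be open for locality arguments at its points.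
\<close>
definition supp :: "('a \<Rightarrow> real) \<Rightarrow> 'a set" where
  "supp f = closure {p. f p \<noteq> 0}"

lemma supp_zero: "p \<notin> supp f \<Longrightarrow> f p = 0"
  using closure_subset by (force simp: supp_def)

lemma supp_closed: "closed (supp f)"
  by (simp add: supp_def)

lemma supp_subset: "(\<And>p. f p \<noteq> 0 \<Longrightarrow> p \<in> K) \<Longrightarrow> closed K \<Longrightarrow> supp f \<subseteq> K"
  unfolding supp_def by (rule closure_minimal) auto

lemma compact_supp:
  assumes "\<And>p. f p \<noteq> 0 \<Longrightarrow> p \<in> K" "compact K"
  shows "compact (supp f)"
  using supp_subset[OF assms(1) compact_imp_closed[OF assms(2)]] assms(2)
  by (metis compact_Int_closed inf.absorb2 supp_closed)

lemma smooth_function_chart_supported: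
  assumes U: "(U, \<phi>) \<in> A" and N: "open N" "N \<subseteq> U" and f: "smooth_on (\<phi> ` N) (f \<circ> inv_into U \<phi>)" "supp f \<subseteq> N"
  shows "f \<in> smooth_functions A"
proof (rule smooth_functionI_chartwise)
  fix p
  show "\<exists>U \<phi> W. (U, \<phi>) \<in> A \<and> open W \<and> p \<in> W \<and> W \<subseteq> U \<and> smooth_on (\<phi> ` W) (f \<circ> inv_into U \<phi>)"
  proof (cases "p \<in> N")
    case True
    then show ?thesis using U N f by blast
  next
    case False
    then have p: "p \<notin> supp f" using f by blast
    obtain V \<psi> where V: "(V, \<psi>) \<in> A" "p \<in> V" by (rule chart_at)
    let ?W = "V - supp f"
    have o: "open ?W" using V chart_open[OF V(1)] supp_closed by blast
    have "smooth_on (\<psi> ` ?W) (\<lambda>x. 0 :: real)" by (rule smooth_on_const)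
    then have "smooth_on (\<psi> ` ?W) (f \<circ> inv_into V \<psi>)"
      by (rule smooth_on_cong) (use V open_chart_image[OF V(1) o] supp_zero in auto)
    then show ?thesis using V o p by blast
  qed
qed

text \<open>
  This is how global smooth functions are made from coordinate expressions. At the border of \<open>N\<close>
  nothing can go wrong because \<open>\<eta>\<close> is supported in \<open>N\<close>.
\<close>
lemma smooth_function_chart_extend:
  assumes U: "(U, \<phi>) \<in> A" and N: "open N" "N \<subseteq> U" and u: "smooth_on (\<phi> ` N) u"
    and \<eta>: "\<eta> \<in> smooth_functions A" "supp \<eta> \<subseteq> N"
  shows "(\<lambda>p. if p \<in> N then \<eta> p * u (\<phi> p) else 0) \<in> smooth_functions A" (is "?f \<in> _")
proof (rule smooth_function_chart_supported[OF U N])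
  have "smooth_on (\<phi> ` N) (\<eta> \<circ> inv_into U \<phi>)"
    using smooth_function_chart[OF \<eta>(1) U] by (rule smooth_on_subset) (use N in auto)
  then have "smooth_on (\<phi> ` N) (\<lambda>x. (\<eta> \<circ> inv_into U \<phi>) x * u x)"
    by (intro smooth_on_mult u open_chart_image[OF U] N)
  then show "smooth_on (\<phi> ` N) (?f \<circ> inv_into U \<phi>)"
    by (rule smooth_on_cong) (use N U open_chart_image[OF U N] in \<open>auto simp: subset_eq\<close>)
  have "supp ?f \<subseteq> supp \<eta>"
    by (rule supp_subset) (use supp_zero supp_closed in \<open>force split: if_splits\<close>)+
  then show "supp ?f \<subseteq> N" using \<eta>(2) by blast
qed

text \<open>
  The bump of Euclidean space is transported by a chart. As the space is Hausdorff, the compact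
  image of the closed ball is closed, so extension by zero does not spoil smoothness at the border
  of the chart domain. The chart is reported because the bumps are used to localise to charts.
\<close>
lemma smooth_bump_at:
  assumes "open N" "p \<in> N"
  obtains \<eta> W U \<phi> where "\<eta> \<in> smooth_functions A" "\<And>q. 0 \<le> \<eta> q" "\<And>q. \<eta> q \<le> 1"
    "open W" "p \<in> W" "W \<subseteq> N" "\<And>q. q \<in> W \<Longrightarrow> \<eta> q = 1"
    "compact (supp \<eta>)" "supp \<eta> \<subseteq> N" "(U, \<phi>) \<in> A" "supp \<eta> \<subseteq> U"
proof -
  obtain U \<phi> where U: "(U, \<phi>) \<in> A" "p \<in> U" by (rule chart_at)
  have o: "open (U \<inter> N)" using U chart_open[OF U(1)] assms by blast
  then have "open (\<phi> ` (U \<inter> N))" by (intro open_chart_image[OF U(1)]) auto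
  \<comment> \<open>Closed balls are compact, so the support stays away from the border of the chart domain.\<close>
  then obtain e where e: "e > 0" "cball (\<phi> p) e \<subseteq> \<phi> ` (U \<inter> N)"
    using U assms open_contains_cball by blast
  obtain b where b: "smooth_on UNIV b" "\<And>x. 0 \<le> b x" "\<And>x. b x \<le> (1::real)"
    "\<And>x. dist (\<phi> p) x \<le> e / 2 \<Longrightarrow> b x = 1" "\<And>x. dist (\<phi> p) x \<ge> 2 * (e / 2) \<Longrightarrow> b x = 0"
    by (rule euclidean_bump[of "e / 2" "\<phi> p"]) (use e in auto)
  let ?\<eta> = "\<lambda>q. if q \<in> U then b (\<phi> q) else 0"
  let ?K = "inv_into U \<phi> ` cball (\<phi> p) e"
  let ?W = "U \<inter> \<phi> -` ball (\<phi> p) (e / 2)"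
  have K: "compact ?K"
  proof (rule compact_continuous_image)
    show "continuous_on (cball (\<phi> p) e) (inv_into U \<phi>)"
      by (rule continuous_on_subset[OF homeomorphism_cont2[OF chart_homeomorphism[OF U(1)]]]) (use e in auto)
  qed simp
  have KN: "?K \<subseteq> U \<inter> N"
    using e(2) U(1) by (auto simp: subset_eq)
  have nz: "q \<in> ?K" if "?\<eta> q \<noteq> 0" for q
  proof -
    have "q \<in> U" "\<not> dist (\<phi> p) (\<phi> q) \<ge> e"
      using that b(5)[of "\<phi> q"] by (auto split: if_splits)
    then have "q \<in> U" "\<phi> q \<in> cball (\<phi> p) e" by auto
    then show ?thesis using U by (metis chart_inverse imageI)
  qed
  have s: "supp ?\<eta> \<subseteq> ?K" by (rule supp_subset[OF nz]) (use K compact_imp_closed in auto)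
  have sU: "supp ?\<eta> \<subseteq> U" and sN: "supp ?\<eta> \<subseteq> N" using s KN by (meson le_inf_iff order_trans)+
  have sm: "?\<eta> \<in> smooth_functions A"
  proof (rule smooth_function_chart_supported[OF U(1) _ subset_refl _ sU])
    have "smooth_on (\<phi> ` U) b" using b(1) smooth_on_subset by blast
    then show "smooth_on (\<phi> ` U) (?\<eta> \<circ> inv_into U \<phi>)"
      by (rule smooth_on_cong) (use U chart_open[OF U(1)] in auto)
  qed (use chart_open[OF U(1)] in blast)
  show thesis
  proof
    show "?\<eta> \<in> smooth_functions A" by (rule sm)
    show "open ?W" by (rule open_chart_preimage[OF U(1)]) simp
    show "?W \<subseteq> N"
    proof
      fix q assume q: "q \<in> ?W"
      then have "?\<eta> q \<noteq> 0" using b(4)[of "\<phi> q"] by auto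
      then show "q \<in> N" using nz KN by blast
    qed
    show "compact (supp ?\<eta>)" by (rule compact_supp[OF nz K])
    show "(U, \<phi>) \<in> A" by (rule U)
    show "supp ?\<eta> \<subseteq> U" "supp ?\<eta> \<subseteq> N" by (rule sU, rule sN)
  qed (use U e b in auto)
qed

text \<open>
  This induction rule replaces partitions of unity: to prove an additive property of compactly
  supported functions it is enough to consider functions that are supported in a chart domain. Finitely
  many bumps \<open>b\<close> are such that at each point of the support one of them is 1; splitting off
  \<open>b * f\<close> leaves \<open>(1 - b) * f\<close>, for which the remaining bumps do.
\<close>
lemma smooth_partition_induct:
  assumes f: "f \<in> smooth_functions A" "compact (supp f)"
    and chart: "\<And>f U \<phi>. f \<in> smooth_functions A \<Longrightarrow> compact (supp f) \<Longrightarrow> (U, \<phi>) \<in> A \<Longrightarrow> supp f \<subseteq> U \<Longrightarrow> P f"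
    and add: "\<And>f h. f \<in> smooth_functions A \<Longrightarrow> h \<in> smooth_functions A \<Longrightarrow> P f \<Longrightarrow> P h \<Longrightarrow> P (\<lambda>p. f p + h p)"
  shows "P f"
proof -
  let ?good = "\<lambda>b W. b \<in> smooth_functions A \<and> open W \<and> (\<forall>q\<in>W. b q = 1) \<and>
     compact (supp b) \<and> (\<exists>U \<phi>. (U, \<phi>) \<in> A \<and> supp b \<subseteq> U)"
  have "\<forall>p. \<exists>b W. p \<in> W \<and> ?good b W"
  proof
    fix p
    show "\<exists>b W. p \<in> W \<and> ?good b W"
      by (rule smooth_bump_at[of UNIV p]) blast+
  qed
  then obtain b W where bW: "\<And>p. p \<in> W p" "\<And>p. ?good (b p) (W p)" by metis
  obtain I where I: "finite I" "supp f \<subseteq> (\<Union>p\<in>I. W p)"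
    using compactE_image[OF f(2), of UNIV W] bW by (metis UNIV_I UN_iff subsetI)
  have "f \<in> smooth_functions A \<Longrightarrow> (\<And>q. f q \<noteq> 0 \<Longrightarrow> \<exists>p\<in>I. b p q = 1) \<Longrightarrow> P f" for f
    using I(1)
  proof (induction I arbitrary: f)
    case empty
    then have "f = (\<lambda>q. 0)" by auto
    moreover obtain U \<phi> where "(U, \<phi>) \<in> A" by (rule chart_at)
    ultimately show ?case using chart[of f U \<phi>] by (simp add: supp_def)
  next
    case (insert p I)
    have bp: "b p \<in> smooth_functions A" "compact (supp (b p))" using bW by blast+
    obtain U \<phi> where U: "(U, \<phi>) \<in> A" "supp (b p) \<subseteq> U" using bW by blast
    have s: "q \<in> supp (b p)" if "b p q * f q \<noteq> 0" for q
      using that supp_zero by fastforce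
    have b': "(\<lambda>q. (1 - b p q) * f q) \<in> smooth_functions A"
      by (intro smooth_function_mult smooth_function_diff smooth_function_const bp(1) insert.prems(1))
    have "P (\<lambda>q. b p q * f q)"
    proof (rule chart)
      show "(U, \<phi>) \<in> A" by (rule U)
      show "supp (\<lambda>q. b p q * f q) \<subseteq> U"
        by (rule order_trans[OF supp_subset[OF s supp_closed] U(2)])
      show "compact (supp (\<lambda>q. b p q * f q))" by (rule compact_supp[OF s bp(2)])
    qed (use bp insert.prems in blast)
    moreover have "P (\<lambda>q. (1 - b p q) * f q)"
    proof (rule insert.IH)
      show "(\<lambda>q. (1 - b p q) * f q) \<in> smooth_functions A" by (rule b')
      show "\<exists>p\<in>I. b p q = 1" if "(1 - b p q) * f q \<noteq> 0" for q
        using that insert.prems(2)[of q] by auto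
    qed
    ultimately have "P (\<lambda>q. b p q * f q + (1 - b p q) * f q)"
      by (intro add smooth_function_mult bp(1) b' insert.prems(1))
    then show ?case by (simp add: algebra_simps)
  qed
  moreover have "\<exists>p\<in>I. b p q = 1" if "f q \<noteq> 0" for q
    using that I(2) bW supp_zero[of q f] by blast
  ultimately show ?thesis using f(1) by blast
qed

text \<open>
  With bumps \<open>b\<close> around finitely many points of \<open>K\<close>, the function \<open>1 - (\<Prod>b. 1 - b)\<close> is 1 wherever
  one of the bumps is.
\<close>
lemma smooth_bump_compact:
  assumes "compact K" "K \<subseteq> N" "open N"
  obtains \<eta> W where "\<eta> \<in> smooth_functions A" "open W" "K \<subseteq> W" "W \<subseteq> N"
    "\<And>q. q \<in> W \<Longrightarrow> \<eta> q = 1" "compact (supp \<eta>)" "supp \<eta> \<subseteq> N"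
proof -
  let ?good = "\<lambda>b W. b \<in> smooth_functions A \<and> open W \<and> W \<subseteq> N \<and> (\<forall>q\<in>W. b q = 1) \<and>
     compact (supp b) \<and> supp b \<subseteq> N"
  have "\<forall>p\<in>K. \<exists>b W. p \<in> W \<and> ?good b W"
  proof
    fix p assume "p \<in> K"
    then have "p \<in> N" using assms by blast
    then show "\<exists>b W. p \<in> W \<and> ?good b W"
      by (rule smooth_bump_at[OF assms(3)]) blast+
  qed
  then obtain b W where bW: "\<And>p. p \<in> K \<Longrightarrow> p \<in> W p" "\<And>p. p \<in> K \<Longrightarrow> ?good (b p) (W p)" by metis
  obtain I where I: "I \<subseteq> K" "finite I" "K \<subseteq> (\<Union>p\<in>I. W p)"
    by (rule compactE_image[OF assms(1), of K W]) (use bW in blast)+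
  let ?\<eta> = "\<lambda>q. 1 - (\<Prod>p\<in>I. 1 - b p q)"
  have s: "q \<in> (\<Union>p\<in>I. supp (b p))" if "?\<eta> q \<noteq> 0" for q
  proof (rule ccontr)
    assume "q \<notin> (\<Union>p\<in>I. supp (b p))"
    then have "\<forall>p\<in>I. b p q = 0" using supp_zero by blast
    then show False using that by simp
  qed
  have c: "compact (\<Union>p\<in>I. supp (b p))"
    using I bW by (intro compact_UN) auto
  show thesis
  proof
    show "?\<eta> \<in> smooth_functions A"
      using bW I by (intro smooth_function_diff smooth_function_prod smooth_function_const) auto
    show "open (\<Union>p\<in>I. W p)" "(\<Union>p\<in>I. W p) \<subseteq> N" using bW I by blast+
    show "K \<subseteq> (\<Union>p\<in>I. W p)" by (rule I)
    show "?\<eta> q = 1" if q: "q \<in> (\<Union>p\<in>I. W p)" for q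
    proof -
      obtain p where "p \<in> I" "q \<in> W p" using q by blast
      then have "p \<in> I" "1 - b p q = 0" using bW(2)[of p] I(1) by auto
      then have "(\<Prod>p\<in>I. 1 - b p q) = 0" by (intro prod_zero I(2)) blast
      then show ?thesis by simp
    qed
    show "compact (supp ?\<eta>)" by (rule compact_supp[OF s c])
    have "supp ?\<eta> \<subseteq> (\<Union>p\<in>I. supp (b p))" by (rule supp_subset[OF s compact_imp_closed[OF c]])
    then show "supp ?\<eta> \<subseteq> N" using bW I by blast
  qed
qed

section \<open>Vector fields, one-forms and coordinates\<close>

lemma vector_fieldD:
  assumes "X \<in> vector_fields A"
  shows vector_field_smooth: "h \<in> smooth_functions A \<Longrightarrow> X h \<in> smooth_functions A"
    and vector_field_nonsmooth: "h \<notin> smooth_functions A \<Longrightarrow> X h = (\<lambda>p. 0)"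
    and vector_field_add: "h \<in> smooth_functions A \<Longrightarrow> k \<in> smooth_functions A \<Longrightarrow>
      X (\<lambda>p. h p + k p) = (\<lambda>p. X h p + X k p)"
    and vector_field_scale: "h \<in> smooth_functions A \<Longrightarrow> X (\<lambda>p. c * h p) = (\<lambda>p. c * X h p)"
    and vector_field_mult: "h \<in> smooth_functions A \<Longrightarrow> k \<in> smooth_functions A \<Longrightarrow>
      X (\<lambda>p. h p * k p) = (\<lambda>p. X h p * k p + h p * X k p)"
  using assms unfolding vector_fields_def by blast+

text \<open>
  If \<open>\<eta>\<close> is a bump at \<open>p\<close> supported in \<open>N\<close>, then \<open>\<eta> * h = \<eta> * k\<close>; the product rule at \<open>p\<close> turns
  this into the claim.
\<close>
lemma vector_field_local:
  assumes X: "X \<in> vector_fields A" and h: "h \<in> smooth_functions A" "k \<in> smooth_functions A"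
    and N: "open N" "p \<in> N" "\<And>q. q \<in> N \<Longrightarrow> h q = k q"
  shows "X h p = X k p"
proof -
  obtain \<eta> W U \<phi> where \<eta>: "\<eta> \<in> smooth_functions A" "p \<in> W" "\<And>q. q \<in> W \<Longrightarrow> \<eta> q = 1" "supp \<eta> \<subseteq> N"
    by (rule smooth_bump_at[OF N(1,2)]) blast
  have eq: "(\<lambda>q. \<eta> q * h q) = (\<lambda>q. \<eta> q * k q)"
  proof
    fix q show "\<eta> q * h q = \<eta> q * k q"
      using supp_zero[of q \<eta>] \<eta>(4) N(3)[of q] by (cases "q \<in> supp \<eta>") auto
  qed
  have "X \<eta> p * h p + \<eta> p * X h p = X \<eta> p * k p + \<eta> p * X k p"
    using vector_field_mult[OF X \<eta>(1) h(1)] vector_field_mult[OF X \<eta>(1) h(2)] eq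
    by (metis (no_types, lifting))
  then show ?thesis using \<eta>(2,3) N by simp
qed

lemma vector_field_const:
  assumes "X \<in> vector_fields A"
  shows "X (\<lambda>p. c) p = 0"
proof -
  have "X (\<lambda>p. 1 * 1) = (\<lambda>p. X (\<lambda>p. 1) p * 1 + 1 * X (\<lambda>p. 1) p)"
    by (rule vector_field_mult[OF assms]) auto
  then have "X (\<lambda>p. 1) p = X (\<lambda>p. 1) p * 1 + 1 * X (\<lambda>p. 1) p"
    by (simp add: fun_eq_iff)
  then have "X (\<lambda>p. 1) p = 0" by simp
  moreover have "X (\<lambda>p. c * 1) = (\<lambda>p. c * X (\<lambda>p. 1) p)"
    by (rule vector_field_scale[OF assms]) auto
  ultimately show ?thesis by simp
qed

lemma vector_field_sum:
  assumes "X \<in> vector_fields A" "\<And>i. i \<in> I \<Longrightarrow> f i \<in> smooth_functions A"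
  shows "X (\<lambda>p. \<Sum>i\<in>I. f i p) p = (\<Sum>i\<in>I. X (f i) p)"
  using assms(2)
proof (induction I rule: infinite_finite_induct)
  case (insert i I)
  then have "X (\<lambda>p. f i p + (\<Sum>i\<in>I. f i p)) = (\<lambda>p. X (f i) p + X (\<lambda>p. \<Sum>i\<in>I. f i p) p)"
    by (intro vector_field_add[OF assms(1)]) auto
  then show ?case using insert by simp
qed (simp_all add: vector_field_const[OF assms(1)])

lemma vector_fields_fadd [intro]:
  assumes "X \<in> vector_fields A" "Y \<in> vector_fields A"
  shows "fadd X Y \<in> vector_fields A"
  unfolding vector_fields_def fadd_def
  using assms
  by (auto simp: vector_field_nonsmooth vector_field_add vector_field_scale vector_field_mult
      vector_field_smooth algebra_simps)

lemma vector_fields_fscale [intro]: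
  assumes "f \<in> smooth_functions A" "X \<in> vector_fields A"
  shows "fscale f X \<in> vector_fields A"
  unfolding vector_fields_def fscale_def
  using assms
  by (auto simp: vector_field_nonsmooth vector_field_add vector_field_scale vector_field_mult
      vector_field_smooth algebra_simps)

lemma one_formD:
  assumes "\<alpha> \<in> one_forms A"
  shows one_form_smooth: "X \<in> vector_fields A \<Longrightarrow> \<alpha> X \<in> smooth_functions A"
    and one_form_outside: "X \<notin> vector_fields A \<Longrightarrow> \<alpha> X = (\<lambda>p. 0)"
    and one_form_add: "X \<in> vector_fields A \<Longrightarrow> Y \<in> vector_fields A \<Longrightarrow>
      \<alpha> (fadd X Y) = (\<lambda>p. \<alpha> X p + \<alpha> Y p)"
    and one_form_scale: "f \<in> smooth_functions A \<Longrightarrow> X \<in> vector_fields A \<Longrightarrow>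
      \<alpha> (fscale f X) = (\<lambda>p. f p * \<alpha> X p)"
  using assms unfolding one_forms_def by blast+

lemma one_forms_fadd [intro]:
  assumes "\<alpha> \<in> one_forms A" "\<beta> \<in> one_forms A"
  shows "fadd \<alpha> \<beta> \<in> one_forms A"
  using assms unfolding one_forms_def fadd_def[of \<alpha> \<beta>]
  by (auto simp: algebra_simps)

lemma one_forms_fscale [intro]:
  assumes "f \<in> smooth_functions A" "\<alpha> \<in> one_forms A"
  shows "fscale f \<alpha> \<in> one_forms A"
  using assms unfolding one_forms_def fscale_def[of f \<alpha>]
  by (auto simp: algebra_simps)

text \<open>
  The guard gives the value zero outside of the vector fields, as required of a one-form.
\<close>
definition differential :: "('a \<Rightarrow> real) \<Rightarrow> 'a oneform" where
  "differential h = (\<lambda>X p. if X \<in> vector_fields A then X h p else 0)"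

lemma differential_one_form [intro]: "h \<in> smooth_functions A \<Longrightarrow> differential h \<in> one_forms A"
  using vector_fields_fadd vector_fields_fscale
  by (auto simp: one_forms_def differential_def fadd_def fscale_def vector_field_smooth)

end

locale coordinate_patch = smooth_manifold A
  for A :: "('a::{t2_space, second_countable_topology}, 'n::finite) chart set" +
  fixes U :: "'a set" and \<phi> :: "'a \<Rightarrow> real ^ 'n" and \<eta> :: "'a \<Rightarrow> real" and N :: "'a set"
  assumes chart: "(U, \<phi>) \<in> A"
    and patch_open: "open N" and patch_subset: "N \<subseteq> U"
    and cutoff_smooth: "\<eta> \<in> smooth_functions A"
    and cutoff_supp: "supp \<eta> \<subseteq> U"
    and cutoff_eq_1: "\<And>q. q \<in> N \<Longrightarrow> \<eta> q = 1"
begin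

text \<open>
  Coordinate functions and coordinate vector fields have to be global objects, so they carry the
  cut-off factor \<open>\<eta>\<close>; on \<open>N\<close>, where \<open>\<eta>\<close> is 1, they are the true ones.
\<close>
definition coord :: "'n \<Rightarrow> 'a \<Rightarrow> real" where
  "coord i = (\<lambda>p. if p \<in> U then \<eta> p * \<phi> p $ i else 0)"

definition partial :: "'n \<Rightarrow> 'a vfield" where
  "partial i = (\<lambda>h p. if h \<in> smooth_functions A \<and> p \<in> U
     then \<eta> p * frechet_derivative (h \<circ> inv_into U \<phi>) (at (\<phi> p)) (axis i 1) else 0)"

lemma coord_smooth: "coord i \<in> smooth_functions A"
  unfolding coord_def
  by (rule smooth_function_chart_extend[OF chart, where u="\<lambda>x. x $ i"])
    (use chart_open[OF chart] cutoff_smooth cutoff_supp in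
      \<open>auto intro!: smooth_on_bounded_linear bounded_linear_vec_nth\<close>)

lemma chart_derivative:
  assumes "h \<in> smooth_functions A" "p \<in> U"
  shows "((h \<circ> inv_into U \<phi>) has_derivative frechet_derivative (h \<circ> inv_into U \<phi>) (at (\<phi> p))) (at (\<phi> p))"
  using smooth_on_has_derivative[OF smooth_function_chart[OF assms(1) chart]] assms(2) by blast

lemma partial_vector_field: "partial i \<in> vector_fields A"
proof -
  have smooth: "partial i h \<in> smooth_functions A" if h: "h \<in> smooth_functions A" for h
  proof -
    let ?u = "\<lambda>x. frechet_derivative (h \<circ> inv_into U \<phi>) (at x) (axis i 1)"
    have "smooth_on (\<phi> ` U) ?u"
      by (rule smooth_on_derivative[OF smooth_function_chart[OF h chart]])
    from smooth_function_chart_extend[OF chart _ _ this cutoff_smooth cutoff_supp]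
    have "(\<lambda>p. if p \<in> U then \<eta> p * ?u (\<phi> p) else 0) \<in> smooth_functions A"
      using chart_open[OF chart] by blast
    then show ?thesis using h by (simp add: partial_def)
  qed
  have add: "partial i (\<lambda>p. h p + k p) p = partial i h p + partial i k p"
    if h: "h \<in> smooth_functions A" and k: "k \<in> smooth_functions A" for h k p
  proof (cases "p \<in> U")
    case True
    have "((\<lambda>p. h p + k p) \<circ> inv_into U \<phi> has_derivative (\<lambda>v.
        frechet_derivative (h \<circ> inv_into U \<phi>) (at (\<phi> p)) v +
        frechet_derivative (k \<circ> inv_into U \<phi>) (at (\<phi> p)) v)) (at (\<phi> p))"
      using has_derivative_add[OF chart_derivative[OF h True] chart_derivative[OF k True]]
      by (simp add: o_def)
    from frechet_derivative_at[OF this, symmetric] show ?thesis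
      using h k True by (auto simp: partial_def algebra_simps)
  qed (simp add: partial_def)
  have mult: "partial i (\<lambda>p. h p * k p) p = partial i h p * k p + h p * partial i k p"
    if h: "h \<in> smooth_functions A" and k: "k \<in> smooth_functions A" for h k p
  proof (cases "p \<in> U")
    case True
    have "((\<lambda>p. h p * k p) \<circ> inv_into U \<phi> has_derivative (\<lambda>v.
        h p * frechet_derivative (k \<circ> inv_into U \<phi>) (at (\<phi> p)) v +
        frechet_derivative (h \<circ> inv_into U \<phi>) (at (\<phi> p)) v * k p)) (at (\<phi> p))"
      using has_derivative_mult[OF chart_derivative[OF h True] chart_derivative[OF k True]] chart True
      by (simp add: o_def)
    from frechet_derivative_at[OF this, symmetric] show ?thesis
      using smooth_function_mult[OF h k] h k True by (simp add: partial_def algebra_simps)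
  qed (simp add: partial_def)
  have const: "partial i (\<lambda>p. c) p = 0" for c p
    by (simp add: partial_def o_def)
  have scale: "partial i (\<lambda>p. c * h p) p = c * partial i h p" if h: "h \<in> smooth_functions A" for c h p
    using mult[OF smooth_function_const h] const by simp
  show ?thesis
    unfolding vector_fields_def
  proof (safe)
    show "partial i h = (\<lambda>p. 0)" if "h \<notin> smooth_functions A" for h
      using that by (simp add: partial_def)
  qed (auto intro!: ext simp: smooth add mult scale const)
qed

lemma partial_on_patch:
  "h \<in> smooth_functions A \<Longrightarrow> p \<in> N \<Longrightarrow>
    partial i h p = frechet_derivative (h \<circ> inv_into U \<phi>) (at (\<phi> p)) (axis i 1)"
  using patch_subset cutoff_eq_1 by (auto simp: partial_def)

lemma coord_on_patch: "p \<in> N \<Longrightarrow> coord i p = \<phi> p $ i"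
  using patch_subset cutoff_eq_1 by (auto simp: coord_def)

lemma partial_coord:
  assumes "p \<in> N"
  shows "partial i (coord j) p = (if i = j then 1 else 0)"
proof -
  have "((\<lambda>x. x $ j) has_derivative (\<lambda>v. v $ j)) (at (\<phi> p))"
    by (rule bounded_linear_imp_has_derivative) (rule bounded_linear_vec_nth)
  then have "(coord j \<circ> inv_into U \<phi> has_derivative (\<lambda>v. v $ j)) (at (\<phi> p))"
    by (rule has_derivative_transform_within_open[of "\<lambda>x. x $ j" _ _ UNIV "\<phi> ` N"])
      (use assms patch_open patch_subset open_chart_image[OF chart] coord_on_patch chart in
        \<open>auto simp: subset_eq\<close>)
  from frechet_derivative_at[OF this, symmetric] show ?thesis
    using assms coord_smooth by (simp add: partial_on_patch axis_def)
qed

text \<open>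
  By Hadamard's lemma \<open>h\<close> is, near \<open>p\<close>, a constant plus a sum of products of \<open>x\<^sub>i - x\<^sub>i(p)\<close> with smooth
  functions. A derivation kills the constant, and by the product rule only the derivatives of the first
  factors survive at \<open>p\<close>. This is the step that bounds the dimension of the tangent spaces.
\<close>
lemma vector_field_coordinates:
  assumes X: "X \<in> vector_fields A" and h: "h \<in> smooth_functions A" and p: "p \<in> N"
  shows "X h p = (\<Sum>i\<in>UNIV. X (coord i) p * partial i h p)"
proof -
  have pU: "p \<in> U" using p patch_subset by blast
  have oN: "open (\<phi> ` N)" using open_chart_image[OF chart patch_open patch_subset] .
  then obtain e where e: "e > 0" "ball (\<phi> p) e \<subseteq> \<phi> ` N"
    using p open_contains_ball by blast
  have "smooth_on (ball (\<phi> p) e) (h \<circ> inv_into U \<phi>)"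
    using smooth_function_chart[OF h chart] by (rule smooth_on_subset) (use e patch_subset in blast)
  then obtain G where G: "\<And>i. smooth_on (ball (\<phi> p) e) (G i)"
    "\<And>x. x \<in> ball (\<phi> p) e \<Longrightarrow> (h \<circ> inv_into U \<phi>) x = (h \<circ> inv_into U \<phi>) (\<phi> p) + (\<Sum>i\<in>UNIV. (x $ i - \<phi> p $ i) * G i x)"
    "\<And>i. G i (\<phi> p) = frechet_derivative (h \<circ> inv_into U \<phi>) (at (\<phi> p)) (axis i 1)"
    using hadamard[OF _ e(1)] by blast
  let ?B = "U \<inter> \<phi> -` ball (\<phi> p) e"
  have B: "open ?B" "p \<in> ?B" "?B \<subseteq> U"
    using open_chart_preimage[OF chart, of "ball (\<phi> p) e"] pU e by auto
  have BN: "?B \<subseteq> N"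
  proof
    fix q assume q: "q \<in> ?B"
    then obtain q' where "q' \<in> N" "\<phi> q = \<phi> q'" using e(2) by blast
    then show "q \<in> N" using q inj_on_chart[OF chart] patch_subset by (metis IntD1 inj_onD subsetD)
  qed
  \<comment> \<open>The coefficients of Hadamard's lemma only exist near \<open>p\<close>; \<open>\<zeta>\<close> makes them global.\<close>
  obtain \<zeta> W where \<zeta>: "\<zeta> \<in> smooth_functions A" "open W" "p \<in> W" "W \<subseteq> ?B" "\<And>q. q \<in> W \<Longrightarrow> \<zeta> q = 1" "supp \<zeta> \<subseteq> ?B"
    by (rule smooth_bump_at[OF B(1,2)]) blast
  let ?g = "\<lambda>i q. if q \<in> ?B then \<zeta> q * G i (\<phi> q) else 0"
  have g: "?g i \<in> smooth_functions A" for i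
  proof (rule smooth_function_chart_extend[OF chart B(1,3) _ \<zeta>(1,6)])
    show "smooth_on (\<phi> ` ?B) (G i)" using G(1) by (rule smooth_on_subset) auto
  qed
  let ?k = "\<lambda>q. h p + (\<Sum>i\<in>UNIV. (coord i q - coord i p) * ?g i q)"
  have c: "(\<lambda>q. coord i q - coord i p) \<in> smooth_functions A" for i
    by (intro smooth_function_diff coord_smooth smooth_function_const)
  have s: "(\<lambda>q. \<Sum>i\<in>UNIV. (coord i q - coord i p) * ?g i q) \<in> smooth_functions A"
    by (intro smooth_function_sum smooth_function_mult c g)
  have "X h p = X ?k p"
  proof (rule vector_field_local[OF X h _ \<zeta>(2,3)])
    show "?k \<in> smooth_functions A"
      by (intro smooth_function_add smooth_function_const s)
    fix q assume q: "q \<in> W"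
    then have "q \<in> ?B" "q \<in> N" "q \<in> U" using \<zeta> BN B by blast+
    then show "h q = ?k q"
      using G(2)[of "\<phi> q"] pU p chart \<zeta>(5)[OF q] by (simp add: coord_on_patch)
  qed
  also have "\<dots> = X (\<lambda>q. \<Sum>i\<in>UNIV. (coord i q - coord i p) * ?g i q) p"
    using vector_field_add[OF X smooth_function_const s] vector_field_const[OF X] by simp
  also have "\<dots> = (\<Sum>i\<in>UNIV. X (\<lambda>q. (coord i q - coord i p) * ?g i q) p)"
    by (rule vector_field_sum[OF X]) (intro smooth_function_mult c g)
  also have "\<dots> = (\<Sum>i\<in>UNIV. X (coord i) p * partial i h p)"
  proof (rule sum.cong[OF refl])
    fix i
    have "X (\<lambda>q. coord i q + (- coord i p)) = (\<lambda>q. X (coord i) q + X (\<lambda>q. - coord i p) q)"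
      by (rule vector_field_add[OF X coord_smooth smooth_function_const])
    then have "X (\<lambda>q. coord i q - coord i p) p = X (coord i) p"
      using vector_field_const[OF X] by simp
    then have "X (\<lambda>q. (coord i q - coord i p) * ?g i q) p = X (coord i) p * ?g i p"
      using vector_field_mult[OF X c g] by simp
    also have "?g i p = partial i h p"
      using B(2) \<zeta>(3,5) G(3) p h by (simp add: partial_on_patch)
    finally show "X (\<lambda>q. (coord i q - coord i p) * ?g i q) p = X (coord i) p * partial i h p" .
  qed
  finally show ?thesis .
qed

end

context smooth_manifold
begin

lemma coordinate_patch_at:
  obtains U \<phi> \<eta> N where "coordinate_patch A U \<phi> \<eta> N" "p \<in> N"
proof -
  obtain U \<phi> where U: "(U, \<phi>) \<in> A" "p \<in> U" by (rule chart_at)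
  obtain \<eta> W where "\<eta> \<in> smooth_functions A" "open W" "p \<in> W" "W \<subseteq> U" "\<And>q. q \<in> W \<Longrightarrow> \<eta> q = 1" "supp \<eta> \<subseteq> U"
    by (rule smooth_bump_at[OF conjunct1[OF chart_open[OF U(1)]] U(2)]) blast
  then have "coordinate_patch A U \<phi> \<eta> W"
    using U by unfold_locales auto
  then show thesis using that \<open>p \<in> W\<close> by blast
qed

section \<open>Linearity over the smooth functions, and frames\<close>

definition submodule :: "('b \<Rightarrow> 'a \<Rightarrow> real) set \<Rightarrow> bool" where
  "submodule M \<longleftrightarrow> (\<forall>x\<in>M. \<forall>y\<in>M. fadd x y \<in> M) \<and> (\<forall>f\<in>smooth_functions A. \<forall>x\<in>M. fscale f x \<in> M)"

text \<open>
  Linearity over the ring of smooth functions, on a set \<open>M\<close> of fields that is closed under the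
  module operations. The same notion serves vector fields and one-forms.
\<close>
definition flinear :: "('b \<Rightarrow> 'a \<Rightarrow> real) set \<Rightarrow> (('b \<Rightarrow> 'a \<Rightarrow> real) \<Rightarrow> 'a \<Rightarrow> real) \<Rightarrow> bool" where
  "flinear M B \<longleftrightarrow>
     (\<forall>x\<in>M. \<forall>y\<in>M. B (fadd x y) = (\<lambda>p. B x p + B y p)) \<and>
     (\<forall>f\<in>smooth_functions A. \<forall>x\<in>M. B (fscale f x) = (\<lambda>p. f p * B x p))"

lemma submodule_vector_fields: "submodule (vector_fields A)"
  by (auto simp: submodule_def)

lemma submodule_one_forms: "submodule (one_forms A)"
  by (auto simp: submodule_def)

lemma flinear_add: "flinear M B \<Longrightarrow> x \<in> M \<Longrightarrow> y \<in> M \<Longrightarrow> B (fadd x y) p = B x p + B y p"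
  by (simp add: flinear_def)

lemma flinear_scale: "flinear M B \<Longrightarrow> f \<in> smooth_functions A \<Longrightarrow> x \<in> M \<Longrightarrow> B (fscale f x) p = f p * B x p"
  by (simp add: flinear_def)

lemma flinear_one_form: "\<alpha> \<in> one_forms A \<Longrightarrow> flinear (vector_fields A) \<alpha>"
  by (simp add: flinear_def one_form_add one_form_scale)

text \<open>
  Multiplying \<open>Z\<close> by a bump supported in \<open>N\<close> gives the zero field, on which \<open>B\<close> vanishes.
\<close>
lemma flinear_vanish:
  assumes M: "submodule M" and B: "flinear M B" and Z: "Z \<in> M"
    and N: "open N" "p \<in> N" "\<And>q b. q \<in> N \<Longrightarrow> Z b q = 0"
  shows "B Z p = 0"
proof -
  obtain \<eta> W where \<eta>: "\<eta> \<in> smooth_functions A" "p \<in> W" "\<And>q. q \<in> W \<Longrightarrow> \<eta> q = 1" "supp \<eta> \<subseteq> N"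
    by (rule smooth_bump_at[OF N(1,2)]) blast
  have "fscale \<eta> Z = fscale (\<lambda>p. 0) Z"
    unfolding fscale_def using \<eta>(4) N(3) supp_zero[of _ \<eta>]
    by (metis (no_types, lifting) mult_eq_0_iff subsetD)
  then have "\<eta> p * B Z p = 0 * B Z p"
    using flinear_scale[OF B \<eta>(1) Z, of p] flinear_scale[OF B smooth_function_const[of 0] Z, of p] by simp
  then show ?thesis using \<eta>(2,3) by simp
qed

lemma flinear_lincomb:
  assumes M: "submodule M" and B: "flinear M B" and x: "x \<in> M"
    and "finite I" "\<And>i. i \<in> I \<Longrightarrow> f i \<in> smooth_functions A" "\<And>i. i \<in> I \<Longrightarrow> E i \<in> M"
  shows "(\<lambda>b p. \<Sum>i\<in>I. f i p * E i b p) \<in> M \<and>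
    B (\<lambda>b p. \<Sum>i\<in>I. f i p * E i b p) = (\<lambda>p. \<Sum>i\<in>I. f i p * B (E i) p)"
  using assms(4-6)
proof (induction I)
  case empty
  have "(\<lambda>b p. 0) = fscale (\<lambda>p. 0) x" by (simp add: fscale_def)
  then show ?case
    using x M B by (simp add: submodule_def flinear_def)
next
  case (insert i I)
  let ?L = "\<lambda>b p. \<Sum>i\<in>I. f i p * E i b p"
  have eq: "(\<lambda>b p. \<Sum>i\<in>insert i I. f i p * E i b p) = fadd (fscale (f i) (E i)) ?L"
    using insert by (simp add: fadd_def fscale_def)
  have "fscale (f i) (E i) \<in> M" "?L \<in> M"
    using insert M by (auto simp: submodule_def)
  then show ?case
    unfolding eq using insert M B by (auto simp: submodule_def flinear_def)
qed

text \<open>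
  A linear combination with smooth coefficients that holds near \<open>p\<close> may be pulled through a map that
  is linear over the smooth functions, even though the map is only defined on global fields.
\<close>
lemma flinear_expand:
  assumes M: "submodule M" and B: "flinear M B" and Z: "Z \<in> M"
    and fE: "\<And>i. f i \<in> smooth_functions A" "\<And>i. E i \<in> M"
    and N: "open N" "p \<in> N" "\<And>q b. q \<in> N \<Longrightarrow> Z b q = (\<Sum>i\<in>UNIV. f i q * E i b q)"
  shows "B Z p = (\<Sum>i\<in>(UNIV :: 'i::finite set). f i p * B (E i) p)"
proof -
  let ?L = "\<lambda>b p. \<Sum>i\<in>(UNIV :: 'i set). f i p * E i b p"
  let ?Z = "fadd Z (fscale (\<lambda>p. -1) ?L)"
  have L: "?L \<in> M" "B ?L p = (\<Sum>i\<in>UNIV. f i p * B (E i) p)"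
    using flinear_lincomb[OF M B Z, of UNIV f E] fE by auto
  have sL: "fscale (\<lambda>p. -1) ?L \<in> M"
    using M L by (simp add: submodule_def)
  have "B ?Z p = 0"
  proof (rule flinear_vanish[OF M B _ N(1,2)])
    show "?Z \<in> M" using M Z sL by (simp add: submodule_def)
    show "?Z b q = 0" if "q \<in> N" for q b
      using N(3)[OF that] by (simp add: fadd_def fscale_def)
  qed
  then show ?thesis
    using flinear_add[OF B Z sL] flinear_scale[OF B smooth_function_const[of "-1"] L(1)] L(2) by simp
qed

text \<open>
  The neighbourhood is named because derivatives at a point use that duality holds nearby, not just
  at that point.
\<close>
definition frame_on :: "'a set \<Rightarrow> ('n \<Rightarrow> 'a vfield) \<Rightarrow> ('n \<Rightarrow> 'a oneform) \<Rightarrow> bool" where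
  "frame_on N E F \<longleftrightarrow> open N \<and> (\<forall>i. E i \<in> vector_fields A) \<and> (\<forall>i. F i \<in> one_forms A) \<and>
     (\<forall>q\<in>N. \<forall>i j. F i (E j) q = (if i = j then 1 else 0))"

lemma local_frame_iff: "local_frame A p E F \<longleftrightarrow> (\<exists>N. frame_on N E F \<and> p \<in> N)"
  by (auto simp: local_frame_def frame_on_def)

lemma frame_onD:
  assumes "frame_on N E F"
  shows "open N" "E i \<in> vector_fields A" "F i \<in> one_forms A"
    "q \<in> N \<Longrightarrow> F i (E j) q = (if i = j then 1 else 0)"
  using assms by (auto simp: frame_on_def)

end

context coordinate_patch
begin

lemma frame_on_patch: "frame_on N partial (\<lambda>i. differential (coord i))"
proof -
  have "differential (coord i) (partial j) q = (if i = j then 1 else 0)" if "q \<in> N" for i j q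
    using that by (auto simp: differential_def partial_vector_field partial_coord)
  then show ?thesis
    using patch_open partial_vector_field differential_one_form[OF coord_smooth]
    by (simp add: frame_on_def)
qed

lemma patch_flinear:
  assumes B: "flinear (vector_fields A) B" and X: "X \<in> vector_fields A" and p: "p \<in> N"
  shows "B X p = (\<Sum>i\<in>UNIV. X (coord i) p * B (partial i) p)"
proof (rule flinear_expand[OF submodule_vector_fields B X _ partial_vector_field patch_open p])
  show "X (coord i) \<in> smooth_functions A" for i
    by (rule vector_field_smooth[OF X coord_smooth])
  fix q h assume "q \<in> N"
  then show "X h q = (\<Sum>i\<in>UNIV. X (coord i) q * partial i h q)"
    using vector_field_coordinates[OF X] vector_field_nonsmooth[OF X]
      vector_field_nonsmooth[OF partial_vector_field]
    by (cases "h \<in> smooth_functions A") auto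
qed

text \<open>
  Duality says that the matrix of \<open>F\<close> times the matrix of \<open>E\<close>, both with respect to the coordinate
  frame, is the identity. The matrices are square, so the product in the other order is the identity
  as well, and that is the expansion of \<open>X\<close>.
\<close>
lemma patch_frame_expand:
  assumes F: "frame_on M E F" and q: "q \<in> N" "q \<in> M" and X: "X \<in> vector_fields A"
  shows "X h q = (\<Sum>i\<in>UNIV. F i X q * E i h q)"
proof (cases "h \<in> smooth_functions A")
  case True
  note E = frame_onD(2)[OF F] and FF = frame_onD(3)[OF F]
  define a :: "real ^ 'n ^ 'n" where "a = (\<chi> i j. F i (partial j) q)"
  define b :: "real ^ 'n ^ 'n" where "b = (\<chi> i j. E j (coord i) q)"
  have "a ** b = mat 1"
  proof -
    have "(\<Sum>k\<in>UNIV. F i (partial k) q * E j (coord k) q) = (if i = j then 1 else 0)" for i j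
      using patch_flinear[OF flinear_one_form[OF FF] E q(1), of i j] frame_onD(4)[OF F q(2), of i j]
      by (simp add: mult.commute)
    then show ?thesis by (simp add: a_def b_def matrix_matrix_mult_def mat_def vec_eq_iff)
  qed
  then have "b ** a = mat 1" by (simp add: matrix_left_right_inverse)
  then have ba: "(\<Sum>i\<in>UNIV. E i (coord l) q * F i (partial k) q) = (if l = k then 1 else 0)" for l k
    by (simp add: a_def b_def matrix_matrix_mult_def mat_def vec_eq_iff)
  have "(\<Sum>i\<in>UNIV. F i X q * E i h q) =
      (\<Sum>i\<in>UNIV. (\<Sum>k\<in>UNIV. X (coord k) q * F i (partial k) q) * (\<Sum>l\<in>UNIV. E i (coord l) q * partial l h q))"
    using patch_flinear[OF flinear_one_form[OF FF] X q(1)] vector_field_coordinates[OF E True q(1)] by simp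
  also have "\<dots> = (\<Sum>i\<in>UNIV. \<Sum>k\<in>UNIV. \<Sum>l\<in>UNIV.
      (X (coord k) q * F i (partial k) q) * (E i (coord l) q * partial l h q))"
    by (simp only: sum_product)
  also have "\<dots> = (\<Sum>k\<in>UNIV. \<Sum>l\<in>UNIV. \<Sum>i\<in>UNIV.
      (X (coord k) q * F i (partial k) q) * (E i (coord l) q * partial l h q))"
    by (subst sum.swap) (intro sum.cong refl sum.swap)
  also have "\<dots> = (\<Sum>k\<in>UNIV. \<Sum>l\<in>UNIV. X (coord k) q * partial l h q *
      (\<Sum>i\<in>UNIV. E i (coord l) q * F i (partial k) q))"
    by (simp add: sum_distrib_left mult_ac)
  also have "\<dots> = (\<Sum>k\<in>UNIV. X (coord k) q * partial k h q)"
    by (simp add: ba if_distrib[of "\<lambda>x. _ * x"] cong: if_cong)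
  finally show ?thesis using vector_field_coordinates[OF X True q(1)] by simp
next
  case False
  then show ?thesis
    using vector_field_nonsmooth[OF X] vector_field_nonsmooth[OF frame_onD(2)[OF F]] by simp
qed

end

context smooth_manifold
begin

lemma local_frame_exists: obtains N E F where "frame_on N E F" "p \<in> N"
proof -
  obtain U \<phi> \<eta> N where "coordinate_patch A U \<phi> \<eta> N" and p: "p \<in> N" by (rule coordinate_patch_at)
  then interpret coordinate_patch A U \<phi> \<eta> N by simp
  show thesis using that frame_on_patch p by blast
qed

lemma frame_expand_vector:
  assumes "frame_on M E F" "q \<in> M" "X \<in> vector_fields A"
  shows "X h q = (\<Sum>i\<in>UNIV. F i X q * E i h q)"
proof -
  obtain U \<phi> \<eta> N where "coordinate_patch A U \<phi> \<eta> N" and q: "q \<in> N" by (rule coordinate_patch_at)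
  then interpret coordinate_patch A U \<phi> \<eta> N by simp
  show ?thesis by (rule patch_frame_expand[OF assms(1) q assms(2,3)])
qed

lemma frame_flinear_vector:
  assumes F: "frame_on N E F" "p \<in> N" and B: "flinear (vector_fields A) B" and X: "X \<in> vector_fields A"
  shows "B X p = (\<Sum>i\<in>UNIV. F i X p * B (E i) p)"
  by (rule flinear_expand[OF submodule_vector_fields B X _ _ frame_onD(1)[OF F(1)] F(2)])
    (use frame_onD(2,3)[OF F(1)] X frame_expand_vector[OF F(1) _ X] one_form_smooth in auto)

lemma frame_expand_form:
  assumes F: "frame_on N E F" "p \<in> N" and \<alpha>: "\<alpha> \<in> one_forms A"
  shows "\<alpha> X p = (\<Sum>i\<in>UNIV. \<alpha> (E i) p * F i X p)"
proof (cases "X \<in> vector_fields A")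
  case True
  then show ?thesis
    using frame_flinear_vector[OF F flinear_one_form[OF \<alpha>]] by (simp add: mult.commute)
next
  case False
  then show ?thesis
    using one_form_outside[OF \<alpha>] one_form_outside[OF frame_onD(3)[OF F(1)]] by simp
qed

lemma frame_flinear_form:
  assumes F: "frame_on N E F" "p \<in> N" and B: "flinear (one_forms A) B" and \<alpha>: "\<alpha> \<in> one_forms A"
  shows "B \<alpha> p = (\<Sum>i\<in>UNIV. \<alpha> (E i) p * B (F i) p)"
  by (rule flinear_expand[OF submodule_one_forms B \<alpha> _ _ frame_onD(1)[OF F(1)] F(2)])
    (use frame_onD(2,3)[OF F(1)] \<alpha> frame_expand_form[OF F(1) _ \<alpha>] one_form_smooth in auto)

text \<open>
  In coordinates the value at \<open>p\<close> only involves the numbers \<open>X (coord i) p\<close>.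
\<close>
lemma flinear_pointwise:
  assumes B: "flinear (vector_fields A) B" and X: "X \<in> vector_fields A" and Y: "Y \<in> vector_fields A"
    and eq: "\<And>h. h \<in> smooth_functions A \<Longrightarrow> X h p = Y h p"
  shows "B X p = B Y p"
proof -
  obtain U \<phi> \<eta> N where "coordinate_patch A U \<phi> \<eta> N" and p: "p \<in> N" by (rule coordinate_patch_at)
  then interpret coordinate_patch A U \<phi> \<eta> N by simp
  show ?thesis
    using patch_flinear[OF B X p] patch_flinear[OF B Y p] eq[OF coord_smooth] by simp
qed

text \<open>
  Expand \<open>F i\<close> in the second coframe, and read the expansion of the second frame in the first one
  backwards; both use the same coefficients \<open>F i (E' j)\<close>.
\<close>
lemma trace_frame_independent:
  assumes F: "frame_on N E F" "p \<in> N" and F': "frame_on N' E' F'" "p \<in> N'"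
    and form: "\<And>X. X \<in> vector_fields A \<Longrightarrow> flinear (one_forms A) (\<lambda>\<alpha>. G \<alpha> X)"
    and vector: "\<And>\<alpha>. \<alpha> \<in> one_forms A \<Longrightarrow> flinear (vector_fields A) (G \<alpha>)"
  shows "(\<Sum>i\<in>UNIV. G (F i) (E i) p) = (\<Sum>i\<in>UNIV. G (F' i) (E' i) p)"
proof -
  have "(\<Sum>i\<in>UNIV. G (F i) (E i) p) = (\<Sum>i\<in>UNIV. \<Sum>j\<in>UNIV. F i (E' j) p * G (F' j) (E i) p)"
    using frame_flinear_form[OF F' form frame_onD(3)[OF F(1)]] frame_onD(2)[OF F(1)] by simp
  also have "\<dots> = (\<Sum>j\<in>UNIV. \<Sum>i\<in>UNIV. F i (E' j) p * G (F' j) (E i) p)"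
    by (rule sum.swap)
  also have "\<dots> = (\<Sum>j\<in>UNIV. G (F' j) (E' j) p)"
    using frame_flinear_vector[OF F vector frame_onD(2)[OF F'(1)]] frame_onD(3)[OF F'(1)] by simp
  finally show ?thesis .
qed

lemma dual_slots_frame_independent:
  assumes F: "frame_on N E F" "p \<in> N" and F': "frame_on N' E' F'" "p \<in> N'"
    and C: "flinear (one_forms A) C" and B: "flinear (vector_fields A) B"
  shows "(\<Sum>i\<in>UNIV. C (F i) p * B (E i) p) = (\<Sum>i\<in>UNIV. C (F' i) p * B (E' i) p)"
  by (rule trace_frame_independent[OF F F', where G="\<lambda>\<alpha> X p. C \<alpha> p * B X p"])
    (use C B in \<open>simp_all add: flinear_def algebra_simps\<close>)

section \<open>Tensor fields as multilinear maps\<close>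

lemma tensor_argsD:
  assumes "(\<alpha>s, vs) \<in> tensor_args A r s"
  shows "length \<alpha>s = r" "set \<alpha>s \<subseteq> one_forms A" "length vs = s" "set vs \<subseteq> vector_fields A"
  using assms by (auto simp: tensor_args_def)

lemma tensor_args_update_form:
  "(\<alpha>s, vs) \<in> tensor_args A r s \<Longrightarrow> \<alpha> \<in> one_forms A \<Longrightarrow> (\<alpha>s[j := \<alpha>], vs) \<in> tensor_args A r s"
  using set_update_subset_insert by (fastforce simp: tensor_args_def)

lemma tensor_args_update_vector:
  "(\<alpha>s, vs) \<in> tensor_args A r s \<Longrightarrow> v \<in> vector_fields A \<Longrightarrow> (\<alpha>s, vs[i := v]) \<in> tensor_args A r s"
  using set_update_subset_insert by (fastforce simp: tensor_args_def)

lemma tensor_args_nth: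
  assumes "(\<alpha>s, vs) \<in> tensor_args A r s"
  shows "j < r \<Longrightarrow> \<alpha>s ! j \<in> one_forms A" "i < s \<Longrightarrow> vs ! i \<in> vector_fields A"
  using tensor_argsD[OF assms] nth_mem by blast+

text \<open>
  The definition states additivity and homogeneity by modifying the entry that is already there;
  here they become linearity of the map that inserts an arbitrary entry.
\<close>
lemma tensor_fields_iff:
  "T \<in> tensor_fields A r s \<longleftrightarrow> (\<forall>\<alpha>s vs. (\<alpha>s, vs) \<in> tensor_args A r s \<longrightarrow>
     T \<alpha>s vs \<in> smooth_functions A \<and>
     (\<forall>j<r. flinear (one_forms A) (\<lambda>\<alpha>. T (\<alpha>s[j := \<alpha>]) vs)) \<and>
     (\<forall>i<s. flinear (vector_fields A) (\<lambda>v. T \<alpha>s (vs[i := v]))))" (is "_ \<longleftrightarrow> ?R")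
proof
  assume T: "T \<in> tensor_fields A r s"
  show ?R
  proof (intro allI impI conjI)
    fix \<alpha>s vs assume a: "(\<alpha>s, vs) \<in> tensor_args A r s"
    show "T \<alpha>s vs \<in> smooth_functions A" using T a by (auto simp: tensor_fields_def)
    show "flinear (one_forms A) (\<lambda>\<alpha>. T (\<alpha>s[j := \<alpha>]) vs)" if j: "j < r" for j
      unfolding flinear_def
    proof (intro conjI ballI)
      fix \<alpha> \<beta> assume ab: "\<alpha> \<in> one_forms A" "\<beta> \<in> one_forms A"
      have "\<alpha>s[j := \<alpha>] ! j = \<alpha>" using tensor_argsD[OF a] j by simp
      then show "T (\<alpha>s[j := fadd \<alpha> \<beta>]) vs = (\<lambda>p. T (\<alpha>s[j := \<alpha>]) vs p + T (\<alpha>s[j := \<beta>]) vs p)"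
        using T tensor_args_update_form[OF a ab(1), of j] j ab(2)
        by (fastforce simp: tensor_fields_def)
    next
      fix f \<alpha> assume f: "f \<in> smooth_functions A" and \<alpha>: "\<alpha> \<in> one_forms A"
      have "\<alpha>s[j := \<alpha>] ! j = \<alpha>" using tensor_argsD[OF a] j by simp
      then show "T (\<alpha>s[j := fscale f \<alpha>]) vs = (\<lambda>p. f p * T (\<alpha>s[j := \<alpha>]) vs p)"
        using T tensor_args_update_form[OF a \<alpha>, of j] j f
        by (fastforce simp: tensor_fields_def)
    qed
    show "flinear (vector_fields A) (\<lambda>v. T \<alpha>s (vs[i := v]))" if i: "i < s" for i
      unfolding flinear_def
    proof (intro conjI ballI)
      fix v w assume vw: "v \<in> vector_fields A" "w \<in> vector_fields A"
      have "vs[i := v] ! i = v" using tensor_argsD[OF a] i by simp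
      then show "T \<alpha>s (vs[i := fadd v w]) = (\<lambda>p. T \<alpha>s (vs[i := v]) p + T \<alpha>s (vs[i := w]) p)"
        using T tensor_args_update_vector[OF a vw(1), of i] i vw(2)
        by (fastforce simp: tensor_fields_def)
    next
      fix f v assume f: "f \<in> smooth_functions A" and v: "v \<in> vector_fields A"
      have "vs[i := v] ! i = v" using tensor_argsD[OF a] i by simp
      then show "T \<alpha>s (vs[i := fscale f v]) = (\<lambda>p. f p * T \<alpha>s (vs[i := v]) p)"
        using T tensor_args_update_vector[OF a v, of i] i f
        by (fastforce simp: tensor_fields_def)
    qed
  qed
next
  assume R: ?R
  have form: "\<beta> \<in> one_forms A \<Longrightarrow> T (\<alpha>s[j := fadd (\<alpha>s ! j) \<beta>]) vs = (\<lambda>p. T \<alpha>s vs p + T (\<alpha>s[j := \<beta>]) vs p)"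
      "f \<in> smooth_functions A \<Longrightarrow> T (\<alpha>s[j := fscale f (\<alpha>s ! j)]) vs = (\<lambda>p. f p * T \<alpha>s vs p)"
    if "(\<alpha>s, vs) \<in> tensor_args A r s" "j < r" for \<alpha>s vs j \<beta> f
  proof -
    have *: "flinear (one_forms A) (\<lambda>\<alpha>. T (\<alpha>s[j := \<alpha>]) vs)" using R that by blast
    have n: "\<alpha>s ! j \<in> one_forms A" using tensor_args_nth that by blast
    show "T (\<alpha>s[j := fadd (\<alpha>s ! j) \<beta>]) vs = (\<lambda>p. T \<alpha>s vs p + T (\<alpha>s[j := \<beta>]) vs p)" if "\<beta> \<in> one_forms A"
      using flinear_add[OF * n that] by (simp add: fun_eq_iff)
    show "T (\<alpha>s[j := fscale f (\<alpha>s ! j)]) vs = (\<lambda>p. f p * T \<alpha>s vs p)" if "f \<in> smooth_functions A"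
      using flinear_scale[OF * that n] by (simp add: fun_eq_iff)
  qed
  have vec: "w \<in> vector_fields A \<Longrightarrow> T \<alpha>s (vs[i := fadd (vs ! i) w]) = (\<lambda>p. T \<alpha>s vs p + T \<alpha>s (vs[i := w]) p)"
      "f \<in> smooth_functions A \<Longrightarrow> T \<alpha>s (vs[i := fscale f (vs ! i)]) = (\<lambda>p. f p * T \<alpha>s vs p)"
    if "(\<alpha>s, vs) \<in> tensor_args A r s" "i < s" for \<alpha>s vs i w f
  proof -
    have *: "flinear (vector_fields A) (\<lambda>v. T \<alpha>s (vs[i := v]))" using R that by blast
    have n: "vs ! i \<in> vector_fields A" using tensor_args_nth that by blast
    show "T \<alpha>s (vs[i := fadd (vs ! i) w]) = (\<lambda>p. T \<alpha>s vs p + T \<alpha>s (vs[i := w]) p)" if "w \<in> vector_fields A"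
      using flinear_add[OF * n that] by (simp add: fun_eq_iff)
    show "T \<alpha>s (vs[i := fscale f (vs ! i)]) = (\<lambda>p. f p * T \<alpha>s vs p)" if "f \<in> smooth_functions A"
      using flinear_scale[OF * that n] by (simp add: fun_eq_iff)
  qed
  show "T \<in> tensor_fields A r s"
    unfolding tensor_fields_def
    by (rule CollectI, clarify, intro conjI allI impI ballI form vec)
      (assumption | use R in blast)+
qed

lemma tensor_smooth: "T \<in> tensor_fields A r s \<Longrightarrow> (\<alpha>s, vs) \<in> tensor_args A r s \<Longrightarrow> T \<alpha>s vs \<in> smooth_functions A"
  by (simp add: tensor_fields_iff)

lemma tensor_flinear_form: "T \<in> tensor_fields A r s \<Longrightarrow> (\<alpha>s, vs) \<in> tensor_args A r s \<Longrightarrow> j < r \<Longrightarrow>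
    flinear (one_forms A) (\<lambda>\<alpha>. T (\<alpha>s[j := \<alpha>]) vs)"
  by (simp add: tensor_fields_iff)

lemma tensor_flinear_vector: "T \<in> tensor_fields A r s \<Longrightarrow> (\<alpha>s, vs) \<in> tensor_args A r s \<Longrightarrow> i < s \<Longrightarrow>
    flinear (vector_fields A) (\<lambda>v. T \<alpha>s (vs[i := v]))"
  by (simp add: tensor_fields_iff)

lemma tensor_snoc_form:
  assumes "T \<in> tensor_fields A (Suc r) s" "\<alpha> \<in> one_forms A"
  shows "(\<lambda>\<alpha>s. T (\<alpha>s @ [\<alpha>])) \<in> tensor_fields A r s"
  unfolding tensor_fields_iff
proof (intro allI impI)
  fix \<alpha>s vs assume a: "(\<alpha>s, vs) \<in> tensor_args A r s"
  then have b: "(\<alpha>s @ [\<alpha>], vs) \<in> tensor_args A (Suc r) s" using assms(2) by (auto simp: tensor_args_def)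
  have "flinear (one_forms A) (\<lambda>\<beta>. T (\<alpha>s[j := \<beta>] @ [\<alpha>]) vs)" if "j < r" for j
    using tensor_flinear_form[OF assms(1) b, of j] that tensor_argsD(1)[OF a]
    by (simp add: list_update_append)
  then show "T (\<alpha>s @ [\<alpha>]) vs \<in> smooth_functions A \<and>
     (\<forall>j<r. flinear (one_forms A) (\<lambda>\<beta>. T (\<alpha>s[j := \<beta>] @ [\<alpha>]) vs)) \<and>
     (\<forall>i<s. flinear (vector_fields A) (\<lambda>v. T (\<alpha>s @ [\<alpha>]) (vs[i := v])))"
    using tensor_smooth[OF assms(1) b] tensor_flinear_vector[OF assms(1) b] by blast
qed

lemma tensor_snoc_vector:
  assumes "T \<in> tensor_fields A r (Suc s)" "v \<in> vector_fields A"
  shows "(\<lambda>\<alpha>s vs. T \<alpha>s (vs @ [v])) \<in> tensor_fields A r s"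
  unfolding tensor_fields_iff
proof (intro allI impI)
  fix \<alpha>s vs assume a: "(\<alpha>s, vs) \<in> tensor_args A r s"
  then have b: "(\<alpha>s, vs @ [v]) \<in> tensor_args A r (Suc s)" using assms(2) by (auto simp: tensor_args_def)
  have "flinear (vector_fields A) (\<lambda>w. T \<alpha>s (vs[i := w] @ [v]))" if "i < s" for i
    using tensor_flinear_vector[OF assms(1) b, of i] that tensor_argsD(3)[OF a]
    by (simp add: list_update_append)
  then show "T \<alpha>s (vs @ [v]) \<in> smooth_functions A \<and>
     (\<forall>j<r. flinear (one_forms A) (\<lambda>\<beta>. T (\<alpha>s[j := \<beta>]) (vs @ [v]))) \<and>
     (\<forall>i<s. flinear (vector_fields A) (\<lambda>w. T \<alpha>s (vs[i := w] @ [v])))"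
    using tensor_smooth[OF assms(1) b] tensor_flinear_form[OF assms(1) b] by blast
qed

lemma tensor_flinear_snoc_form:
  assumes T: "T \<in> tensor_fields A (Suc r) s" and a: "(\<alpha>s, vs) \<in> tensor_args A r s"
  shows "flinear (one_forms A) (\<lambda>\<alpha>. T (\<alpha>s @ [\<alpha>]) vs)"
proof -
  obtain N E F where F: "frame_on N E F" by (rule local_frame_exists[of undefined])
  \<comment> \<open>Any one-form can fill the slot before it is overwritten.\<close>
  have "(\<alpha>s @ [F undefined], vs) \<in> tensor_args A (Suc r) s"
    using frame_onD(3)[OF F] a by (auto simp: tensor_args_def)
  from tensor_flinear_form[OF T this, of r] show ?thesis
    using tensor_argsD(1)[OF a] by (simp add: list_update_append)
qed

lemma tensor_flinear_snoc_vector: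
  assumes T: "T \<in> tensor_fields A r (Suc s)" and a: "(\<alpha>s, vs) \<in> tensor_args A r s"
  shows "flinear (vector_fields A) (\<lambda>v. T \<alpha>s (vs @ [v]))"
proof -
  obtain N E F where F: "frame_on N E F" by (rule local_frame_exists[of undefined])
  have "(\<alpha>s, vs @ [E undefined]) \<in> tensor_args A r (Suc s)"
    using frame_onD(2)[OF F] a by (auto simp: tensor_args_def)
  from tensor_flinear_vector[OF T this, of s] show ?thesis
    using tensor_argsD(3)[OF a] by (simp add: list_update_append)
qed

lemma frame_tensor_args:
  assumes "frame_on N E F" "length is = r" "length js = s"
  shows "(map F is, map E js) \<in> tensor_args A r s"
  using assms frame_onD(2,3)[OF assms(1)] by (auto simp: tensor_args_def)

section \<open>Frame independence of the contraction\<close>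

lemma sum_lists_Suc:
  "(\<Sum>is\<in>{is :: 'i::finite list. length is = Suc r}. f is) =
   (\<Sum>i\<in>UNIV. \<Sum>is\<in>{is. length is = r}. f (i # is))"
proof -
  have "{is :: 'i list. length is = Suc r} = (\<lambda>(i, is). i # is) ` (UNIV \<times> {is. length is = r})"
    by (auto simp: length_Suc_conv image_iff)
  moreover have "inj_on (\<lambda>(i, is). i # is) (UNIV \<times> {is :: 'i list. length is = r})"
    by (auto simp: inj_on_def)
  ultimately show ?thesis
    by (simp add: sum.reindex sum.cartesian_product split_def)
qed

lemma sum_lists_snoc:
  "(\<Sum>is\<in>{is :: 'i::finite list. length is = Suc r}. f is) =
   (\<Sum>is\<in>{is. length is = r}. \<Sum>i\<in>UNIV. f (is @ [i]))"
proof -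
  have "{is :: 'i list. length is = Suc r} = (\<lambda>(is, i). is @ [i]) ` ({is. length is = r} \<times> UNIV)"
    by (auto simp: length_Suc_conv_rev image_iff)
  moreover have "inj_on (\<lambda>(is, i). is @ [i]) ({is :: 'i list. length is = r} \<times> UNIV)"
    by (auto simp: inj_on_def)
  ultimately show ?thesis
    by (simp add: sum.reindex sum.cartesian_product split_def)
qed

definition frame_contraction :: "('n \<Rightarrow> 'a vfield) \<Rightarrow> ('n \<Rightarrow> 'a oneform) \<Rightarrow> nat \<Rightarrow> nat \<Rightarrow>
    'a tensor \<Rightarrow> 'a tensor \<Rightarrow> 'a \<Rightarrow> real" where
  "frame_contraction E F r s T\<^sub>1 T\<^sub>2 p =
     (\<Sum>is\<in>{is. length is = r}. \<Sum>js\<in>{js. length js = s}.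
        T\<^sub>1 (map F is) (map E js) p * T\<^sub>2 (map F js) (map E is) p)"

lemma frame_contraction_commute:
  "frame_contraction E F r s T\<^sub>1 T\<^sub>2 p = frame_contraction E F s r T\<^sub>2 T\<^sub>1 p"
  unfolding frame_contraction_def by (subst sum.swap) (simp add: mult.commute)

lemma frame_contraction_Suc:
  "frame_contraction E F (Suc r) s T\<^sub>1 T\<^sub>2 p =
   (\<Sum>i\<in>UNIV. frame_contraction E F r s (\<lambda>\<alpha>s. T\<^sub>1 (\<alpha>s @ [F i])) (\<lambda>\<alpha>s vs. T\<^sub>2 \<alpha>s (vs @ [E i])) p)"
  unfolding frame_contraction_def sum_lists_snoc by (subst sum.swap) simp

text \<open>
  One dual pair of slots is split off at the end of the argument lists. The induction hypothesis
  changes the frame in all other slots, and \<open>dual_slots_frame_independent\<close> changes it in this one.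
\<close>
lemma frame_contraction_independent_Suc:
  assumes F: "frame_on N E F" "p \<in> N" and F': "frame_on N' E' F'" "p \<in> N'"
    and IH: "\<And>T\<^sub>1 T\<^sub>2. T\<^sub>1 \<in> tensor_fields A r s \<Longrightarrow> T\<^sub>2 \<in> tensor_fields A s r \<Longrightarrow>
      frame_contraction E F r s T\<^sub>1 T\<^sub>2 p = frame_contraction E' F' r s T\<^sub>1 T\<^sub>2 p"
    and T: "T\<^sub>1 \<in> tensor_fields A (Suc r) s" "T\<^sub>2 \<in> tensor_fields A s (Suc r)"
  shows "frame_contraction E F (Suc r) s T\<^sub>1 T\<^sub>2 p = frame_contraction E' F' (Suc r) s T\<^sub>1 T\<^sub>2 p"
proof -
  let ?slot = "\<lambda>F i. \<lambda>\<alpha>s. T\<^sub>1 (\<alpha>s @ [F i])" and ?slot' = "\<lambda>E i. \<lambda>\<alpha>s vs. T\<^sub>2 \<alpha>s (vs @ [E i])"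
  have swap: "(\<Sum>i\<in>UNIV. frame_contraction E' F' r s (?slot F i) (?slot' E i) p) =
    (\<Sum>is\<in>{is. length is = r}. \<Sum>js\<in>{js. length js = s}. \<Sum>i\<in>UNIV.
       T\<^sub>1 (map F' is @ [F i]) (map E' js) p * T\<^sub>2 (map F' js) (map E' is @ [E i]) p)" for E F
    unfolding frame_contraction_def
    by (subst sum.swap, intro sum.cong refl, subst sum.swap, rule refl)
  have "frame_contraction E F (Suc r) s T\<^sub>1 T\<^sub>2 p =
    (\<Sum>i\<in>UNIV. frame_contraction E' F' r s (?slot F i) (?slot' E i) p)"
    unfolding frame_contraction_Suc
    using frame_onD(2,3)[OF F(1)] by (intro sum.cong refl IH tensor_snoc_form tensor_snoc_vector T) auto
  also have "\<dots> = (\<Sum>i\<in>UNIV. frame_contraction E' F' r s (?slot F' i) (?slot' E' i) p)"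
    unfolding swap
    by (intro sum.cong refl dual_slots_frame_independent[OF F F'] tensor_flinear_snoc_form[OF T(1)]
        tensor_flinear_snoc_vector[OF T(2)] frame_tensor_args[OF F'(1)]) auto
  finally show ?thesis unfolding frame_contraction_Suc .
qed

lemma frame_contraction_independent:
  assumes F: "frame_on N E F" "p \<in> N" and F': "frame_on N' E' F'" "p \<in> N'"
    and T: "T\<^sub>1 \<in> tensor_fields A r s" "T\<^sub>2 \<in> tensor_fields A s r"
  shows "frame_contraction E F r s T\<^sub>1 T\<^sub>2 p = frame_contraction E' F' r s T\<^sub>1 T\<^sub>2 p"
proof -
  have r0: "frame_contraction E F r 0 T\<^sub>1 T\<^sub>2 p = frame_contraction E' F' r 0 T\<^sub>1 T\<^sub>2 p"
    if "T\<^sub>1 \<in> tensor_fields A r 0" "T\<^sub>2 \<in> tensor_fields A 0 r" for r T\<^sub>1 T\<^sub>2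
    using that
  proof (induction r arbitrary: T\<^sub>1 T\<^sub>2)
    case 0
    show ?case by (simp add: frame_contraction_def)
  next
    case (Suc r)
    show ?case by (rule frame_contraction_independent_Suc[OF F F' Suc.IH Suc.prems])
  qed
  show ?thesis
    using T
  proof (induction r arbitrary: T\<^sub>1 T\<^sub>2)
    case 0
    then show ?case
      using r0[of T\<^sub>2 s T\<^sub>1] by (simp add: frame_contraction_commute[of _ _ 0])
  next
    case (Suc r)
    show ?case by (rule frame_contraction_independent_Suc[OF F F' Suc.IH Suc.prems])
  qed
qed

text \<open>
  The frame at \<open>p\<close> that the definition of the contraction selects. It serves all types and all
  arguments at once, including a second argument, such as a divergence, that is not yet known to be a
  tensor field.
\<close>
lemma contraction_chosen_frame:
  obtains N E F where "frame_on N E F" "p \<in> N"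
    "\<forall>r s T\<^sub>1 T\<^sub>2. contraction A r s T\<^sub>1 T\<^sub>2 p = frame_contraction E F r s T\<^sub>1 T\<^sub>2 p"
proof -
  obtain N E F where "frame_on N E F" "p \<in> N" by (rule local_frame_exists)
  then have "\<exists>EF. case EF of (E, F) \<Rightarrow> local_frame A p E F" by (auto simp: local_frame_iff)
  then have l: "case SOME (E, F). local_frame A p E F of (E, F) \<Rightarrow> local_frame A p E F"
    by (rule someI_ex)
  obtain E F where EF: "(SOME (E, F). local_frame A p E F) = (E, F)" by (rule prod.exhaust)
  with l obtain N where "frame_on N E F" "p \<in> N" by (auto simp: local_frame_iff)
  moreover have "contraction A r s T\<^sub>1 T\<^sub>2 p = frame_contraction E F r s T\<^sub>1 T\<^sub>2 p" for r s T\<^sub>1 T\<^sub>2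
    unfolding contraction_def EF frame_contraction_def by simp
  ultimately show thesis by (intro that) blast+
qed

lemma contraction_in_frame:
  assumes "frame_on N E F" "p \<in> N" "T\<^sub>1 \<in> tensor_fields A r s" "T\<^sub>2 \<in> tensor_fields A s r"
  shows "contraction A r s T\<^sub>1 T\<^sub>2 p = frame_contraction E F r s T\<^sub>1 T\<^sub>2 p"
proof -
  obtain N' E' F' where "frame_on N' E' F'" "p \<in> N'"
    "contraction A r s T\<^sub>1 T\<^sub>2 p = frame_contraction E' F' r s T\<^sub>1 T\<^sub>2 p"
    by (rule contraction_chosen_frame[of p]) blast
  then show ?thesis using frame_contraction_independent assms by metis
qed

lemma frame_contraction_smooth:
  assumes "frame_on N E F" "T\<^sub>1 \<in> tensor_fields A r s" "T\<^sub>2 \<in> tensor_fields A s r"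
  shows "frame_contraction E F r s T\<^sub>1 T\<^sub>2 \<in> smooth_functions A"
  unfolding frame_contraction_def[abs_def]
  by (intro smooth_function_sum smooth_function_mult tensor_smooth[OF assms(2)] tensor_smooth[OF assms(3)]
      frame_tensor_args[OF assms(1)]) auto

lemma contraction_smooth:
  assumes "T\<^sub>1 \<in> tensor_fields A r s" "T\<^sub>2 \<in> tensor_fields A s r"
  shows "contraction A r s T\<^sub>1 T\<^sub>2 \<in> smooth_functions A"
proof (rule smooth_functionI_local)
  fix p
  obtain N E F where F: "frame_on N E F" "p \<in> N" by (rule local_frame_exists)
  show "\<exists>W h. open W \<and> p \<in> W \<and> h \<in> smooth_functions A \<and> (\<forall>q\<in>W. contraction A r s T\<^sub>1 T\<^sub>2 q = h q)"
    using F frame_onD(1)[OF F(1)] frame_contraction_smooth[OF F(1) assms]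
      contraction_in_frame[OF F(1) _ assms] by blast
qed

section \<open>The covariant derivative of a tensor field\<close>

lemma flinear_minus: "flinear M B \<Longrightarrow> flinear M C \<Longrightarrow> flinear M (\<lambda>x p. B x p - C x p)"
  by (simp add: flinear_def algebra_simps)

lemma flinear_sum: "(\<And>i. i \<in> I \<Longrightarrow> flinear M (B i)) \<Longrightarrow> flinear M (\<lambda>x p. \<Sum>i\<in>I. B i x p)"
  by (simp add: flinear_def sum.distrib sum_distrib_left)

definition multilinear :: "('b \<Rightarrow> 'a \<Rightarrow> real) set \<Rightarrow> nat \<Rightarrow> (('b \<Rightarrow> 'a \<Rightarrow> real) list \<Rightarrow> 'a \<Rightarrow> real) \<Rightarrow> bool" where
  "multilinear M n P \<longleftrightarrow> (\<forall>xs. length xs = n \<and> set xs \<subseteq> M \<longrightarrow>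
     P xs \<in> smooth_functions A \<and> (\<forall>j<n. flinear M (\<lambda>x. P (xs[j := x]))))"

lemma multilinearI:
  assumes "\<And>xs. length xs = n \<Longrightarrow> set xs \<subseteq> M \<Longrightarrow> P xs \<in> smooth_functions A"
    and "\<And>xs j. length xs = n \<Longrightarrow> set xs \<subseteq> M \<Longrightarrow> j < n \<Longrightarrow> flinear M (\<lambda>x. P (xs[j := x]))"
  shows "multilinear M n P"
  using assms by (simp add: multilinear_def)

lemma multilinearD:
  assumes "multilinear M n P" "length xs = n" "set xs \<subseteq> M"
  shows "P xs \<in> smooth_functions A" "j < n \<Longrightarrow> flinear M (\<lambda>x. P (xs[j := x]))"
  using assms by (simp_all add: multilinear_def)

lemma multilinear_diff:
  assumes "multilinear M n P" "multilinear M n Q"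
  shows "multilinear M n (\<lambda>xs p. P xs p - Q xs p)"
proof (rule multilinearI)
  fix xs assume xs: "length xs = n" "set xs \<subseteq> M"
  note P = multilinearD[OF assms(1) xs] and Q = multilinearD[OF assms(2) xs]
  show "(\<lambda>p. P xs p - Q xs p) \<in> smooth_functions A"
    by (intro smooth_function_diff P Q)
  show "flinear M (\<lambda>x p. P (xs[j := x]) p - Q (xs[j := x]) p)" if "j < n" for j
    by (intro flinear_minus P Q that)
qed

lemma multilinear_sum:
  assumes "\<And>i. i \<in> I \<Longrightarrow> multilinear M n (P i)"
  shows "multilinear M n (\<lambda>xs p. \<Sum>i\<in>I. P i xs p)"
proof (rule multilinearI)
  fix xs assume xs: "length xs = n" "set xs \<subseteq> M"
  note P = multilinearD[OF assms xs]
  show "(\<lambda>p. \<Sum>i\<in>I. P i xs p) \<in> smooth_functions A"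
    by (intro smooth_function_sum P)
  show "flinear M (\<lambda>x p. \<Sum>i\<in>I. P i (xs[j := x]) p)" if "j < n" for j
    by (intro flinear_sum P that)
qed

text \<open>
  The common properties of the covariant derivatives of vector fields and of one-forms along \<open>X\<close>.
\<close>
definition derivation_over :: "'a vfield \<Rightarrow> ('b \<Rightarrow> 'a \<Rightarrow> real) set \<Rightarrow> (('b \<Rightarrow> 'a \<Rightarrow> real) \<Rightarrow> 'b \<Rightarrow> 'a \<Rightarrow> real) \<Rightarrow> bool" where
  "derivation_over X M D \<longleftrightarrow> (\<forall>x\<in>M. D x \<in> M) \<and>
     (\<forall>x\<in>M. \<forall>y\<in>M. D (fadd x y) = fadd (D x) (D y)) \<and>
     (\<forall>f\<in>smooth_functions A. \<forall>x\<in>M. D (fscale f x) = fadd (fscale f (D x)) (fscale (X f) x))"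

text \<open>
  In the slot \<open>j\<close>, the terms \<open>X (P \<dots>)\<close> and \<open>P (\<dots>, D x, \<dots>)\<close> both fail to be linear over the smooth
  functions, by the same term \<open>X f * P (\<dots>, x, \<dots>)\<close>; all the other summands are linear in that slot.
\<close>
lemma derivation_multilinear:
  assumes X: "X \<in> vector_fields A" and D: "derivation_over X M D" and M: "submodule M"
    and P: "multilinear M n P"
  shows "multilinear M n (\<lambda>xs p. X (P xs) p - (\<Sum>j<length xs. P (xs[j := D (xs ! j)]) p))"
proof (rule multilinearI)
  fix xs assume xs: "length xs = n" "set xs \<subseteq> M"
  have DM: "D x \<in> M" if "x \<in> M" for x using D that by (simp add: derivation_over_def)
  have nth: "xs ! k \<in> M" if "k < n" for k using xs that by auto
  have upd: "length (xs[k := x]) = n" "set (xs[k := x]) \<subseteq> M" if "x \<in> M" for k x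
    using xs that set_update_subset_insert[of xs k x] by auto
  show "(\<lambda>p. X (P xs) p - (\<Sum>j<length xs. P (xs[j := D (xs ! j)]) p)) \<in> smooth_functions A"
    using xs by (intro smooth_function_diff smooth_function_sum vector_field_smooth[OF X]
        multilinearD(1)[OF P] upd DM nth) auto
  fix j assume j: "j < n"
  have Pj: "flinear M (\<lambda>x. P (xs[j := x]))" by (rule multilinearD(2)[OF P xs j])
  have Psm: "P (xs[j := x]) \<in> smooth_functions A" if "x \<in> M" for x
    by (intro multilinearD(1)[OF P] upd that)
  have main: "flinear M (\<lambda>x p. X (P (xs[j := x])) p - P (xs[j := D x]) p)"
    unfolding flinear_def
  proof (intro conjI ballI ext)
    fix x y p assume xy: "x \<in> M" "y \<in> M"
    have 1: "P (xs[j := fadd x y]) = (\<lambda>p. P (xs[j := x]) p + P (xs[j := y]) p)"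
      using Pj xy by (simp add: flinear_def)
    have 2: "D (fadd x y) = fadd (D x) (D y)"
      using D xy by (simp add: derivation_over_def)
    show "X (P (xs[j := fadd x y])) p - P (xs[j := D (fadd x y)]) p =
      X (P (xs[j := x])) p - P (xs[j := D x]) p + (X (P (xs[j := y])) p - P (xs[j := D y]) p)"
      unfolding 1 2 vector_field_add[OF X Psm Psm, OF xy]
        flinear_add[OF Pj DM DM, OF xy] by simp
  next
    fix f x p assume f: "f \<in> smooth_functions A" and x: "x \<in> M"
    have 1: "P (xs[j := fscale f x]) = (\<lambda>p. f p * P (xs[j := x]) p)"
      using Pj f x by (simp add: flinear_def)
    have 2: "D (fscale f x) = fadd (fscale f (D x)) (fscale (X f) x)"
      using D f x by (simp add: derivation_over_def)
    have Xf: "X f \<in> smooth_functions A" using vector_field_smooth[OF X f] .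
    have 3: "fscale f (D x) \<in> M" "fscale (X f) x \<in> M"
      using M DM x f Xf by (simp_all add: submodule_def)
    show "X (P (xs[j := fscale f x])) p - P (xs[j := D (fscale f x)]) p =
      f p * (X (P (xs[j := x])) p - P (xs[j := D x]) p)"
      unfolding 1 2 vector_field_mult[OF X f Psm, OF x] flinear_add[OF Pj 3]
        flinear_scale[OF Pj f DM[OF x]] flinear_scale[OF Pj Xf x]
      by (simp add: algebra_simps)
  qed
  have rest: "flinear M (\<lambda>x p. \<Sum>k\<in>{..<n} - {j}. P (xs[k := D (xs ! k), j := x]) p)"
    by (intro flinear_sum multilinearD(2)[OF P] upd DM nth j) auto
  have eq: "(\<lambda>x p. X (P (xs[j := x])) p - (\<Sum>k<length (xs[j := x]). P (xs[j := x, k := D (xs[j := x] ! k)]) p)) =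
     (\<lambda>x p. (X (P (xs[j := x])) p - P (xs[j := D x]) p) -
        (\<Sum>k\<in>{..<n} - {j}. P (xs[k := D (xs ! k), j := x]) p))"
  proof (intro ext)
    fix x p
    have "(\<Sum>k<length (xs[j := x]). P (xs[j := x, k := D (xs[j := x] ! k)]) p) =
      P (xs[j := x, j := D (xs[j := x] ! j)]) p + (\<Sum>k\<in>{..<n} - {j}. P (xs[j := x, k := D (xs[j := x] ! k)]) p)"
      using xs j by (simp add: sum.remove[of "{..<n}" j])
    also have "(\<Sum>k\<in>{..<n} - {j}. P (xs[j := x, k := D (xs[j := x] ! k)]) p) =
        (\<Sum>k\<in>{..<n} - {j}. P (xs[k := D (xs ! k), j := x]) p)"
      by (intro sum.cong refl) (simp add: list_update_swap)
    finally show "X (P (xs[j := x])) p - (\<Sum>k<length (xs[j := x]). P (xs[j := x, k := D (xs[j := x] ! k)]) p) =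
      (X (P (xs[j := x])) p - P (xs[j := D x]) p) -
        (\<Sum>k\<in>{..<n} - {j}. P (xs[k := D (xs ! k), j := x]) p)"
      using xs j by simp
  qed
  show "flinear M (\<lambda>x p. X (P (xs[j := x])) p - (\<Sum>k<length (xs[j := x]). P (xs[j := x, k := D (xs[j := x] ! k)]) p))"
    unfolding eq by (rule flinear_minus[OF main rest])
qed

lemma tensor_fields_multilinear:
  "T \<in> tensor_fields A r s \<longleftrightarrow>
     (\<forall>vs. length vs = s \<and> set vs \<subseteq> vector_fields A \<longrightarrow> multilinear (one_forms A) r (\<lambda>\<alpha>s. T \<alpha>s vs)) \<and>
     (\<forall>\<alpha>s. length \<alpha>s = r \<and> set \<alpha>s \<subseteq> one_forms A \<longrightarrow> multilinear (vector_fields A) s (T \<alpha>s))"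
  unfolding tensor_fields_iff multilinear_def tensor_args_def by auto

end

locale connected_manifold = smooth_manifold A
  for A :: "('a::{t2_space, second_countable_topology}, 'n::finite) chart set" +
  fixes nabla :: "'a vfield \<Rightarrow> 'a vfield \<Rightarrow> 'a vfield"
  assumes connection: "affine_connection A nabla"
begin

lemma nabla_rules:
  assumes "X \<in> vector_fields A" "Y \<in> vector_fields A"
  shows nabla_closed: "nabla X Y \<in> vector_fields A"
    and nabla_add_left: "Z \<in> vector_fields A \<Longrightarrow> nabla (fadd X Z) Y = fadd (nabla X Y) (nabla Z Y)"
    and nabla_scale_left: "f \<in> smooth_functions A \<Longrightarrow> nabla (fscale f X) Y = fscale f (nabla X Y)"
    and nabla_add_right: "Z \<in> vector_fields A \<Longrightarrow> nabla X (fadd Y Z) = fadd (nabla X Y) (nabla X Z)"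
    and nabla_scale_right: "f \<in> smooth_functions A \<Longrightarrow>
      nabla X (fscale f Y) = fadd (fscale f (nabla X Y)) (fscale (X f) Y)"
  using connection assms unfolding affine_connection_def by blast+

abbreviation "nform \<equiv> nabla_form A nabla"

lemma nabla_form_one_form:
  assumes X: "X \<in> vector_fields A" and \<alpha>: "\<alpha> \<in> one_forms A"
  shows "nform X \<alpha> \<in> one_forms A"
  unfolding one_forms_def
proof (intro CollectI conjI ballI allI impI ext)
  note sm = vector_field_smooth[OF X] one_form_smooth[OF \<alpha>]
  show "nform X \<alpha> Y \<in> smooth_functions A" if Y: "Y \<in> vector_fields A" for Y
    using Y nabla_closed[OF X Y] by (simp add: nabla_form_def sm smooth_function_diff)
  show "nform X \<alpha> Y p = 0" if "Y \<notin> vector_fields A" for Y p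
    using that by (simp add: nabla_form_def)
  show "nform X \<alpha> (fadd Y Z) p = nform X \<alpha> Y p + nform X \<alpha> Z p"
    if Y: "Y \<in> vector_fields A" and Z: "Z \<in> vector_fields A" for Y Z p
    using Y Z nabla_closed[OF X Y] nabla_closed[OF X Z] vector_fields_fadd[OF Y Z]
    by (simp add: nabla_form_def nabla_add_right[OF X] one_form_add[OF \<alpha>] vector_field_add[OF X] sm)
  show "nform X \<alpha> (fscale f Y) p = f p * nform X \<alpha> Y p"
    if f: "f \<in> smooth_functions A" and Y: "Y \<in> vector_fields A" for f Y p
    using f Y nabla_closed[OF X Y] vector_fields_fscale[OF f Y] vector_fields_fscale[OF f nabla_closed[OF X Y]]
      vector_fields_fscale[OF vector_field_smooth[OF X f] Y]
    by (simp add: nabla_form_def nabla_scale_right[OF X] one_form_add[OF \<alpha>] one_form_scale[OF \<alpha>]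
        vector_field_mult[OF X] sm algebra_simps)
qed

lemma derivation_nabla_form:
  assumes X: "X \<in> vector_fields A"
  shows "derivation_over X (one_forms A) (nform X)"
  unfolding derivation_over_def
proof (intro conjI ballI ext)
  note Xsm = vector_field_smooth[OF X]
  show "nform X \<alpha> \<in> one_forms A" if "\<alpha> \<in> one_forms A" for \<alpha>
    by (rule nabla_form_one_form[OF X that])
  show "nform X (fadd \<alpha> \<beta>) Y p = fadd (nform X \<alpha>) (nform X \<beta>) Y p"
    if "\<alpha> \<in> one_forms A" "\<beta> \<in> one_forms A" for \<alpha> \<beta> Y p
    using that by (auto simp: nabla_form_def fadd_def vector_field_add[OF X] one_form_smooth)
  show "nform X (fscale f \<alpha>) Y p = fadd (fscale f (nform X \<alpha>)) (fscale (X f) \<alpha>) Y p"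
    if "f \<in> smooth_functions A" "\<alpha> \<in> one_forms A" for f \<alpha> Y p
    using that by (auto simp: nabla_form_def fadd_def fscale_def vector_field_mult[OF X] one_form_smooth
        one_form_outside algebra_simps)
qed

lemma derivation_nabla:
  "X \<in> vector_fields A \<Longrightarrow> derivation_over X (vector_fields A) (nabla X)"
  by (simp add: derivation_over_def nabla_closed nabla_add_right nabla_scale_right)

lemma nabla_form_add_left:
  assumes "X \<in> vector_fields A" "Y \<in> vector_fields A" "\<alpha> \<in> one_forms A"
  shows "nform (fadd X Y) \<alpha> = fadd (nform X \<alpha>) (nform Y \<alpha>)"
proof (intro ext)
  fix Z p
  show "nform (fadd X Y) \<alpha> Z p = fadd (nform X \<alpha>) (nform Y \<alpha>) Z p"
    using assms nabla_add_left[OF assms(1) _ assms(2), of Z] nabla_closed[OF assms(1), of Z]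
      nabla_closed[OF assms(2), of Z]
    by (auto simp: nabla_form_def one_form_add) (simp_all add: fadd_def)
qed

lemma nabla_form_scale_left:
  assumes "X \<in> vector_fields A" "f \<in> smooth_functions A" "\<alpha> \<in> one_forms A"
  shows "nform (fscale f X) \<alpha> = fscale f (nform X \<alpha>)"
proof (intro ext)
  fix Z p
  show "nform (fscale f X) \<alpha> Z p = fscale f (nform X \<alpha>) Z p"
    using assms nabla_scale_left[OF assms(1) _ assms(2), of Z] nabla_closed[OF assms(1), of Z]
    by (auto simp: nabla_form_def one_form_scale) (simp_all add: fscale_def algebra_simps)
qed

abbreviation "ntensor \<equiv> nabla_tensor A nabla"

text \<open>
  For fixed vector arguments the corrections in the vector slots are multilinear in the one-forms
  anyway, and conversely, so \<open>derivation_multilinear\<close> can be applied to the two lists separately.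
\<close>
lemma nabla_tensor_field:
  assumes X: "X \<in> vector_fields A" and T: "T \<in> tensor_fields A r s"
  shows "ntensor X T \<in> tensor_fields A r s"
  unfolding tensor_fields_multilinear
proof (intro conjI allI impI)
  fix vs assume vs: "length vs = s \<and> set vs \<subseteq> vector_fields A"
  have "multilinear (one_forms A) r (\<lambda>\<alpha>s p.
      (X (T \<alpha>s vs) p - (\<Sum>j<length \<alpha>s. T (\<alpha>s[j := nform X (\<alpha>s ! j)]) vs p)) -
      (\<Sum>i<length vs. T \<alpha>s (vs[i := nabla X (vs ! i)]) p))"
  proof (rule multilinear_diff[OF _ multilinear_sum])
    have "multilinear (one_forms A) r (\<lambda>\<alpha>s. T \<alpha>s vs)"
      using T vs by (simp add: tensor_fields_multilinear)
    then show "multilinear (one_forms A) r (\<lambda>\<alpha>s p.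
        X (T \<alpha>s vs) p - (\<Sum>j<length \<alpha>s. T (\<alpha>s[j := nform X (\<alpha>s ! j)]) vs p))"
      by (rule derivation_multilinear[OF X derivation_nabla_form[OF X] submodule_one_forms])
    fix i assume "i \<in> {..<length vs}"
    then have "vs ! i \<in> vector_fields A" using vs by (auto simp: subset_eq)
    then have "nabla X (vs ! i) \<in> vector_fields A" by (rule nabla_closed[OF X])
    then have "set (vs[i := nabla X (vs ! i)]) \<subseteq> vector_fields A"
      using vs set_update_subset_insert[of vs i "nabla X (vs ! i)"] by auto
    then show "multilinear (one_forms A) r (\<lambda>\<alpha>s. T \<alpha>s (vs[i := nabla X (vs ! i)]))"
      using T vs by (simp add: tensor_fields_multilinear)
  qed
  then show "multilinear (one_forms A) r (\<lambda>\<alpha>s. ntensor X T \<alpha>s vs)"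
    by (simp add: nabla_tensor_def)
next
  fix \<alpha>s assume \<alpha>s: "length \<alpha>s = r \<and> set \<alpha>s \<subseteq> one_forms A"
  have "multilinear (vector_fields A) s (\<lambda>vs p.
      (X (T \<alpha>s vs) p - (\<Sum>i<length vs. T \<alpha>s (vs[i := nabla X (vs ! i)]) p)) -
      (\<Sum>j<length \<alpha>s. T (\<alpha>s[j := nform X (\<alpha>s ! j)]) vs p))"
  proof (rule multilinear_diff[OF _ multilinear_sum])
    have "multilinear (vector_fields A) s (T \<alpha>s)"
      using T \<alpha>s by (simp add: tensor_fields_multilinear)
    then show "multilinear (vector_fields A) s (\<lambda>vs p.
        X (T \<alpha>s vs) p - (\<Sum>i<length vs. T \<alpha>s (vs[i := nabla X (vs ! i)]) p))"
      by (rule derivation_multilinear[OF X derivation_nabla[OF X] submodule_vector_fields])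
    fix j assume "j \<in> {..<length \<alpha>s}"
    then have "\<alpha>s ! j \<in> one_forms A" using \<alpha>s by (auto simp: subset_eq)
    then have "nform X (\<alpha>s ! j) \<in> one_forms A" by (rule nabla_form_one_form[OF X])
    then have "set (\<alpha>s[j := nform X (\<alpha>s ! j)]) \<subseteq> one_forms A"
      using \<alpha>s set_update_subset_insert[of \<alpha>s j "nform X (\<alpha>s ! j)"] by auto
    then show "multilinear (vector_fields A) s (T (\<alpha>s[j := nform X (\<alpha>s ! j)]))"
      using T \<alpha>s by (simp add: tensor_fields_multilinear)
  qed
  moreover have "(\<lambda>vs p.
      (X (T \<alpha>s vs) p - (\<Sum>i<length vs. T \<alpha>s (vs[i := nabla X (vs ! i)]) p)) -
      (\<Sum>j<length \<alpha>s. T (\<alpha>s[j := nform X (\<alpha>s ! j)]) vs p)) = ntensor X T \<alpha>s"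
    by (simp add: nabla_tensor_def fun_eq_iff)
  ultimately show "multilinear (vector_fields A) s (ntensor X T \<alpha>s)" by simp
qed

lemma nabla_tensor_flinear:
  assumes T: "T \<in> tensor_fields A r s" and a: "(\<alpha>s, vs) \<in> tensor_args A r s"
  shows "flinear (vector_fields A) (\<lambda>X. ntensor X T \<alpha>s vs)"
  unfolding nabla_tensor_def
proof (intro flinear_minus flinear_sum)
  show "flinear (vector_fields A) (\<lambda>X. X (T \<alpha>s vs))"
    by (simp add: flinear_def fadd_def fscale_def)
  fix j assume "j \<in> {..<length \<alpha>s}"
  then have j: "j < r" using tensor_argsD[OF a] by simp
  note L = tensor_flinear_form[OF T a j] and n = tensor_args_nth(1)[OF a j]
  show "flinear (vector_fields A) (\<lambda>X. T (\<alpha>s[j := nform X (\<alpha>s ! j)]) vs)"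
    unfolding flinear_def
    by (simp add: fun_eq_iff nabla_form_add_left nabla_form_scale_left n nabla_form_one_form
        flinear_add[OF L] flinear_scale[OF L])
next
  fix i assume "i \<in> {..<length vs}"
  then have i: "i < s" using tensor_argsD[OF a] by simp
  note L = tensor_flinear_vector[OF T a i] and n = tensor_args_nth(2)[OF a i]
  show "flinear (vector_fields A) (\<lambda>X. T \<alpha>s (vs[i := nabla X (vs ! i)]))"
    unfolding flinear_def
    by (simp add: fun_eq_iff nabla_add_left nabla_scale_left n nabla_closed
        flinear_add[OF L] flinear_scale[OF L])
qed

lemma covariant_derivative_tensor_field:
  assumes T: "T \<in> tensor_fields A r s"
  shows "covariant_derivative A nabla T \<in> tensor_fields A r (Suc s)"
  unfolding tensor_fields_iff
proof (intro allI impI)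
  fix \<alpha>s ws assume a: "(\<alpha>s, ws) \<in> tensor_args A r (Suc s)"
  then obtain vs X where ws: "ws = vs @ [X]"
    by (metis length_Suc_conv_rev tensor_argsD(3))
  then have X: "X \<in> vector_fields A" and b: "(\<alpha>s, vs) \<in> tensor_args A r s"
    using a by (auto simp: tensor_args_def)
  note N = nabla_tensor_field[OF X T]
  have "flinear (vector_fields A) (\<lambda>v. covariant_derivative A nabla T \<alpha>s (ws[i := v]))" if "i < Suc s" for i
  proof (cases "i < s")
    case True
    then show ?thesis
      using tensor_flinear_vector[OF N b True] tensor_argsD(3)[OF b]
      by (simp add: covariant_derivative_def ws list_update_append)
  next
    case False
    with that have "i = s" by simp
    then show ?thesis
      using nabla_tensor_flinear[OF T b] tensor_argsD(3)[OF b]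
      by (simp add: covariant_derivative_def ws list_update_append)
  qed
  then show "covariant_derivative A nabla T \<alpha>s ws \<in> smooth_functions A \<and>
    (\<forall>j<r. flinear (one_forms A) (\<lambda>\<alpha>. covariant_derivative A nabla T (\<alpha>s[j := \<alpha>]) ws)) \<and>
    (\<forall>i<Suc s. flinear (vector_fields A) (\<lambda>v. covariant_derivative A nabla T \<alpha>s (ws[i := v])))"
    using tensor_smooth[OF N b] tensor_flinear_form[OF N b]
    by (simp add: covariant_derivative_def ws)
qed

section \<open>The Leibniz rule for the contraction\<close>

text \<open>
  Summing over the index in position \<open>j\<close> first. This is how corrections of a single slot are shown to
  cancel in a contraction over whole multi-indices.
\<close>
lemma sum_lists_slot_zero:
  fixes g :: "'i::finite list \<Rightarrow> real"
  assumes "j < r" "\<And>is. length is = r \<Longrightarrow> (\<Sum>a\<in>UNIV. g (is[j := a])) = 0"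
  shows "(\<Sum>is\<in>{is. length is = r}. g is) = 0"
  using assms
proof (induction r arbitrary: j g)
  case 0
  then show ?case by simp
next
  case (Suc r)
  show ?case
  proof (cases j)
    case 0
    have "(\<Sum>a\<in>UNIV. g (a # is)) = 0" if "length is = r" for "is"
      using Suc.prems(2)[of "undefined # is"] that 0 by simp
    then show ?thesis
      unfolding sum_lists_Suc by (subst sum.swap) (simp add: sum.neutral)
  next
    case (Suc k)
    have "(\<Sum>is\<in>{is. length is = r}. g (a # is)) = 0" for a
    proof (rule Suc.IH)
      show "k < r" using Suc.prems Suc by simp
      show "(\<Sum>b\<in>UNIV. g (a # is[k := b])) = 0" if "length is = r" for "is"
        using Suc.prems(2)[of "a # is"] that Suc by simp
    qed
    then show ?thesis unfolding sum_lists_Suc by simp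
  qed
qed

text \<open>
  The functions \<open>F i (E k)\<close> are constant, so \<open>(\<nabla>\<^sub>X F\<^sub>i)(E\<^sub>k) = - F\<^sub>i(\<nabla>\<^sub>X E\<^sub>k)\<close>: the coefficients of
  \<open>\<nabla>\<^sub>X F\<close> and of \<open>\<nabla>\<^sub>X E\<close> are opposite and transposed to each other.
\<close>
lemma dual_slots_derivative:
  assumes F: "frame_on N E F" "p \<in> N" and X: "X \<in> vector_fields A"
    and C: "flinear (one_forms A) C" and B: "flinear (vector_fields A) B"
  shows "(\<Sum>i\<in>UNIV. C (nform X (F i)) p * B (E i) p + C (F i) p * B (nabla X (E i)) p) = 0"
proof -
  note E = frame_onD(2)[OF F(1)] and FF = frame_onD(3)[OF F(1)]
  have nF: "nform X (F i) (E k) p = - F i (nabla X (E k)) p" for i k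
  proof -
    have "X (F i (E k)) p = X (\<lambda>q. if i = k then 1 else 0) p"
      by (rule vector_field_local[OF X one_form_smooth[OF FF E] smooth_function_const frame_onD(1)[OF F(1)] F(2)])
        (rule frame_onD(4)[OF F(1)])
    then show ?thesis using E vector_field_const[OF X] by (simp add: nabla_form_def)
  qed
  have "(\<Sum>i\<in>UNIV. C (nform X (F i)) p * B (E i) p) =
      (\<Sum>i\<in>UNIV. \<Sum>k\<in>UNIV. - (F i (nabla X (E k)) p * C (F k) p * B (E i) p))"
    by (simp add: frame_flinear_form[OF F C nabla_form_one_form[OF X FF]] nF sum_distrib_right sum_negf)
  also have "\<dots> = (\<Sum>k\<in>UNIV. \<Sum>i\<in>UNIV. - (F i (nabla X (E k)) p * C (F k) p * B (E i) p))"
    by (rule sum.swap)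
  also have "\<dots> = - (\<Sum>k\<in>UNIV. C (F k) p * B (nabla X (E k)) p)"
    by (simp add: frame_flinear_vector[OF F B nabla_closed[OF X E]] sum_distrib_left sum_negf mult_ac)
  finally show ?thesis by (simp add: sum.distrib)
qed

text \<open>
  In a frame, the derivative of each product of components differs from the wanted expression by
  one correction for every slot of \<open>T\<^sub>1\<close> and of \<open>T\<^sub>2\<close>. The corrections of dual slots cancel after summation
  over the common index, by \<open>dual_slots_derivative\<close>.
\<close>
lemma contraction_derivative:
  assumes X: "X \<in> vector_fields A" and T: "T\<^sub>1 \<in> tensor_fields A r s" "T\<^sub>2 \<in> tensor_fields A s r"
  shows "X (contraction A r s T\<^sub>1 T\<^sub>2) p =
    contraction A r s (ntensor X T\<^sub>1) T\<^sub>2 p + contraction A r s T\<^sub>1 (ntensor X T\<^sub>2) p"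
proof -
  obtain N E F where F: "frame_on N E F" "p \<in> N" by (rule local_frame_exists)
  note E = frame_onD(2)[OF F(1)] and FF = frame_onD(3)[OF F(1)]
  let ?I = "{is :: 'n list. length is = r}" and ?J = "{js :: 'n list. length js = s}"
  let ?T1 = "\<lambda>is js. T\<^sub>1 (map F is) (map E js)" and ?T2 = "\<lambda>js is. T\<^sub>2 (map F js) (map E is)"
  have a1: "(map F is, map E js) \<in> tensor_args A r s" and a2: "(map F js, map E is) \<in> tensor_args A s r"
    if "is \<in> ?I" "js \<in> ?J" for "is" js
    using that frame_tensor_args[OF F(1)] by auto
  have sm1: "?T1 is js \<in> smooth_functions A" and sm2: "?T2 js is \<in> smooth_functions A"
    if "is \<in> ?I" "js \<in> ?J" for "is" js
    using that tensor_smooth[OF T(1) a1] tensor_smooth[OF T(2) a2] by auto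
  \<comment> \<open>The corrections of the slot \<open>j\<close> of \<open>is\<close> and of the slot \<open>i\<close> of \<open>js\<close>, in both tensor fields.\<close>
  let ?U = "\<lambda>j is js. T\<^sub>1 ((map F is)[j := nform X (F (is ! j))]) (map E js) p * ?T2 js is p +
      ?T1 is js p * T\<^sub>2 (map F js) ((map E is)[j := nabla X (E (is ! j))]) p"
  let ?V = "\<lambda>i is js. T\<^sub>1 (map F is) ((map E js)[i := nabla X (E (js ! i))]) p * ?T2 js is p +
      ?T1 is js p * T\<^sub>2 ((map F js)[i := nform X (F (js ! i))]) (map E is) p"
  have U0: "(\<Sum>is\<in>?I. ?U j is js) = 0" if j: "j < r" and js: "js \<in> ?J" for j js
  proof (rule sum_lists_slot_zero[OF j])
    fix "is" :: "'n list" assume l: "length is = r"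
    have "(\<Sum>a\<in>UNIV. T\<^sub>1 ((map F is)[j := nform X (F a)]) (map E js) p * T\<^sub>2 (map F js) ((map E is)[j := E a]) p +
        T\<^sub>1 ((map F is)[j := F a]) (map E js) p * T\<^sub>2 (map F js) ((map E is)[j := nabla X (E a)]) p) = 0"
      by (rule dual_slots_derivative[OF F X, where C="\<lambda>\<alpha>. T\<^sub>1 ((map F is)[j := \<alpha>]) (map E js)"
            and B="\<lambda>v. T\<^sub>2 (map F js) ((map E is)[j := v])"])
        (use l js j in \<open>auto intro!: tensor_flinear_form[OF T(1) a1] tensor_flinear_vector[OF T(2) a2]\<close>)
    then show "(\<Sum>a\<in>UNIV. ?U j (is[j := a]) js) = 0"
      using l j by (simp add: map_update)
  qed
  have V0: "(\<Sum>js\<in>?J. ?V i is js) = 0" if i: "i < s" and "is": "is \<in> ?I" for i "is"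
  proof (rule sum_lists_slot_zero[OF i])
    fix js :: "'n list" assume l: "length js = s"
    have "(\<Sum>a\<in>UNIV. T\<^sub>2 ((map F js)[i := nform X (F a)]) (map E is) p * T\<^sub>1 (map F is) ((map E js)[i := E a]) p +
        T\<^sub>2 ((map F js)[i := F a]) (map E is) p * T\<^sub>1 (map F is) ((map E js)[i := nabla X (E a)]) p) = 0"
      by (rule dual_slots_derivative[OF F X, where C="\<lambda>\<alpha>. T\<^sub>2 ((map F js)[i := \<alpha>]) (map E is)"
            and B="\<lambda>v. T\<^sub>1 (map F is) ((map E js)[i := v])"])
        (use l "is" i in \<open>auto intro!: tensor_flinear_form[OF T(2) a2] tensor_flinear_vector[OF T(1) a1]\<close>)
    then show "(\<Sum>a\<in>UNIV. ?V i is (js[i := a])) = 0"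
      using l i by (simp add: map_update add.commute mult.commute)
  qed
  have summand: "X (?T1 is js) p * ?T2 js is p + ?T1 is js p * X (?T2 js is) p =
      ntensor X T\<^sub>1 (map F is) (map E js) p * ?T2 js is p + ?T1 is js p * ntensor X T\<^sub>2 (map F js) (map E is) p
      + (\<Sum>j<r. ?U j is js) + (\<Sum>i<s. ?V i is js)"
    if "is \<in> ?I" "js \<in> ?J" for "is" js
    using that by (simp add: nabla_tensor_def sum.distrib sum_distrib_left sum_distrib_right
        left_diff_distrib right_diff_distrib)
  have "X (contraction A r s T\<^sub>1 T\<^sub>2) p = X (frame_contraction E F r s T\<^sub>1 T\<^sub>2) p"
    by (rule vector_field_local[OF X contraction_smooth[OF T] frame_contraction_smooth[OF F(1) T]
          frame_onD(1)[OF F(1)] F(2) contraction_in_frame[OF F(1) _ T]])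
  also have "\<dots> = (\<Sum>is\<in>?I. \<Sum>js\<in>?J. X (?T1 is js) p * ?T2 js is p + ?T1 is js p * X (?T2 js is) p)"
  proof -
    have "X (frame_contraction E F r s T\<^sub>1 T\<^sub>2) p = (\<Sum>is\<in>?I. X (\<lambda>p. \<Sum>js\<in>?J. ?T1 is js p * ?T2 js is p) p)"
      unfolding frame_contraction_def[abs_def]
      by (rule vector_field_sum[OF X]) (intro smooth_function_sum smooth_function_mult sm1 sm2)
    also have "\<dots> = (\<Sum>is\<in>?I. \<Sum>js\<in>?J. X (\<lambda>p. ?T1 is js p * ?T2 js is p) p)"
      by (intro sum.cong refl vector_field_sum[OF X] smooth_function_mult sm1 sm2)
    also have "\<dots> = (\<Sum>is\<in>?I. \<Sum>js\<in>?J. X (?T1 is js) p * ?T2 js is p + ?T1 is js p * X (?T2 js is) p)"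
      by (intro sum.cong refl) (simp add: vector_field_mult[OF X sm1 sm2])
    finally show ?thesis .
  qed
  also have "\<dots> = (\<Sum>is\<in>?I. \<Sum>js\<in>?J.
      ntensor X T\<^sub>1 (map F is) (map E js) p * ?T2 js is p + ?T1 is js p * ntensor X T\<^sub>2 (map F js) (map E is) p
      + (\<Sum>j<r. ?U j is js) + (\<Sum>i<s. ?V i is js))"
    using summand by (intro sum.cong refl) blast
  also have "\<dots> = frame_contraction E F r s (ntensor X T\<^sub>1) T\<^sub>2 p + frame_contraction E F r s T\<^sub>1 (ntensor X T\<^sub>2) p
     + (\<Sum>is\<in>?I. \<Sum>js\<in>?J. \<Sum>j<r. ?U j is js) + (\<Sum>is\<in>?I. \<Sum>js\<in>?J. \<Sum>i<s. ?V i is js)"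
    unfolding frame_contraction_def by (simp only: sum.distrib)
  also have "(\<Sum>is\<in>?I. \<Sum>js\<in>?J. \<Sum>j<r. ?U j is js) = (\<Sum>js\<in>?J. \<Sum>j<r. \<Sum>is\<in>?I. ?U j is js)"
    by (subst sum.swap) (intro sum.cong refl sum.swap)
  also have "\<dots> = 0"
    by (rule sum.neutral, rule ballI, rule sum.neutral, rule ballI, rule U0) auto
  also have "(\<Sum>is\<in>?I. \<Sum>js\<in>?J. \<Sum>i<s. ?V i is js) = (\<Sum>is\<in>?I. \<Sum>i<s. \<Sum>js\<in>?J. ?V i is js)"
    by (intro sum.cong refl sum.swap)
  also have "\<dots> = 0"
    by (rule sum.neutral, rule ballI, rule sum.neutral, rule ballI, rule V0) auto
  finally show ?thesis
    using contraction_in_frame[OF F nabla_tensor_field[OF X T(1)] T(2)]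
      contraction_in_frame[OF F T(1) nabla_tensor_field[OF X T(2)]] by simp
qed

end

section \<open>The vector field contracted from two tensor fields\<close>

context smooth_manifold
begin

definition contracted_field :: "nat \<Rightarrow> nat \<Rightarrow> 'a tensor \<Rightarrow> 'a tensor \<Rightarrow> 'a vfield" where
  "contracted_field r s T S = (\<lambda>h. if h \<in> smooth_functions A
     then contraction A r s T (\<lambda>\<alpha>s. S (\<alpha>s @ [differential h])) else (\<lambda>p. 0))"

text \<open>
  This makes the contracted field a derivation: \<open>h \<mapsto> dh\<close> satisfies the product rule, and the contraction is
  linear over the smooth functions in the slot filled by \<open>dh\<close>.
\<close>
lemma contraction_snoc_flinear:
  assumes S: "S \<in> tensor_fields A (Suc s) r"
  shows "flinear (one_forms A) (\<lambda>\<alpha>. contraction A r s T (\<lambda>\<alpha>s. S (\<alpha>s @ [\<alpha>])))"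
  unfolding flinear_def
proof (intro conjI ballI ext)
  fix \<alpha> \<beta> p assume ab: "\<alpha> \<in> one_forms A" "\<beta> \<in> one_forms A"
  obtain N E F where F: "frame_on N E F" "p \<in> N"
    "\<forall>r s T\<^sub>1 T\<^sub>2. contraction A r s T\<^sub>1 T\<^sub>2 p = frame_contraction E F r s T\<^sub>1 T\<^sub>2 p"
    by (rule contraction_chosen_frame[of p])
  show "contraction A r s T (\<lambda>\<alpha>s. S (\<alpha>s @ [fadd \<alpha> \<beta>])) p =
    contraction A r s T (\<lambda>\<alpha>s. S (\<alpha>s @ [\<alpha>])) p + contraction A r s T (\<lambda>\<alpha>s. S (\<alpha>s @ [\<beta>])) p"
    unfolding F(3)[rule_format] frame_contraction_def sum.distrib[symmetric]
    by (intro sum.cong refl)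
      (simp add: flinear_add[OF tensor_flinear_snoc_form[OF S frame_tensor_args[OF F(1)]]] ab distrib_left)
next
  fix f \<alpha> p assume f: "f \<in> smooth_functions A" and \<alpha>: "\<alpha> \<in> one_forms A"
  obtain N E F where F: "frame_on N E F" "p \<in> N"
    "\<forall>r s T\<^sub>1 T\<^sub>2. contraction A r s T\<^sub>1 T\<^sub>2 p = frame_contraction E F r s T\<^sub>1 T\<^sub>2 p"
    by (rule contraction_chosen_frame[of p])
  show "contraction A r s T (\<lambda>\<alpha>s. S (\<alpha>s @ [fscale f \<alpha>])) p = f p * contraction A r s T (\<lambda>\<alpha>s. S (\<alpha>s @ [\<alpha>])) p"
    unfolding F(3)[rule_format] frame_contraction_def sum_distrib_left
    by (intro sum.cong refl)
      (simp add: flinear_scale[OF tensor_flinear_snoc_form[OF S frame_tensor_args[OF F(1)]]] f \<alpha>)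
qed

lemma differential_add:
  assumes "h \<in> smooth_functions A" "k \<in> smooth_functions A"
  shows "differential (\<lambda>p. h p + k p) = fadd (differential h) (differential k)"
  using assms by (auto simp: differential_def fadd_def vector_field_add fun_eq_iff)

lemma differential_scale:
  assumes "h \<in> smooth_functions A"
  shows "differential (\<lambda>p. c * h p) = fscale (\<lambda>p. c) (differential h)"
  using assms by (auto simp: differential_def fscale_def vector_field_scale fun_eq_iff)

lemma differential_mult:
  assumes "h \<in> smooth_functions A" "k \<in> smooth_functions A"
  shows "differential (\<lambda>p. h p * k p) = fadd (fscale k (differential h)) (fscale h (differential k))"
  using assms by (auto simp: differential_def fadd_def fscale_def vector_field_mult fun_eq_iff mult.commute)

lemma contracted_field_vector_field:
  assumes T: "T \<in> tensor_fields A r s" and S: "S \<in> tensor_fields A (Suc s) r"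
  shows "contracted_field r s T S \<in> vector_fields A"
proof -
  note L = contraction_snoc_flinear[OF S, of T]
  note d = differential_one_form
  show ?thesis
    unfolding vector_fields_def
  proof (intro CollectI conjI ballI allI impI ext)
    show "contracted_field r s T S h \<in> smooth_functions A" if "h \<in> smooth_functions A" for h
      using contraction_smooth[OF T tensor_snoc_form[OF S d[OF that]]] that
      by (simp add: contracted_field_def)
    show "contracted_field r s T S h p = 0" if "h \<notin> smooth_functions A" for h p
      using that by (simp add: contracted_field_def)
    show "contracted_field r s T S (\<lambda>p. h p + k p) p = contracted_field r s T S h p + contracted_field r s T S k p"
      if "h \<in> smooth_functions A" "k \<in> smooth_functions A" for h k p
      using that flinear_add[OF L d d, of h k p] smooth_function_add[of h k]
      by (simp add: contracted_field_def differential_add)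
    show "contracted_field r s T S (\<lambda>p. c * h p) p = c * contracted_field r s T S h p"
      if "h \<in> smooth_functions A" for c h p
      using that flinear_scale[OF L smooth_function_const d, of h c p] smooth_function_mult[of "\<lambda>p. c" h]
      by (simp add: contracted_field_def differential_scale)
    show "contracted_field r s T S (\<lambda>p. h p * k p) p =
        contracted_field r s T S h p * k p + h p * contracted_field r s T S k p"
      if hk: "h \<in> smooth_functions A" "k \<in> smooth_functions A" for h k p
      using hk flinear_add[OF L one_forms_fscale[OF hk(2) d[OF hk(1)]] one_forms_fscale[OF hk(1) d[OF hk(2)]], of p]
        flinear_scale[OF L hk(2) d[OF hk(1)], of p] flinear_scale[OF L hk(1) d[OF hk(2)], of p]
        smooth_function_mult[OF hk]
      by (simp add: contracted_field_def differential_mult)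
  qed
qed

text \<open>
  By definition this holds for differentials, and these span the one-forms pointwise.
\<close>
lemma one_form_contracted_field:
  assumes T: "T \<in> tensor_fields A r s" and S: "S \<in> tensor_fields A (Suc s) r" and \<alpha>: "\<alpha> \<in> one_forms A"
  shows "\<alpha> (contracted_field r s T S) = contraction A r s T (\<lambda>\<alpha>s. S (\<alpha>s @ [\<alpha>]))"
proof
  fix p
  obtain U \<phi> \<eta> N where "coordinate_patch A U \<phi> \<eta> N" and p: "p \<in> N" by (rule coordinate_patch_at)
  then interpret coordinate_patch A U \<phi> \<eta> N by simp
  show "\<alpha> (contracted_field r s T S) p = contraction A r s T (\<lambda>\<alpha>s. S (\<alpha>s @ [\<alpha>])) p"
    using patch_flinear[OF flinear_one_form[OF \<alpha>] contracted_field_vector_field[OF T S] p]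
      frame_flinear_form[OF frame_on_patch p contraction_snoc_flinear[OF S] \<alpha>]
    by (simp add: contracted_field_def coord_smooth mult.commute)
qed

section \<open>Local orthonormal frames\<close>

text \<open>
  The composition may be undefined far away from \<open>p\<close>, so it is cut off; near \<open>p\<close> it is kept.
\<close>
lemma smooth_function_compose_near:
  fixes \<theta> :: "real \<Rightarrow> real"
  assumes k: "k \<in> smooth_functions A" and \<theta>: "smooth_on T \<theta>" "open T" "k p \<in> T"
  obtains u W where "u \<in> smooth_functions A" "open W" "p \<in> W" "\<And>q. q \<in> W \<Longrightarrow> k q \<in> T \<and> u q = \<theta> (k q)"
proof -
  obtain U \<phi> where U: "(U, \<phi>) \<in> A" "p \<in> U" by (rule chart_at)
  have "open (k -` T)"
    using smooth_function_continuous[OF k] \<theta>(2) by (simp add: continuous_on_open_vimage)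
  then have N: "open (U \<inter> k -` T)" "U \<inter> k -` T \<subseteq> U" "p \<in> U \<inter> k -` T"
    using chart_open[OF U(1)] U(2) \<theta>(3) by auto
  obtain \<eta> W where \<eta>: "\<eta> \<in> smooth_functions A" "open W" "p \<in> W" "W \<subseteq> U \<inter> k -` T"
    "\<And>q. q \<in> W \<Longrightarrow> \<eta> q = 1" "supp \<eta> \<subseteq> U \<inter> k -` T"
    by (rule smooth_bump_at[OF N(1,3)]) blast
  have "smooth_on (\<phi> ` (U \<inter> k -` T)) (k \<circ> inv_into U \<phi>)"
    using smooth_function_chart[OF k U(1)] by (rule smooth_on_subset) auto
  then have "smooth_on (\<phi> ` (U \<inter> k -` T)) (\<lambda>x. \<theta> ((k \<circ> inv_into U \<phi>) x))"
    by (rule smooth_on_compose[OF \<theta>(1)]) (use U(1) open_chart_image[OF U(1) N(1,2)] \<theta>(2) in auto)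
  from smooth_function_chart_extend[OF U(1) N(1,2) this \<eta>(1,6)]
  show thesis
  proof (rule that[OF _ \<eta>(2,3)])
    fix q assume q: "q \<in> W"
    then have "q \<in> U \<inter> k -` T" using \<eta>(4) by blast
    then show "k q \<in> T \<and> (if q \<in> U \<inter> k -` T
        then \<eta> q * \<theta> ((k \<circ> inv_into U \<phi>) (\<phi> q)) else 0) = \<theta> (k q)"
      using \<eta>(5)[OF q] U(1) by simp
  qed
qed

end

locale metric_manifold = smooth_manifold A
  for A :: "('a::{t2_space, second_countable_topology}, 'n::finite) chart set" +
  fixes g :: "'a tensor"
  assumes metric: "riemannian_metric A g"
begin

lemma metric_tensor: "g \<in> tensor_fields A 0 (Suc (Suc 0))"
  using metric by (simp add: riemannian_metric_def numeral_2_eq_2)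

lemma metric_sym: "X \<in> vector_fields A \<Longrightarrow> Y \<in> vector_fields A \<Longrightarrow> g [] [X, Y] = g [] [Y, X]"
  using metric by (simp add: riemannian_metric_def)

lemma metric_pos: "X \<in> vector_fields A \<Longrightarrow> X h p \<noteq> 0 \<Longrightarrow> g [] [X, X] p > 0"
  using metric unfolding riemannian_metric_def by blast

lemma metric_smooth: "X \<in> vector_fields A \<Longrightarrow> Y \<in> vector_fields A \<Longrightarrow> g [] [X, Y] \<in> smooth_functions A"
  by (rule tensor_smooth[OF metric_tensor]) (simp add: tensor_args_def)

lemma metric_flinear_right: "X \<in> vector_fields A \<Longrightarrow> flinear (vector_fields A) (\<lambda>Y. g [] [X, Y])"
  using tensor_flinear_vector[OF metric_tensor, of "[]" "[X, X]" 1] by (simp add: tensor_args_def)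

lemma metric_flinear_left: "Y \<in> vector_fields A \<Longrightarrow> flinear (vector_fields A) (\<lambda>X. g [] [X, Y])"
  using tensor_flinear_vector[OF metric_tensor, of "[]" "[Y, Y]" 0] by (simp add: tensor_args_def)

text \<open>
  The Gram-Schmidt process in the form in which the component along a new unit vector is at once
  removed from all vectors that are not yet processed. So the vectors in \<open>I\<close> are orthogonal to all others,
  and linear independence at \<open>p\<close> guarantees that the next vector can be normalised near \<open>p\<close>.
\<close>
lemma partial_orthonormal_frame:
  fixes I :: "'n set"
  shows "\<exists>E W. (\<forall>i. E i \<in> vector_fields A) \<and> open W \<and> p \<in> W \<and>
     (\<forall>q\<in>W. \<forall>i\<in>I. \<forall>j. g [] [E i, E j] q = (if i = j then 1 else 0)) \<and>
     (\<forall>c. (\<forall>h\<in>smooth_functions A. (\<Sum>i\<in>UNIV. c i * E i h p) = 0) \<longrightarrow> c = (\<lambda>i. 0))"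
  using finite[of I]
proof (induction I)
  case empty
  obtain U \<phi> \<eta> N where "coordinate_patch A U \<phi> \<eta> N" and p: "p \<in> N" by (rule coordinate_patch_at)
  then interpret coordinate_patch A U \<phi> \<eta> N by simp
  have "c = (\<lambda>i. 0)" if c: "\<forall>h\<in>smooth_functions A. (\<Sum>i\<in>UNIV. c i * partial i h p) = 0" for c
  proof
    fix j
    have "(\<Sum>i\<in>UNIV. c i * partial i (coord j) p) = 0" using c coord_smooth by blast
    then show "c j = 0"
      by (simp add: partial_coord[OF p] if_distrib[of "\<lambda>x. _ * x"] cong: if_cong)
  qed
  then show ?case
    using partial_vector_field patch_open p by (intro exI[of _ partial] exI[of _ N] conjI) simp_all
next
  case (insert k I)
  from insert.IH obtain E W where EW: "(\<forall>i. E i \<in> vector_fields A) \<and> open W \<and> p \<in> W \<and>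
     (\<forall>q\<in>W. \<forall>i\<in>I. \<forall>j. g [] [E i, E j] q = (if i = j then 1 else 0)) \<and>
     (\<forall>c. (\<forall>h\<in>smooth_functions A. (\<Sum>i\<in>UNIV. c i * E i h p) = 0) \<longrightarrow> c = (\<lambda>i. 0))"
    by (elim exE)
  then have E: "\<And>i. E i \<in> vector_fields A" and W: "open W" "p \<in> W"
    and ortho: "\<And>q i j. q \<in> W \<Longrightarrow> i \<in> I \<Longrightarrow> g [] [E i, E j] q = (if i = j then 1 else 0)"
    and indep: "\<And>c. (\<And>h. h \<in> smooth_functions A \<Longrightarrow> (\<Sum>i\<in>UNIV. c i * E i h p) = 0) \<Longrightarrow> c = (\<lambda>i. 0)"
    by simp_all
  have "\<exists>h. E k h p \<noteq> 0"
  proof (rule ccontr)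
    assume "\<not> ?thesis"
    then have "(\<Sum>i\<in>UNIV. (if i = k then 1 else 0) * E i h p) = 0" for h
      by (simp add: if_distrib[of "\<lambda>x. x * _"] cong: if_cong)
    then have "(\<lambda>i. if i = k then 1 else 0) = (\<lambda>i. 0 :: real)" by (intro indep)
    then show False by (metis zero_neq_one)
  qed
  then have pos: "g [] [E k, E k] p \<in> {0<..}" using metric_pos[OF E] by auto
  obtain u V where u: "u \<in> smooth_functions A" "open V" "p \<in> V"
    "\<And>q. q \<in> V \<Longrightarrow> g [] [E k, E k] q \<in> {0<..} \<and> u q = g [] [E k, E k] q powr (- 1 / 2)"
    by (rule smooth_function_compose_near[OF metric_smooth[OF E E] smooth_on_powr open_greaterThan pos]) blast
  define e where "e = fscale u (E k)"
  have e: "e \<in> vector_fields A" unfolding e_def using u(1) E by (rule vector_fields_fscale)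
  have uu: "u q * (u q * g [] [E k, E k] q) = 1" if "q \<in> V" for q
  proof -
    have "g [] [E k, E k] q powr (- 1 / 2) * g [] [E k, E k] q powr (- 1 / 2) * g [] [E k, E k] q powr 1 = 1"
      using u(4)[OF that] by (simp flip: powr_add)
    then show ?thesis using u(4)[OF that] by (simp add: mult.assoc)
  qed
  have ge: "g [] [e, e] q = 1" if "q \<in> V" for q
    using uu[OF that] flinear_scale[OF metric_flinear_left[OF e] u(1) E] flinear_scale[OF metric_flinear_right[OF E] u(1) E]
    by (simp add: e_def)
  have gIe: "g [] [E i, e] q = 0" "g [] [e, E i] q = 0" if "q \<in> W" "i \<in> I" for q i
  proof -
    have "i \<noteq> k" using that insert by blast
    then show "g [] [E i, e] q = 0"
      unfolding e_def using ortho[OF that, of k] flinear_scale[OF metric_flinear_right[OF E] u(1) E] by simp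
    then show "g [] [e, E i] q = 0" using metric_sym[OF e E] by simp
  qed
  let ?m = "\<lambda>j q. (-1) * g [] [e, E j] q"
  have m: "?m j \<in> smooth_functions A" for j
    by (intro smooth_function_mult smooth_function_const metric_smooth e E)
  have me: "fscale (?m j) e \<in> vector_fields A" for j by (rule vector_fields_fscale[OF m e])
  define E' where "E' = (\<lambda>j. if j = k then e else if j \<in> I then E j else fadd (E j) (fscale (?m j) e))"
  have E': "E' j \<in> vector_fields A" for j
    using e E me by (auto simp: E'_def)
  have "g [] [E' i, E' j] q = (if i = j then 1 else 0)" if q: "q \<in> W \<inter> V" and i: "i \<in> insert k I" for q i j
  proof -
    have gj: "g [] [X, fadd (E j) (fscale (?m j) e)] q = g [] [X, E j] q - g [] [e, E j] q * g [] [X, e] q"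
      if "X \<in> vector_fields A" for X
      using flinear_add[OF metric_flinear_right[OF that] E me, of j j q]
        flinear_scale[OF metric_flinear_right[OF that] m e, of j q] by simp
    show ?thesis
    proof (cases "i = k")
      case True
      then show ?thesis
        using q ge gIe(2)[of q j] gj[OF e] insert by (auto simp: E'_def)
    next
      case False
      then have "i \<in> I" using i by blast
      then show ?thesis
        using False q gIe(1)[of q i] gj[OF E[of i]] ortho[of q i j] insert by (auto simp: E'_def)
    qed
  qed
  moreover have "c = (\<lambda>i. 0)" if c: "\<forall>h\<in>smooth_functions A. (\<Sum>i\<in>UNIV. c i * E' i h p) = 0" for c
  proof -
    \<comment> \<open>A linear relation \<open>c\<close> between the new vectors at \<open>p\<close>, rewritten in terms of the old ones.\<close>
    define d where "d = (\<lambda>j. if j = k then u p * (c k + (\<Sum>j\<in>UNIV. if j = k \<or> j \<in> I then 0 else c j * ?m j p)) else c j)"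
    have "(\<Sum>i\<in>UNIV. d i * E i h p) = (\<Sum>i\<in>UNIV. c i * E' i h p)" for h
    proof -
      have "c i * E' i h p = (if i = k then 0 else c i * E i h p) + (if i = k then c k * e h p else 0) +
          (if i = k \<or> i \<in> I then 0 else c i * ?m i p) * e h p" for i
        using insert by (simp add: E'_def fadd_def fscale_def algebra_simps)
      then have "(\<Sum>i\<in>UNIV. c i * E' i h p) = (\<Sum>i\<in>UNIV. if i = k then 0 else c i * E i h p) + c k * e h p +
          (\<Sum>i\<in>UNIV. if i = k \<or> i \<in> I then 0 else c i * ?m i p) * e h p"
        by (simp add: sum.distrib sum_distrib_right)
      also have "\<dots> = (\<Sum>i\<in>UNIV. (if i = k then 0 else c i * E i h p) + (if i = k then d k * E k h p else 0))"
        by (simp add: sum.distrib d_def e_def fscale_def algebra_simps)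
      also have "\<dots> = (\<Sum>i\<in>UNIV. d i * E i h p)"
        by (intro sum.cong refl) (auto simp: d_def)
      finally show ?thesis by simp
    qed
    then have d0: "d = (\<lambda>i. 0)" using c by (intro indep) auto
    have cj: "c j = 0" if "j \<noteq> k" for j
      using fun_cong[OF d0, of j] that by (simp add: d_def)
    have "(\<Sum>j\<in>UNIV. if j = k \<or> j \<in> I then 0 else c j * ?m j p) = 0"
      by (intro sum.neutral) (auto simp: cj)
    then have "u p * c k = 0" using fun_cong[OF d0, of k] by (simp add: d_def)
    moreover have "u p \<noteq> 0" using uu[OF u(3)] by auto
    ultimately have "c k = 0" by simp
    with cj have "c j = 0" for j by (cases "j = k") simp_all
    then show ?thesis by (rule ext)
  qed
  ultimately show ?case
    using E' W u by (intro exI[of _ E'] exI[of _ "W \<inter> V"]) auto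
qed

lemma local_orthonormal_frame_exists: "\<exists>E F. local_orthonormal_frame A g p E F"
proof -
  obtain E W where EW: "(\<forall>i. E i \<in> vector_fields A) \<and> open W \<and> p \<in> W \<and>
     (\<forall>q\<in>W. \<forall>i\<in>UNIV. \<forall>j. g [] [E i, E j] q = (if i = (j :: 'n) then 1 else 0)) \<and>
     (\<forall>c. (\<forall>h\<in>smooth_functions A. (\<Sum>i\<in>UNIV. c i * E i h p) = 0) \<longrightarrow> c = (\<lambda>i. 0))"
    using partial_orthonormal_frame[of p UNIV] by (elim exE)
  then have E: "\<And>i. E i \<in> vector_fields A" "open W" "p \<in> W"
    "\<And>q i j. q \<in> W \<Longrightarrow> g [] [E i, E j] q = (if i = (j :: 'n) then 1 else 0)"
    by simp_all
  define F where "F = (\<lambda>i X q. if X \<in> vector_fields A then g [] [E i, X] q else 0)"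
  have "F i \<in> one_forms A" for i
    using flinear_add[OF metric_flinear_right[OF E(1)]] flinear_scale[OF metric_flinear_right[OF E(1)]]
      metric_smooth[OF E(1)] vector_fields_fadd vector_fields_fscale
    by (auto simp: one_forms_def F_def fun_eq_iff)
  then have "local_orthonormal_frame A g p E F"
    using E unfolding local_orthonormal_frame_def local_frame_def by (auto simp: F_def)
  then show ?thesis by blast
qed

text \<open>
  Without the existence of an orthonormal frame, the choice in the definition of the divergence would
  be arbitrary.
\<close>
lemma divergence_chosen_frame:
  obtains N E F where "frame_on N E F" "p \<in> N"
    "\<And>nabla T \<alpha>s vs. divergence A g nabla T \<alpha>s vs p = (\<Sum>i\<in>UNIV. nabla_tensor A nabla (E i) T (\<alpha>s @ [F i]) vs p)"
proof -
  have "\<exists>EF. case EF of (E, F) \<Rightarrow> local_orthonormal_frame A g p E F"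
    using local_orthonormal_frame_exists by auto
  then have l: "case SOME (E, F). local_orthonormal_frame A g p E F of (E, F) \<Rightarrow> local_orthonormal_frame A g p E F"
    by (rule someI_ex)
  obtain E F where EF: "(SOME (E, F). local_orthonormal_frame A g p E F) = (E, F)" by (rule prod.exhaust)
  with l have "local_frame A p E F" by (simp add: local_orthonormal_frame_def)
  then obtain N where "frame_on N E F" "p \<in> N" by (auto simp: local_frame_iff)
  moreover have "divergence A g nabla T \<alpha>s vs p = (\<Sum>i\<in>UNIV. nabla_tensor A nabla (E i) T (\<alpha>s @ [F i]) vs p)"
    for nabla T \<alpha>s vs
    unfolding divergence_def EF by simp
  ultimately show thesis by (rule that)
qed

end

section \<open>The divergence of a vector field and the pointwise identity\<close>

context connected_manifold
begin

definition field_divergence :: "'a vfield \<Rightarrow> 'a \<Rightarrow> real" where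
  "field_divergence W p = (let (E, F) = (SOME (E, F). local_frame A p E F) in \<Sum>i\<in>UNIV. F i (nabla (E i) W) p)"

lemma field_divergence_in_frame:
  assumes F: "frame_on N E F" "p \<in> N" and W: "W \<in> vector_fields A"
  shows "field_divergence W p = (\<Sum>i\<in>UNIV. F i (nabla (E i) W) p)"
proof -
  have "\<exists>EF. case EF of (E, F) \<Rightarrow> local_frame A p E F" using F by (auto simp: local_frame_iff)
  then have l: "case SOME (E, F). local_frame A p E F of (E, F) \<Rightarrow> local_frame A p E F"
    by (rule someI_ex)
  obtain E' F' where EF: "(SOME (E, F). local_frame A p E F) = (E', F')" by (rule prod.exhaust)
  with l obtain N' where F': "frame_on N' E' F'" "p \<in> N'" by (auto simp: local_frame_iff)
  have "(\<Sum>i\<in>UNIV. F' i (nabla (E' i) W) p) = (\<Sum>i\<in>UNIV. F i (nabla (E i) W) p)"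
  proof (rule trace_frame_independent[OF F' F, where G="\<lambda>\<alpha> X. \<alpha> (nabla X W)"])
    show "flinear (one_forms A) (\<lambda>\<alpha>. \<alpha> (nabla X W))" for X
      by (simp add: flinear_def fadd_def fscale_def)
    show "flinear (vector_fields A) (\<lambda>X. \<alpha> (nabla X W))" if "\<alpha> \<in> one_forms A" for \<alpha>
      using that W by (simp add: flinear_def nabla_add_left nabla_scale_left one_form_add one_form_scale nabla_closed)
  qed
  then show ?thesis by (simp add: field_divergence_def EF)
qed

lemma field_divergence_smooth:
  assumes W: "W \<in> vector_fields A"
  shows "field_divergence W \<in> smooth_functions A"
proof (rule smooth_functionI_local)
  fix p
  obtain N E F where F: "frame_on N E F" "p \<in> N" by (rule local_frame_exists)
  have "(\<lambda>q. \<Sum>i\<in>UNIV. F i (nabla (E i) W) q) \<in> smooth_functions A"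
    by (intro smooth_function_sum one_form_smooth[OF frame_onD(3)[OF F(1)]]
        nabla_closed[OF frame_onD(2)[OF F(1)] W])
  then show "\<exists>V h. open V \<and> p \<in> V \<and> h \<in> smooth_functions A \<and> (\<forall>q\<in>V. field_divergence W q = h q)"
    using field_divergence_in_frame[OF F(1) _ W] F frame_onD(1)[OF F(1)]
    by (intro exI[of _ N] exI[of _ "\<lambda>q. \<Sum>i\<in>UNIV. F i (nabla (E i) W) q"]) simp
qed

text \<open>
  Off the support, \<open>F\<^sub>i(\<nabla>\<^sub>i W) = E\<^sub>i(F\<^sub>i(W)) - (\<nabla>\<^sub>i F\<^sub>i)(W)\<close> only involves values of one-forms on \<open>W\<close>,
  which are zero in a neighbourhood.
\<close>
lemma field_divergence_vanish:
  assumes W: "W \<in> vector_fields A" and K: "closed K" "\<And>h q. q \<notin> K \<Longrightarrow> W h q = 0" and p: "p \<notin> K"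
  shows "field_divergence W p = 0"
proof -
  obtain N E F where F: "frame_on N E F" "p \<in> N" by (rule local_frame_exists)
  note E = frame_onD(2)[OF F(1)] and FF = frame_onD(3)[OF F(1)]
  have oK: "open (- K)" using K by blast
  have z: "\<alpha> W q = 0" if "\<alpha> \<in> one_forms A" "q \<in> - K" for \<alpha> q
    by (rule flinear_vanish[OF submodule_vector_fields flinear_one_form[OF that(1)] W oK that(2)])
      (use K in auto)
  have "F i (nabla (E i) W) p = 0" for i
  proof -
    have "E i (F i W) p = E i (\<lambda>q. 0) p"
      by (rule vector_field_local[OF E one_form_smooth[OF FF W] smooth_function_const oK])
        (use p z[OF FF] in auto)
    moreover have "nform (E i) (F i) W p = 0" using z[OF nabla_form_one_form[OF E FF]] p by blast
    ultimately show ?thesis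
      using W vector_field_const[OF E] by (simp add: nabla_form_def)
  qed
  then show ?thesis using field_divergence_in_frame[OF F W] by simp
qed

lemma field_divergence_add:
  assumes "V \<in> vector_fields A" "W \<in> vector_fields A"
  shows "field_divergence (fadd V W) p = field_divergence V p + field_divergence W p"
proof -
  obtain N E F where F: "frame_on N E F" "p \<in> N" by (rule local_frame_exists)
  note E = frame_onD(2)[OF F(1)] and FF = frame_onD(3)[OF F(1)]
  show ?thesis
    using assms nabla_add_right[OF E assms] one_form_add[OF FF nabla_closed[OF E assms(1)] nabla_closed[OF E assms(2)]]
    by (simp add: field_divergence_in_frame[OF F] vector_fields_fadd sum.distrib)
qed

text \<open>
  Fixing the last one-form and differentiating do not commute: the difference is the correction
  term of that slot.
\<close>
lemma nabla_tensor_snoc: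
  assumes "length \<alpha>s = s"
  shows "ntensor X S (\<alpha>s @ [\<alpha>]) vs p = ntensor X (\<lambda>\<alpha>s. S (\<alpha>s @ [\<alpha>])) \<alpha>s vs p - S (\<alpha>s @ [nform X \<alpha>]) vs p"
proof -
  have "(\<Sum>j<Suc s. S ((\<alpha>s @ [\<alpha>])[j := nform X ((\<alpha>s @ [\<alpha>]) ! j)]) vs p) =
    (\<Sum>j<s. S (\<alpha>s[j := nform X (\<alpha>s ! j)] @ [\<alpha>]) vs p) + S (\<alpha>s @ [nform X \<alpha>]) vs p"
    using assms by (simp add: list_update_append nth_append)
  then show ?thesis using assms by (simp add: nabla_tensor_def)
qed

end

locale metric_connected_manifold = metric_manifold A g + connected_manifold A nabla
  for A :: "('a::{t2_space, second_countable_topology}, 'n::finite) chart set" and g nabla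
begin

lemma divergence_in_frame:
  assumes F: "frame_on N E F" "p \<in> N" and S: "S \<in> tensor_fields A (Suc s) r"
    and a: "(\<alpha>s, vs) \<in> tensor_args A s r"
  shows "divergence A g nabla S \<alpha>s vs p = (\<Sum>i\<in>UNIV. ntensor (E i) S (\<alpha>s @ [F i]) vs p)"
proof -
  obtain N' E' F' where F': "frame_on N' E' F'" "p \<in> N'"
    "divergence A g nabla S \<alpha>s vs p = (\<Sum>i\<in>UNIV. ntensor (E' i) S (\<alpha>s @ [F' i]) vs p)"
    by (rule divergence_chosen_frame[of p]) blast
  have "(\<Sum>i\<in>UNIV. ntensor (E' i) S (\<alpha>s @ [F' i]) vs p) = (\<Sum>i\<in>UNIV. ntensor (E i) S (\<alpha>s @ [F i]) vs p)"
  proof (rule trace_frame_independent[OF F'(1,2) F, where G="\<lambda>\<alpha> X. ntensor X S (\<alpha>s @ [\<alpha>]) vs"])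
    show "flinear (one_forms A) (\<lambda>\<alpha>. ntensor X S (\<alpha>s @ [\<alpha>]) vs)" if "X \<in> vector_fields A" for X
      by (rule tensor_flinear_snoc_form[OF nabla_tensor_field[OF that S] a])
    show "flinear (vector_fields A) (\<lambda>X. ntensor X S (\<alpha>s @ [\<alpha>]) vs)" if "\<alpha> \<in> one_forms A" for \<alpha>
      by (rule nabla_tensor_flinear[OF S]) (use a that in \<open>auto simp: tensor_args_def\<close>)
  qed
  then show ?thesis using F' by simp
qed

text \<open>
  All terms are computed in the frame that the contraction selects at \<open>p\<close>. With
  \<open>S\<^sub>\<alpha> = S(\<dots>, \<alpha>)\<close>, the left hand side is the sum over \<open>k\<close> of \<open>\<nabla>\<^sub>k T : S\<^sub>\<alpha> + T : \<nabla>\<^sub>k (S\<^sub>\<alpha>) - T : S\<^sub>\<beta>\<close> for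
  \<open>\<alpha> = F\<^sub>k\<close> and \<open>\<beta> = \<nabla>\<^sub>k F\<^sub>k\<close>. By the Leibniz rule this is \<open>E\<^sub>k (F\<^sub>k(W)) - (\<nabla>\<^sub>k F\<^sub>k)(W) = F\<^sub>k(\<nabla>\<^sub>k W)\<close>.
\<close>
lemma contraction_covariant_derivative_divergence:
  assumes T: "T \<in> tensor_fields A r s" and S: "S \<in> tensor_fields A (Suc s) r"
  shows "contraction A r (Suc s) (covariant_derivative A nabla T) S p +
    contraction A r s T (divergence A g nabla S) p = field_divergence (contracted_field r s T S) p"
proof -
  let ?W = "contracted_field r s T S"
  obtain N E F where F: "frame_on N E F" "p \<in> N"
    and C: "\<forall>r s T\<^sub>1 T\<^sub>2. contraction A r s T\<^sub>1 T\<^sub>2 p = frame_contraction E F r s T\<^sub>1 T\<^sub>2 p"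
    by (rule contraction_chosen_frame[of p])
  note E = frame_onD(2)[OF F(1)] and FF = frame_onD(3)[OF F(1)]
  let ?S = "\<lambda>\<alpha> \<alpha>s. S (\<alpha>s @ [\<alpha>])"
  let ?I = "{is :: 'n list. length is = r}" and ?J = "{js :: 'n list. length js = s}"
  have 1: "contraction A r (Suc s) (covariant_derivative A nabla T) S p =
      (\<Sum>k\<in>UNIV. contraction A r s (ntensor (E k) T) (?S (F k)) p)"
  proof -
    have "contraction A r (Suc s) (covariant_derivative A nabla T) S p =
      (\<Sum>is\<in>?I. \<Sum>js\<in>?J. \<Sum>k\<in>UNIV. ntensor (E k) T (map F is) (map E js) p * S (map F js @ [F k]) (map E is) p)"
      unfolding C[rule_format] frame_contraction_def sum_lists_snoc by (simp add: covariant_derivative_def)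
    also have "\<dots> = (\<Sum>is\<in>?I. \<Sum>k\<in>UNIV. \<Sum>js\<in>?J. ntensor (E k) T (map F is) (map E js) p * S (map F js @ [F k]) (map E is) p)"
      by (intro sum.cong refl sum.swap)
    also have "\<dots> = (\<Sum>k\<in>UNIV. \<Sum>is\<in>?I. \<Sum>js\<in>?J. ntensor (E k) T (map F is) (map E js) p * S (map F js @ [F k]) (map E is) p)"
      by (rule sum.swap)
    finally show ?thesis unfolding C[rule_format] frame_contraction_def .
  qed
  have 2: "contraction A r s T (divergence A g nabla S) p =
      (\<Sum>k\<in>UNIV. contraction A r s T (ntensor (E k) (?S (F k))) p - contraction A r s T (?S (nform (E k) (F k))) p)"
  proof -
    have "contraction A r s T (divergence A g nabla S) p =
      (\<Sum>is\<in>?I. \<Sum>js\<in>?J. \<Sum>k\<in>UNIV. T (map F is) (map E js) p *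
         (ntensor (E k) (?S (F k)) (map F js) (map E is) p - S (map F js @ [nform (E k) (F k)]) (map E is) p))"
      unfolding C[rule_format] frame_contraction_def
      by (intro sum.cong refl)
        (simp add: divergence_in_frame[OF F S frame_tensor_args[OF F(1)]] nabla_tensor_snoc sum_distrib_left)
    also have "\<dots> = (\<Sum>is\<in>?I. \<Sum>k\<in>UNIV. \<Sum>js\<in>?J. T (map F is) (map E js) p *
         (ntensor (E k) (?S (F k)) (map F js) (map E is) p - S (map F js @ [nform (E k) (F k)]) (map E is) p))"
      by (intro sum.cong refl sum.swap)
    also have "\<dots> = (\<Sum>k\<in>UNIV. \<Sum>is\<in>?I. \<Sum>js\<in>?J. T (map F is) (map E js) p *
         (ntensor (E k) (?S (F k)) (map F js) (map E is) p - S (map F js @ [nform (E k) (F k)]) (map E is) p))"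
      by (rule sum.swap)
    finally show ?thesis unfolding C[rule_format] frame_contraction_def right_diff_distrib sum_subtractf .
  qed
  have "contraction A r s (ntensor (E k) T) (?S (F k)) p + contraction A r s T (ntensor (E k) (?S (F k))) p
      - contraction A r s T (?S (nform (E k) (F k))) p = F k (nabla (E k) ?W) p" for k
  proof -
    note W = contracted_field_vector_field[OF T S]
    have "nform (E k) (F k) ?W p = E k (F k ?W) p - F k (nabla (E k) ?W) p"
      using W by (simp add: nabla_form_def)
    then show ?thesis
      using contraction_derivative[OF E T tensor_snoc_form[OF S FF], of k k p]
        one_form_contracted_field[OF T S FF, of k]
        one_form_contracted_field[OF T S nabla_form_one_form[OF E FF], of k k] by simp
  qed
  then show ?thesis
    unfolding 1 2 field_divergence_in_frame[OF F contracted_field_vector_field[OF T S]]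
      sum.distrib[symmetric] by (intro sum.cong refl) (simp add: algebra_simps)
qed

end

section \<open>Integrals of compactly supported functions on Euclidean space\<close>

lemma compact_support_integrable:
  fixes f :: "'e::euclidean_space \<Rightarrow> real"
  assumes "compact K" "continuous_on UNIV f" "\<And>x. x \<notin> K \<Longrightarrow> f x = 0"
  shows "integrable lborel f"
proof -
  have "integrable lborel (\<lambda>x. indicator K x *\<^sub>R f x)"
    using assms by (intro borel_integrable_compact) (auto intro: continuous_on_subset)
  also have "(\<lambda>x. indicator K x *\<^sub>R f x) = f"
    using assms(3) by (auto simp: indicator_def fun_eq_iff)
  finally show ?thesis .
qed

lemma integral_shift:
  fixes f :: "'e::euclidean_space \<Rightarrow> real"
  assumes "f \<in> borel_measurable borel"
  shows "(\<integral>x. f (x + c) \<partial>lborel) = (\<integral>x. f x \<partial>lborel)"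
proof -
  have "(\<integral>x. f x \<partial>lborel) = (\<integral>x. f x \<partial>distr lborel borel ((+) c))"
    by (simp add: lborel_distr_plus)
  also have "\<dots> = (\<integral>x. f (c + x) \<partial>lborel)"
    using assms by (intro integral_distr) auto
  finally show ?thesis by (simp add: add.commute)
qed

text \<open>
  By translation invariance all difference quotients of \<open>u\<close> have integral zero, and they converge
  to \<open>u'\<close>. The mean value theorem bounds them by the maximum of \<open>u'\<close> on a compact set, so dominated
  convergence applies.
\<close>
lemma integral_directional_derivative:
  fixes u u' :: "'e::euclidean_space \<Rightarrow> real"
  assumes K: "compact K" and uK: "\<And>x. x \<notin> K \<Longrightarrow> u x = 0" and u'K: "\<And>x. x \<notin> K \<Longrightarrow> u' x = 0"
    and cu: "continuous_on UNIV u" and cu': "continuous_on UNIV u'"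
    and der: "\<And>x. ((\<lambda>t. u (x + t *\<^sub>R e)) has_real_derivative u' x) (at 0)"
  shows "(\<integral>x. u' x \<partial>lborel) = 0"
proof -
  let ?h = "\<lambda>n. 1 / real (Suc n)"
  let ?D = "\<lambda>n x. (u (x + ?h n *\<^sub>R e) - u x) / ?h n"
  \<comment> \<open>The points from which a step of length at most one along \<open>e\<close> can reach \<open>K\<close>.\<close>
  let ?L = "(\<lambda>(x, t). x - t *\<^sub>R e) ` (K \<times> {0..1})"
  have L: "compact ?L"
    unfolding split_def
    by (intro compact_continuous_image compact_Times K continuous_intros) auto
  obtain B where B: "\<And>x. \<bar>u' x\<bar> \<le> B"
  proof -
    have "compact (u' ` K)" using K cu' by (intro compact_continuous_image) (auto intro: continuous_on_subset)
    then obtain B where B: "\<And>x. x \<in> K \<Longrightarrow> \<bar>u' x\<bar> \<le> B"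
      using compact_imp_bounded bounded_iff by (metis imageI real_norm_def)
    have "\<bar>u' x\<bar> \<le> max B 0" for x
      using B[of x] u'K[of x] by (cases "x \<in> K") auto
    then show thesis by (rule that)
  qed
  have der': "((\<lambda>t. u (x + t *\<^sub>R e)) has_real_derivative u' (x + t *\<^sub>R e)) (at t)" for x t
  proof -
    have "((\<lambda>s. u ((x + t *\<^sub>R e) + s *\<^sub>R e)) has_real_derivative u' (x + t *\<^sub>R e)) (at 0)"
      by (rule der)
    then have "((\<lambda>s. u (x + (s + t) *\<^sub>R e)) has_real_derivative u' (x + t *\<^sub>R e)) (at 0)"
      by (simp add: algebra_simps)
    then show ?thesis using DERIV_shift[of "\<lambda>s. u (x + s *\<^sub>R e)" "u' (x + t *\<^sub>R e)" 0 t] by simp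
  qed
  have bound: "\<bar>?D n x\<bar> \<le> indicator ?L x * B" for n x
  proof (cases "x \<in> ?L")
    case True
    obtain z where "0 < z" "z < ?h n" "u (x + ?h n *\<^sub>R e) - u (x + 0 *\<^sub>R e) = (?h n - 0) * u' (x + z *\<^sub>R e)"
      using MVT2[of 0 "?h n" "\<lambda>t. u (x + t *\<^sub>R e)" "\<lambda>t. u' (x + t *\<^sub>R e)"] der' by auto
    then have "?D n x = u' (x + z *\<^sub>R e)" by simp
    then show ?thesis using True B by simp
  next
    case False
    have "x + t *\<^sub>R e \<notin> K" if "t \<in> {0..1}" for t
    proof
      assume "x + t *\<^sub>R e \<in> K"
      then have "x \<in> ?L" using that by (intro image_eqI[of _ _ "(x + t *\<^sub>R e, t)"]) auto
      then show False using False by blast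
    qed
    from this[of 0] this[of "?h n"] show ?thesis using uK False by (simp add: field_simps)
  qed
  have mu: "u \<in> borel_measurable borel" "u' \<in> borel_measurable borel"
    using cu cu' by (auto intro: borel_measurable_continuous_onI)
  have iu: "integrable lborel u" by (rule compact_support_integrable[OF K cu uK])
  have m2: "(\<lambda>x. u (x + c)) \<in> borel_measurable borel" for c
    by (rule measurable_compose[OF _ mu(1)]) simp
  have ish: "integrable lborel (\<lambda>x. u (x + c))" for c
  proof -
    have "integrable (distr lborel borel ((+) c)) u" using iu by (simp add: lborel_distr_plus)
    then have "integrable lborel (\<lambda>x. u (c + x))" by (rule integrable_distr[rotated]) simp
    then show ?thesis by (simp add: add.commute)
  qed
  have zero: "(\<integral>x. ?D n x \<partial>lborel) = 0" for n
    using ish[of "?h n *\<^sub>R e"] iu integral_shift[OF mu(1), of "?h n *\<^sub>R e"] by simp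
  have "(\<lambda>n. \<integral>x. ?D n x \<partial>lborel) \<longlonglongrightarrow> (\<integral>x. u' x \<partial>lborel)"
  proof (rule integral_dominated_convergence)
    show "u' \<in> borel_measurable lborel" using mu by simp
    show "?D n \<in> borel_measurable lborel" for n using mu m2 by measurable
    show "integrable lborel (\<lambda>x. indicator ?L x * B)"
      using L by (auto intro!: emeasure_compact_finite borel_compact integrable_mult_left)
    show "AE x in lborel. (\<lambda>n. ?D n x) \<longlonglongrightarrow> u' x"
    proof (rule AE_I2)
      fix x
      have "((\<lambda>h. (u (x + h *\<^sub>R e) - u x) / h) \<longlongrightarrow> u' x) (at 0)"
        using der[of x] by (simp add: DERIV_def)
      moreover have "filterlim ?h (at 0) sequentially"
        unfolding filterlim_at using LIMSEQ_inverse_real_of_nat by (auto simp: inverse_eq_divide)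
      ultimately show "(\<lambda>n. ?D n x) \<longlonglongrightarrow> u' x" by (rule filterlim_compose)
    qed
    show "AE x in lborel. norm (?D n x) \<le> indicator ?L x * B" for n
      using bound by (intro AE_I2) simp
  qed
  then show ?thesis unfolding zero using LIMSEQ_unique tendsto_const by blast
qed

section \<open>The derivative and the positivity of determinants\<close>

text \<open>
  In the Leibniz expansion, a permutation other than the identity moves at least two indices, so
  after differentiating one factor there is still an off-diagonal factor, which is zero.
\<close>
lemma det_derivative_at_identity:
  fixes H :: "real \<Rightarrow> real ^ 'n::finite ^ 'n"
  assumes "H z = mat 1" "\<And>i j. ((\<lambda>t. H t $ i $ j) has_real_derivative H' $ i $ j) (at z)"
  shows "((\<lambda>t. det (H t)) has_real_derivative trace H') (at z)"
proof -
  let ?P = "{p. p permutes (UNIV :: 'n set)}"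
  let ?d = "\<lambda>p. \<Sum>i\<in>UNIV. H' $ i $ p i * (\<Prod>j\<in>UNIV - {i}. H z $ j $ p j)"
  have "((\<lambda>t. \<Prod>i\<in>UNIV. H t $ i $ p i) has_real_derivative ?d p) (at z)" for p
    by (rule has_field_derivative_prod) (rule assms(2))
  then have "((\<lambda>t. det (H t)) has_real_derivative (\<Sum>p\<in>?P. of_int (sign p) * ?d p)) (at z)"
    unfolding det_def by (intro DERIV_sum DERIV_cmult)
  moreover have "(\<Sum>p\<in>?P. of_int (sign p) * ?d p) = (\<Sum>p\<in>{id}. of_int (sign p) * ?d p)"
  proof (rule sum.mono_neutral_right)
    show "\<forall>p\<in>?P - {id}. of_int (sign p) * ?d p = 0"
    proof
      fix p assume p: "p \<in> ?P - {id}"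
      have vanish: "(\<Prod>j\<in>UNIV - {i}. H z $ j $ p j) = 0" for i
      proof -
        have "\<exists>j. j \<noteq> i \<and> p j \<noteq> j"
        proof (rule ccontr)
          assume "\<not> ?thesis"
          then have fixed: "p j = j" if "j \<noteq> i" for j using that by blast
          have "inj p" using p permutes_inj by blast
          then have "p i = i" using fixed by (metis injD)
          then have "p = id" using fixed by (metis ext id_apply)
          then show False using p by blast
        qed
        then obtain j where "j \<noteq> i" "p j \<noteq> j" by blast
        then show ?thesis
          using assms(1) by (intro prod_zero bexI[of _ j]) (auto simp: mat_def)
      qed
      show "of_int (sign p) * ?d p = 0"
        unfolding vanish by simp
    qed
  qed (auto intro: permutes_id finite_permutations)
  moreover have "(\<Sum>p\<in>{id}. of_int (sign p) * ?d p) = trace H'"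
    using assms(1) by (simp add: sign_id trace_def mat_def)
  ultimately show ?thesis by simp
qed

text \<open>
  Jacobi's formula for a curve of matrices with \<open>c' = C c + c C\<^sup>T\<close>: dividing by \<open>c z\<close> reduces it to the
  derivative at the identity, and the trace of \<open>c\<^sup>-\<^sup>1 (C c + c C\<^sup>T)\<close> is twice the trace of \<open>C\<close>.
\<close>
lemma det_derivative:
  fixes c :: "real \<Rightarrow> real ^ 'n::finite ^ 'n"
  assumes "invertible (c z)" "\<And>i j. ((\<lambda>t. c t $ i $ j) has_real_derivative (C ** c z + c z ** transpose C) $ i $ j) (at z)"
  shows "((\<lambda>t. det (c t)) has_real_derivative 2 * trace C * det (c z)) (at z)"
proof -
  obtain R where R: "R ** c z = mat 1" "c z ** R = mat 1" using assms(1) by (auto simp: invertible_def)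
  let ?H = "\<lambda>t. R ** c t" and ?H' = "R ** (C ** c z + c z ** transpose C)"
  have "((\<lambda>t. ?H t $ i $ j) has_real_derivative ?H' $ i $ j) (at z)" for i j
    unfolding matrix_matrix_mult_def[of R] vec_lambda_beta by (intro DERIV_sum DERIV_cmult assms(2))
  from det_derivative_at_identity[OF R(1) this]
  have "((\<lambda>t. det (c z) * det (?H t)) has_real_derivative det (c z) * trace ?H') (at z)"
    by (intro DERIV_cmult)
  moreover have "det (c z) * det (?H t) = det (c t)" for t
  proof -
    have "det (c z) * det R = 1" using arg_cong[OF R(2), of det] by (simp add: det_mul)
    then show ?thesis by (simp add: det_mul flip: mult.assoc)
  qed
  moreover have "trace ?H' = 2 * trace C"
  proof -
    have "trace (R ** (C ** c z)) = trace C"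
      by (subst trace_mul_sym) (simp add: R(2) flip: matrix_mul_assoc)
    moreover have "R ** (c z ** transpose C) = transpose C"
      using R(1) by (simp add: matrix_mul_assoc)
    moreover have "trace (transpose C) = trace C" by (simp add: trace_def transpose_def)
    ultimately show ?thesis by (simp add: matrix_add_ldistrib trace_add)
  qed
  ultimately show ?thesis by (simp add: mult_ac)
qed

text \<open>
  On the segment from the identity to \<open>G\<close> all matrices are positive definite, hence invertible, so
  the determinant cannot change its sign.
\<close>
lemma det_positive_definite:
  fixes G :: "real ^ 'n::finite ^ 'n"
  assumes "\<And>v. v \<noteq> 0 \<Longrightarrow> v \<bullet> (G *v v) > 0"
  shows "det G > 0"
proof (rule ccontr)
  assume "\<not> det G > 0"
  let ?M = "\<lambda>t. (\<chi> i j. (1 - t) * (if i = j then 1 else 0) + t * G $ i $ j) :: real ^ 'n ^ 'n"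
  have M0: "?M 0 = mat 1" by (simp add: mat_def)
  have M1: "?M 1 = G" by (simp add: vec_eq_iff)
  have "continuous_on {0..1} (\<lambda>t. det (?M t))"
    unfolding det_def by (auto intro!: continuous_intros)
  then obtain t where t: "0 \<le> t" "t \<le> 1" "det (?M t) = 0"
    using IVT2'[of "\<lambda>t. det (?M t)" 1 0 0] \<open>\<not> det G > 0\<close> unfolding M0 M1 by auto
  then have "\<not> invertible (?M t)" by (simp add: invertible_det_nz)
  then obtain v where v: "?M t *v v = 0" "v \<noteq> 0"
    using matrix_left_invertible_ker[of "?M t"] invertible_left_inverse by blast
  have "?M t *v v = (1 - t) *\<^sub>R v + t *\<^sub>R (G *v v)"
    by (simp add: vec_eq_iff matrix_vector_mult_def distrib_right sum.distrib sum_distrib_left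
        if_distrib[of "\<lambda>x. _ * x"] if_distrib[of "\<lambda>x. x * _"] mult.assoc cong: if_cong)
  then have "v \<bullet> ((1 - t) *\<^sub>R v + t *\<^sub>R (G *v v)) = 0"
    unfolding v(1) by simp
  then have "(1 - t) * (v \<bullet> v) + t * (v \<bullet> (G *v v)) = 0"
    by (simp only: inner_add_right inner_scaleR_right)
  moreover have "(1 - t) * (v \<bullet> v) \<ge> 0" "t * (v \<bullet> (G *v v)) \<ge> 0"
    using t assms[OF v(2)] by auto
  ultimately have "(1 - t) * (v \<bullet> v) = 0" "t * (v \<bullet> (G *v v)) = 0" by linarith+
  then show False using v(2) assms[OF v(2)] by auto
qed

section \<open>The Riemannian volume in a chart\<close>

locale metric_patch = coordinate_patch A U \<phi> \<eta> N + metric_manifold A g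
  for A :: "('a::{t2_space, second_countable_topology}, 'n::finite) chart set" and U \<phi> \<eta> N g
begin

definition gram :: "'a \<Rightarrow> real ^ 'n ^ 'n" where
  "gram q = (\<chi> i j. g [] [partial i, partial j] q)"

definition density_at :: "'a \<Rightarrow> real" where
  "density_at q = sqrt (det (gram q))"

lemma gram_nth: "gram q $ i $ j = g [] [partial i, partial j] q"
  by (simp add: gram_def)

lemma gram_smooth: "(\<lambda>q. gram q $ i $ j) \<in> smooth_functions A"
  unfolding gram_nth by (rule metric_smooth) (rule partial_vector_field)+

lemma density_continuous: "continuous_on UNIV density_at"
  unfolding density_at_def det_def
  by (intro continuous_on_real_sqrt continuous_on_sum continuous_on_mult continuous_on_prod continuous_on_const
      smooth_function_continuous gram_smooth)

lemma density_nonneg: "q \<in> N \<Longrightarrow> 0 \<le> density_at q" and det_gram_pos: "q \<in> N \<Longrightarrow> det (gram q) > 0"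
proof -
  show *: "det (gram q) > 0" if q: "q \<in> N" for q
  proof (rule det_positive_definite)
    fix v :: "real ^ 'n" assume "v \<noteq> 0"
    then obtain k where k: "v $ k \<noteq> 0" by (auto simp: vec_eq_iff)
    let ?V = "\<lambda>h p. \<Sum>i\<in>UNIV. v $ i * partial i h p"
    have lin: "?V \<in> vector_fields A \<and> B ?V = (\<lambda>p. \<Sum>i\<in>UNIV. v $ i * B (partial i) p)"
      if "flinear (vector_fields A) B" for B
      using flinear_lincomb[OF submodule_vector_fields that partial_vector_field,
          where I=UNIV and f="\<lambda>i p. v $ i" and E=partial] partial_vector_field by simp
    have V: "?V \<in> vector_fields A"
      using lin[OF metric_flinear_right[OF partial_vector_field]] by blast
    have "(\<Sum>i\<in>UNIV. v $ i * partial i (coord k) q) = v $ k"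
      by (simp add: partial_coord[OF q] if_distrib[of "\<lambda>x. _ * x"] cong: if_cong)
    then have "g [] [?V, ?V] q > 0" by (intro metric_pos[OF V, of "coord k"]) (simp add: k)
    also have "g [] [?V, ?V] q = (\<Sum>i\<in>UNIV. v $ i * (\<Sum>j\<in>UNIV. v $ j * g [] [partial i, partial j] q))"
      using lin[OF metric_flinear_left[OF V]] lin[OF metric_flinear_right[OF partial_vector_field]]
      by (simp add: fun_eq_iff)
    also have "\<dots> = v \<bullet> (gram q *v v)"
      by (simp add: inner_vec_def matrix_vector_mult_def gram_nth mult.commute)
    finally show "v \<bullet> (gram q *v v) > 0" .
  qed
  then show "0 \<le> density_at q" if "q \<in> N"
    using that by (simp add: density_at_def less_imp_le)
qed

text \<open>
  The coordinate vectors in \<open>metric_matrix\<close> are chosen separately at each point; they agree there with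
  the coordinate fields of the patch, and the metric only depends on values at the point.
\<close>
lemma metric_matrix_patch:
  assumes q: "q \<in> N"
  shows "metric_matrix A g (U, \<phi>) q = gram q"
proof -
  let ?P = "\<lambda>i X. X \<in> vector_fields A \<and> (\<forall>h\<in>smooth_functions A.
     X h q = frechet_derivative (h \<circ> inv_into U \<phi>) (at (\<phi> q)) (axis i 1))"
  have P: "?P i (partial i)" for i
    using partial_vector_field partial_on_patch[OF _ q] by simp
  have C: "?P i (coordinate_vector A (U, \<phi>) q i)" for i
    unfolding coordinate_vector_def prod.case by (rule someI[of "?P i", OF P])
  have "g [] [coordinate_vector A (U, \<phi>) q i, coordinate_vector A (U, \<phi>) q j] q = g [] [partial i, partial j] q" for i j
  proof -
    note ci = C[of i, THEN conjunct1] and cj = C[of j, THEN conjunct1]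
    have "g [] [coordinate_vector A (U, \<phi>) q i, coordinate_vector A (U, \<phi>) q j] q =
        g [] [partial i, coordinate_vector A (U, \<phi>) q j] q"
      by (rule flinear_pointwise[OF metric_flinear_left[OF cj] ci partial_vector_field]) (use C P in auto)
    also have "\<dots> = g [] [partial i, partial j] q"
      by (rule flinear_pointwise[OF metric_flinear_right[OF partial_vector_field] cj partial_vector_field])
        (use C P in auto)
    finally show ?thesis .
  qed
  then show ?thesis by (simp add: metric_matrix_def gram_def)
qed

text \<open>
  Functions on the manifold are moved to Euclidean space and extended by zero. For functions that are
  supported in a compact subset of \<open>N\<close>, the extension is continuous.
\<close>
definition push :: "('a \<Rightarrow> real) \<Rightarrow> real ^ 'n \<Rightarrow> real" where
  "push f x = (if x \<in> \<phi> ` N then f (inv_into U \<phi> x) else 0)"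

lemma push_chart: "q \<in> N \<Longrightarrow> push f (\<phi> q) = f q"
  using patch_subset chart by (auto simp: push_def)

lemma open_patch_image: "open (\<phi> ` N)"
  using open_chart_image[OF chart patch_open patch_subset] .

lemma compact_patch_image:
  assumes "compact K" "K \<subseteq> N"
  shows "compact (\<phi> ` K)"
  by (rule compact_continuous_image[OF continuous_on_subset[OF homeomorphism_cont1[OF chart_homeomorphism[OF chart]]]])
    (use assms patch_subset in auto)

lemma push_vanish:
  assumes "K \<subseteq> N" "\<And>q. q \<notin> K \<Longrightarrow> f q = 0" "x \<notin> \<phi> ` K"
  shows "push f x = 0"
proof (cases "x \<in> \<phi> ` N")
  case True
  then obtain q where "q \<in> N" "x = \<phi> q" by blast
  then show ?thesis using assms(2)[of q] assms(3) push_chart by auto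
qed (simp add: push_def)

lemma push_continuous:
  assumes K: "compact K" "K \<subseteq> N" and f: "continuous_on UNIV f" "\<And>q. q \<notin> K \<Longrightarrow> f q = 0"
  shows "continuous_on UNIV (push f)"
proof -
  have c: "continuous_on (\<phi> ` N) (inv_into U \<phi>)"
    by (rule continuous_on_subset[OF homeomorphism_cont2[OF chart_homeomorphism[OF chart]]])
      (use patch_subset in auto)
  have "continuous_on (\<phi> ` N) (\<lambda>x. f (inv_into U \<phi> x))"
    by (rule continuous_on_compose2[OF f(1) c]) simp
  then have 1: "continuous_on (\<phi> ` N) (push f)"
    by (rule continuous_on_eq) (simp add: push_def)
  have "continuous_on (- \<phi> ` K) (\<lambda>x. 0 :: real)" by simp
  then have 2: "continuous_on (- \<phi> ` K) (push f)"
    by (rule continuous_on_eq) (use push_vanish[OF K(2) f(2)] in auto)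
  have "open (- \<phi> ` K)" using compact_imp_closed[OF compact_patch_image[OF K]] by blast
  from continuous_on_open_Un[OF open_patch_image this 1 2]
  have "continuous_on (\<phi> ` N \<union> - \<phi> ` K) (push f)" .
  moreover have "\<phi> ` N \<union> - \<phi> ` K = UNIV" using K(2) by blast
  ultimately show ?thesis by simp
qed

end

locale riemannian_patch = metric_patch A U \<phi> \<eta> N g
  for A :: "('a::{t2_space, second_countable_topology}, 'n::finite) chart set" and U \<phi> \<eta> N g +
  fixes \<mu> :: "'a measure"
  assumes volume: "riemannian_volume A g \<mu>"
begin

lemma sets_volume: "sets \<mu> = sets borel"
  using volume by (simp add: riemannian_volume_def)

lemma volume_patch:
  assumes "B \<in> sets borel" "B \<subseteq> N"
  shows "emeasure \<mu> B = (\<integral>\<^sup>+x\<in>\<phi> ` B. ennreal (density_at (inv_into U \<phi> x)) \<partial>lborel)"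
proof -
  have "emeasure \<mu> B = (\<integral>\<^sup>+x\<in>\<phi> ` B. ennreal (sqrt (det (metric_matrix A g (U, \<phi>) (inv_into U \<phi> x)))) \<partial>lborel)"
    using volume chart assms patch_subset unfolding riemannian_volume_def by blast
  also have "\<dots> = (\<integral>\<^sup>+x\<in>\<phi> ` B. ennreal (density_at (inv_into U \<phi> x)) \<partial>lborel)"
  proof (rule nn_integral_cong)
    fix x
    show "ennreal (sqrt (det (metric_matrix A g (U, \<phi>) (inv_into U \<phi> x)))) * indicator (\<phi> ` B) x =
      ennreal (density_at (inv_into U \<phi> x)) * indicator (\<phi> ` B) x"
    proof (cases "x \<in> \<phi> ` B")
      case True
      then have "inv_into U \<phi> x \<in> N" using assms patch_subset chart by (auto simp: subset_eq)
      then show ?thesis by (simp add: metric_matrix_patch density_at_def)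
    qed simp
  qed
  finally show ?thesis .
qed

text \<open>
  The formula for the volume of small sets, read as an equality of measures; from there the
  transformation rules for integrals are available. The value \<open>p0\<close> makes the inverse chart a total
  measurable map; it is taken only where the density is zero.
\<close>
lemma volume_density_distr:
  fixes p0 :: 'a
  defines "\<psi> \<equiv> \<lambda>x. if x \<in> \<phi> ` N then inv_into U \<phi> x else p0"
  shows "\<psi> \<in> borel_measurable borel"
    and "density \<mu> (\<lambda>q. ennreal (indicator N q)) =
      distr (density lborel (\<lambda>x. ennreal (indicator (\<phi> ` N) x * density_at (\<psi> x)))) borel \<psi>"
proof -
  have c: "continuous_on (\<phi> ` N) (inv_into U \<phi>)"
    by (rule continuous_on_subset[OF homeomorphism_cont2[OF chart_homeomorphism[OF chart]]])
      (use patch_subset in auto)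
  show \<psi>: "\<psi> \<in> borel_measurable borel"
    unfolding \<psi>_def
    by (intro borel_measurable_continuous_on_if c continuous_on_const borel_open open_patch_image)
  have d [measurable]: "density_at \<in> borel_measurable borel"
    by (rule borel_measurable_continuous_onI[OF density_continuous])
  have N [measurable]: "N \<in> sets borel" "\<phi> ` N \<in> sets borel"
    using patch_open open_patch_image by auto
  note \<psi> [measurable]
  show "density \<mu> (\<lambda>q. ennreal (indicator N q)) =
      distr (density lborel (\<lambda>x. ennreal (indicator (\<phi> ` N) x * density_at (\<psi> x)))) borel \<psi>"
  proof (rule measure_eqI)
    fix B assume "B \<in> sets (density \<mu> (\<lambda>q. ennreal (indicator N q)))"
    then have B: "B \<in> sets borel" "B \<in> sets \<mu>" using sets_volume by auto
    have NB: "N \<inter> B \<in> sets \<mu>" "N \<inter> B \<in> sets borel" using B N sets_volume by auto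
    have "emeasure (density \<mu> (\<lambda>q. ennreal (indicator N q))) B = (\<integral>\<^sup>+q. indicator (N \<inter> B) q \<partial>\<mu>)"
      using B N(1) by (subst emeasure_density)
        (auto simp: measurable_cong_sets[OF sets_volume refl] ennreal_indicator simp flip: indicator_inter_arith)
    also have "\<dots> = emeasure \<mu> (N \<inter> B)" using NB by simp
    also have "\<dots> = (\<integral>\<^sup>+x\<in>\<phi> ` (N \<inter> B). ennreal (density_at (inv_into U \<phi> x)) \<partial>lborel)"
      by (rule volume_patch) (use NB in auto)
    also have "\<dots> = (\<integral>\<^sup>+x. ennreal (indicator (\<phi> ` N) x * density_at (\<psi> x)) * indicator (\<psi> -` B) x \<partial>lborel)"
    proof (rule nn_integral_cong)
      fix x
      show "ennreal (density_at (inv_into U \<phi> x)) * indicator (\<phi> ` (N \<inter> B)) x =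
        ennreal (indicator (\<phi> ` N) x * density_at (\<psi> x)) * indicator (\<psi> -` B) x"
      proof (cases "x \<in> \<phi> ` N")
        case True
        then obtain q where q: "q \<in> N" "x = \<phi> q" by blast
        then have i: "inv_into U \<phi> x = q" using patch_subset chart by auto
        have "x \<in> \<phi> ` (N \<inter> B) \<longleftrightarrow> q \<in> B"
          using q inj_on_chart[OF chart] patch_subset by (auto dest: inj_onD)
        moreover have "\<psi> x = q" using True i by (simp add: \<psi>_def)
        ultimately show ?thesis using True i by (simp add: indicator_def)
      next
        case False
        then have "x \<notin> \<phi> ` (N \<inter> B)" by blast
        then show ?thesis using False by simp
      qed
    qed
    also have "\<dots> = emeasure (distr (density lborel (\<lambda>x. ennreal (indicator (\<phi> ` N) x * density_at (\<psi> x)))) borel \<psi>) B"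
      using B(1) by (subst emeasure_distr) (auto simp: emeasure_density measurable_sets_borel[OF \<psi>])
    finally show "emeasure (density \<mu> (\<lambda>q. ennreal (indicator N q))) B =
       emeasure (distr (density lborel (\<lambda>x. ennreal (indicator (\<phi> ` N) x * density_at (\<psi> x)))) borel \<psi>) B" .
  qed (simp add: sets_volume)
qed

lemma integral_patch:
  assumes f: "f \<in> borel_measurable borel" and fN: "\<And>q. q \<notin> N \<Longrightarrow> f q = (0 :: real)"
  shows "integrable \<mu> f \<longleftrightarrow> integrable lborel (push (\<lambda>q. density_at q * f q))"
    and "(\<integral>q. f q \<partial>\<mu>) = (\<integral>x. push (\<lambda>q. density_at q * f q) x \<partial>lborel)"
proof -
  define p0 :: 'a where "p0 = undefined"
  define \<psi> where "\<psi> = (\<lambda>x. if x \<in> \<phi> ` N then inv_into U \<phi> x else p0)"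
  have \<psi>_fold: "(if x \<in> \<phi> ` N then inv_into U \<phi> x else p0) = \<psi> x" for x
    by (simp add: \<psi>_def)
  note eq = volume_density_distr[of p0, unfolded \<psi>_fold]
  note \<psi> [measurable] = eq(1)
  note f [measurable]
  have d [measurable]: "density_at \<in> borel_measurable borel"
    by (rule borel_measurable_continuous_onI[OF density_continuous])
  have N [measurable]: "N \<in> sets borel" "\<phi> ` N \<in> sets borel"
    using patch_open open_patch_image by auto
  let ?w = "\<lambda>x. indicator (\<phi> ` N) x * density_at (\<psi> x) :: real"
  have w: "?w x \<ge> 0" for x
    using density_nonneg patch_subset chart by (auto simp: \<psi>_def indicator_def subset_eq)
  have fm: "f \<in> borel_measurable \<mu>" "(\<lambda>q. indicator N q :: real) \<in> borel_measurable \<mu>"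
    using f N by (simp_all add: measurable_cong_sets[OF sets_volume refl])
  have iN: "(\<lambda>q. indicator N q *\<^sub>R f q) = f" using fN by (auto simp: indicator_def fun_eq_iff)
  have p: "(\<lambda>x. ?w x *\<^sub>R f (\<psi> x)) = push (\<lambda>q. density_at q * f q)"
    by (auto simp: push_def \<psi>_def fun_eq_iff indicator_def)
  have "integrable \<mu> f \<longleftrightarrow> integrable (density \<mu> (\<lambda>q. ennreal (indicator N q))) f"
    using integrable_density[OF fm] unfolding iN by simp
  also have "\<dots> \<longleftrightarrow> integrable (density lborel (\<lambda>x. ennreal (?w x))) (\<lambda>x. f (\<psi> x))"
    unfolding eq(2) by (rule integrable_distr_eq) simp_all
  also have "\<dots> \<longleftrightarrow> integrable lborel (\<lambda>x. ?w x *\<^sub>R f (\<psi> x))"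
    by (rule integrable_density) (use w in auto)
  finally show "integrable \<mu> f \<longleftrightarrow> integrable lborel (push (\<lambda>q. density_at q * f q))"
    unfolding p .
  have "(\<integral>q. f q \<partial>\<mu>) = (\<integral>q. f q \<partial>density \<mu> (\<lambda>q. ennreal (indicator N q)))"
    using integral_density[OF fm] unfolding iN by simp
  also have "\<dots> = (\<integral>x. f (\<psi> x) \<partial>density lborel (\<lambda>x. ennreal (?w x)))"
    unfolding eq(2) by (rule integral_distr) simp_all
  also have "\<dots> = (\<integral>x. ?w x *\<^sub>R f (\<psi> x) \<partial>lborel)"
    by (rule integral_density) (use w in auto)
  finally show "(\<integral>q. f q \<partial>\<mu>) = (\<integral>x. push (\<lambda>q. density_at q * f q) x \<partial>lborel)"
    unfolding p .
qed

lemma integrable_patch: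
  assumes K: "compact K" "K \<subseteq> N" and f: "continuous_on UNIV f" "\<And>q. q \<notin> K \<Longrightarrow> f q = (0 :: real)"
  shows "integrable \<mu> f"
proof -
  have c: "continuous_on UNIV (\<lambda>q. density_at q * f q)"
    by (intro continuous_on_mult density_continuous f)
  have z: "density_at q * f q = 0" if "q \<notin> K" for q using f(2)[OF that] by simp
  have "integrable lborel (push (\<lambda>q. density_at q * f q))"
    by (rule compact_support_integrable[OF compact_patch_image[OF K] push_continuous[OF K c z]
          push_vanish[OF K(2) z]])
  then show ?thesis
    using f K by (subst integral_patch) (auto intro: borel_measurable_continuous_onI)
qed

end

section \<open>The divergence theorem\<close>

sublocale riemannian_manifold \<subseteq> metric_connected_manifold A g nabla
  using metric levi_civita by unfold_locales (simp_all add: levi_civita_connection_def)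

context riemannian_manifold
begin

lemma torsion_free:
  "X \<in> vector_fields A \<Longrightarrow> Y \<in> vector_fields A \<Longrightarrow> h \<in> smooth_functions A \<Longrightarrow>
    nabla X Y h p - nabla Y X h p = X (Y h) p - Y (X h) p"
  using levi_civita unfolding levi_civita_connection_def by blast

lemma metric_compatible:
  "X \<in> vector_fields A \<Longrightarrow> Y \<in> vector_fields A \<Longrightarrow> Z \<in> vector_fields A \<Longrightarrow>
    X (g [] [Y, Z]) p = g [] [nabla X Y, Z] p + g [] [Y, nabla X Z] p"
  using levi_civita unfolding levi_civita_connection_def by blast

end

locale levi_civita_patch = riemannian_patch A U \<phi> \<eta> N g \<mu> + riemannian_manifold A g nabla \<mu>
  for A :: "('a::{t2_space, second_countable_topology}, 'n::finite) chart set"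
    and U \<phi> \<eta> N g \<mu> nabla
begin

text \<open>
  The Christoffel symbols of the direction \<open>k\<close>: row \<open>i\<close> lists the components of \<open>\<nabla>\<^sub>k \<partial>\<^sub>i\<close>.
\<close>
definition christoffel :: "'n \<Rightarrow> 'a \<Rightarrow> real ^ 'n ^ 'n" where
  "christoffel k q = (\<chi> i l. nabla (partial k) (partial i) (coord l) q)"

lemma trace_christoffel: "trace (christoffel k q) = (\<Sum>i\<in>UNIV. nabla (partial k) (partial i) (coord i) q)"
  by (simp add: trace_def christoffel_def)

lemma nabla_partial: "nabla (partial k) (partial i) \<in> vector_fields A"
  by (rule nabla_closed) (rule partial_vector_field)+

lemma trace_christoffel_smooth: "(\<lambda>q. trace (christoffel k q)) \<in> smooth_functions A"
  unfolding trace_christoffel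
  by (intro smooth_function_sum vector_field_smooth[OF nabla_partial coord_smooth])

text \<open>
  Metric compatibility, with \<open>\<nabla>\<^sub>k \<partial>\<^sub>i\<close> expanded in the coordinate frame.
\<close>
lemma partial_gram:
  assumes q: "q \<in> N"
  shows "partial k (\<lambda>q. gram q $ i $ j) q =
    (christoffel k q ** gram q + gram q ** transpose (christoffel k q)) $ i $ j"
proof -
  note D = partial_vector_field
  have "partial k (\<lambda>q. gram q $ i $ j) q =
      g [] [nabla (partial k) (partial i), partial j] q + g [] [partial i, nabla (partial k) (partial j)] q"
    unfolding gram_nth by (rule metric_compatible[OF D D D])
  also have "g [] [nabla (partial k) (partial i), partial j] q =
      (\<Sum>l\<in>UNIV. christoffel k q $ i $ l * gram q $ l $ j)"
    using patch_flinear[OF metric_flinear_left[OF D] nabla_partial q] by (simp add: christoffel_def gram_nth)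
  also have "g [] [partial i, nabla (partial k) (partial j)] q =
      (\<Sum>l\<in>UNIV. gram q $ i $ l * christoffel k q $ j $ l)"
    using patch_flinear[OF metric_flinear_right[OF D] nabla_partial q]
    by (simp add: christoffel_def gram_nth mult.commute)
  finally show ?thesis by (simp add: matrix_matrix_mult_def transpose_def)
qed

lemma patch_line_open:
  "open {t::real. \<phi> q + t *\<^sub>R axis k 1 \<in> \<phi> ` N}" "q \<in> N \<Longrightarrow> 0 \<in> {t::real. \<phi> q + t *\<^sub>R axis k 1 \<in> \<phi> ` N}"
proof -
  have "open ((\<lambda>t. \<phi> q + t *\<^sub>R axis k 1) -` (\<phi> ` N))"
    using open_patch_image by (rule open_vimage) (intro continuous_intros)
  then show "open {t::real. \<phi> q + t *\<^sub>R axis k 1 \<in> \<phi> ` N}" by (simp add: vimage_def)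
qed auto

lemma push_derivative:
  assumes h: "h \<in> smooth_functions A" and q: "q \<in> N"
  shows "((\<lambda>t. push h (\<phi> q + t *\<^sub>R axis k 1)) has_real_derivative partial k h q) (at 0)"
proof -
  let ?F = "frechet_derivative (h \<circ> inv_into U \<phi>) (at (\<phi> q))"
  have qU: "q \<in> U" using q patch_subset by blast
  have F: "((h \<circ> inv_into U \<phi>) has_derivative ?F) (at (\<phi> q + 0 *\<^sub>R axis k 1))"
    using chart_derivative[OF h qU] by simp
  then have lin: "linear ?F" using has_derivative_linear by blast
  have "((\<lambda>t. (h \<circ> inv_into U \<phi>) (\<phi> q + t *\<^sub>R axis k 1)) has_derivative (\<lambda>t. ?F (t *\<^sub>R axis k 1))) (at 0)"
    by (rule has_derivative_compose[where f="\<lambda>t. \<phi> q + t *\<^sub>R axis k 1", OF _ F])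
      (auto intro!: derivative_eq_intros)
  then have "((\<lambda>t. (h \<circ> inv_into U \<phi>) (\<phi> q + t *\<^sub>R axis k 1)) has_real_derivative partial k h q) (at 0)"
    unfolding has_field_derivative_def linear_scale[OF lin]
    by (simp add: partial_on_patch[OF h q] mult.commute[of _ "frechet_derivative _ _ _"])
  then show ?thesis
    by (rule has_field_derivative_transform_within_open[OF _ patch_line_open(1)[where q=q and k=k] patch_line_open(2)[OF q]])
      (simp add: push_def)
qed

lemma density_derivative:
  assumes q: "q \<in> N"
  shows "((\<lambda>t. push density_at (\<phi> q + t *\<^sub>R axis k 1)) has_real_derivative
    trace (christoffel k q) * density_at q) (at 0)"
proof -
  \<comment> \<open>The matrix of the metric along a coordinate line through \<open>q\<close>.\<close>
  let ?c = "\<lambda>t. (\<chi> i j. push (\<lambda>q. gram q $ i $ j) (\<phi> q + t *\<^sub>R axis k 1)) :: real ^ 'n ^ 'n"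
  have c0: "?c 0 = gram q" by (simp add: push_chart[OF q] vec_eq_iff)
  have pos: "det (gram q) > 0" by (rule det_gram_pos[OF q])
  have "((\<lambda>t. det (?c t)) has_real_derivative 2 * trace (christoffel k q) * det (?c 0)) (at 0)"
  proof (rule det_derivative)
    show "invertible (?c 0)" unfolding c0 using pos by (simp add: invertible_det_nz)
    show "((\<lambda>t. ?c t $ i $ j) has_real_derivative
      (christoffel k q ** ?c 0 + ?c 0 ** transpose (christoffel k q)) $ i $ j) (at 0)" for i j
      unfolding c0 vec_lambda_beta using push_derivative[OF gram_smooth q, of i j k] partial_gram[OF q, of k i j]
      by metis
  qed
  then have "((\<lambda>t. det (?c t)) has_real_derivative 2 * trace (christoffel k q) * det (gram q)) (at 0)"
    unfolding c0 .
  moreover have "(sqrt has_real_derivative inverse (sqrt (det (?c 0))) / 2) (at (det (?c 0)))"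
    unfolding c0 by (rule DERIV_real_sqrt[OF pos])
  ultimately have sqrt: "((\<lambda>t. sqrt (det (?c t))) has_real_derivative
      inverse (sqrt (det (?c 0))) / 2 * (2 * trace (christoffel k q) * det (gram q))) (at 0)"
    by (rule DERIV_chain2[rotated])
  have eq: "inverse (sqrt (det (?c 0))) / 2 * (2 * trace (christoffel k q) * det (gram q)) =
      trace (christoffel k q) * density_at q"
  proof -
    have "det (gram q) = sqrt (det (gram q)) * sqrt (det (gram q))" "sqrt (det (gram q)) \<noteq> 0" using pos by simp_all
    then show ?thesis unfolding c0 density_at_def by (simp add: field_simps)
  qed
  have "((\<lambda>t. sqrt (det (?c t))) has_real_derivative trace (christoffel k q) * density_at q) (at 0)"
    using sqrt unfolding eq .
  then show ?thesis
    by (rule has_field_derivative_transform_within_open[OF _ patch_line_open(1)[where q=q and k=k] patch_line_open(2)[OF q]])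
      (simp add: push_def density_at_def)
qed

text \<open>
  Coordinate fields commute on \<open>N\<close>, as the derivatives of the coordinate functions are constant. So
  the Christoffel symbols are symmetric, and the trace over the wrong pair of indices, which the divergence
  produces, equals the trace of \<open>christoffel\<close>.
\<close>
lemma patch_divergence:
  assumes W: "W \<in> vector_fields A" and q: "q \<in> N"
  shows "field_divergence W q =
    (\<Sum>k\<in>UNIV. partial k (W (coord k)) q + W (coord k) q * trace (christoffel k q))"
proof -
  note D = partial_vector_field and x = coord_smooth
  let ?d = "\<lambda>k. differential (coord k)"
  have d: "?d k \<in> one_forms A" for k by (rule differential_one_form[OF x])
  have dX: "?d k X = X (coord k)" if "X \<in> vector_fields A" for k X
    using that by (simp add: differential_def)
  have const: "partial k (partial l (coord m)) q = 0" for k l m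
  proof -
    have "partial k (partial l (coord m)) q = partial k (\<lambda>q. if l = m then 1 else 0) q"
      by (rule vector_field_local[OF D vector_field_smooth[OF D x] smooth_function_const patch_open q])
        (rule partial_coord)
    then show ?thesis using vector_field_const[OF D] by simp
  qed
  have sym: "nabla (partial k) (partial l) (coord m) q = nabla (partial l) (partial k) (coord m) q" for k l m
    using torsion_free[OF D D x, of k l m q] const by simp
  have "?d k (nabla (partial k) W) q = partial k (W (coord k)) q +
      (\<Sum>l\<in>UNIV. W (coord l) q * nabla (partial l) (partial k) (coord k) q)" for k
  proof -
    have "nform (partial k) (?d k) (partial l) q = - nabla (partial l) (partial k) (coord k) q" for l
      using D const by (simp add: nabla_form_def dX nabla_partial sym[of k l])
    then have "nform (partial k) (?d k) W q = - (\<Sum>l\<in>UNIV. W (coord l) q * nabla (partial l) (partial k) (coord k) q)"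
      using patch_flinear[OF flinear_one_form[OF nabla_form_one_form[OF D d]] W q, of k k] by (simp add: sum_negf)
    then show ?thesis using W by (simp add: nabla_form_def dX)
  qed
  then have "field_divergence W q = (\<Sum>k\<in>UNIV. partial k (W (coord k)) q +
      (\<Sum>l\<in>UNIV. W (coord l) q * nabla (partial l) (partial k) (coord k) q))"
    using field_divergence_in_frame[OF frame_on_patch q W] by simp
  also have "\<dots> = (\<Sum>k\<in>UNIV. partial k (W (coord k)) q) +
      (\<Sum>l\<in>UNIV. \<Sum>k\<in>UNIV. W (coord l) q * nabla (partial l) (partial k) (coord k) q)"
    unfolding sum.distrib by (subst (2) sum.swap) (rule refl)
  also have "\<dots> = (\<Sum>k\<in>UNIV. partial k (W (coord k)) q + W (coord k) q * trace (christoffel k q))"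
    by (simp add: trace_christoffel sum_distrib_left sum.distrib)
  finally show ?thesis .
qed

text \<open>
  Multiplied by the density, the divergence is the sum of the partial derivatives of
  \<open>density_at q * W (coord k) q\<close>, because the derivative of the density absorbs the Christoffel terms.
\<close>
lemma patch_divergence_integral:
  assumes W: "W \<in> vector_fields A" and K: "compact K" "K \<subseteq> N" "\<And>h q. q \<notin> K \<Longrightarrow> W h q = 0"
  shows "integrable \<mu> (field_divergence W)" "(\<integral>q. field_divergence W q \<partial>\<mu>) = 0"
proof -
  note D = partial_vector_field and x = coord_smooth
  let ?w = "\<lambda>k q. partial k (W (coord k)) q + W (coord k) q * trace (christoffel k q)"
  let ?u = "\<lambda>k. push (\<lambda>q. density_at q * W (coord k) q)" and ?u' = "\<lambda>k. push (\<lambda>q. density_at q * ?w k q)"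
  have cK: "closed K" "open (- K)" using compact_imp_closed[OF K(1)] by auto
  have Wsm: "W (coord k) \<in> smooth_functions A" for k by (rule vector_field_smooth[OF W x])
  have wsm: "?w k \<in> smooth_functions A" for k
    by (intro smooth_function_add smooth_function_mult vector_field_smooth[OF D] Wsm trace_christoffel_smooth)
  have w0: "density_at q * ?w k q = 0" "density_at q * W (coord k) q = 0" if q: "q \<notin> K" for q k
  proof -
    have "partial k (W (coord k)) q = partial k (\<lambda>q. 0) q"
      by (rule vector_field_local[OF D Wsm smooth_function_const cK(2)]) (use q K(3) in auto)
    then show "density_at q * ?w k q = 0" "density_at q * W (coord k) q = 0"
      using vector_field_const[OF D] K(3)[OF q] by simp_all
  qed
  have cont: "continuous_on UNIV (?u k)" "continuous_on UNIV (?u' k)" for k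
    by (intro push_continuous[OF K(1,2)] w0 continuous_on_mult density_continuous
        smooth_function_continuous Wsm wsm; assumption)+
  have van: "?u k y = 0" "?u' k y = 0" if "y \<notin> \<phi> ` K" for k y
    by (rule push_vanish[OF K(2) w0(2) that], assumption) (rule push_vanish[OF K(2) w0(1) that])
  note cpt = compact_patch_image[OF K(1,2)]
  have zero: "(\<integral>y. ?u' k y \<partial>lborel) = 0" for k
  proof (rule integral_directional_derivative[OF cpt van cont])
    fix y
    show "((\<lambda>t. ?u k (y + t *\<^sub>R axis k 1)) has_real_derivative ?u' k y) (at 0)"
    proof (cases "y \<in> \<phi> ` N")
      case True
      then obtain q where q: "q \<in> N" "y = \<phi> q" by blast
      have "((\<lambda>t. push density_at (\<phi> q + t *\<^sub>R axis k 1) * push (W (coord k)) (\<phi> q + t *\<^sub>R axis k 1)) has_real_derivative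
         trace (christoffel k q) * density_at q * push (W (coord k)) (\<phi> q + 0 *\<^sub>R axis k 1) +
         partial k (W (coord k)) q * push density_at (\<phi> q + 0 *\<^sub>R axis k 1)) (at 0)"
        by (rule DERIV_mult[OF density_derivative[OF q(1)] push_derivative[OF Wsm q(1)]])
      moreover have "push density_at z * push (W (coord k)) z = ?u k z" for z
        by (simp add: push_def)
      ultimately show ?thesis
        by (simp add: q push_chart[OF q(1)] algebra_simps)
    next
      case False
      then have y: "y \<notin> \<phi> ` K" using K(2) by blast
      have "open (- \<phi> ` K)" using compact_imp_closed[OF cpt] by blast
      then have o: "open ((\<lambda>t::real. y + t *\<^sub>R axis k 1) -` (- \<phi> ` K))"
        by (rule open_vimage) (intro continuous_intros)
      have "((\<lambda>t. 0) has_real_derivative 0) (at (0::real))" by simp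
      then have "((\<lambda>t. ?u k (y + t *\<^sub>R axis k 1)) has_real_derivative 0) (at 0)"
        by (rule has_field_derivative_transform_within_open[OF _ o]) (use y van(1) in auto)
      then show ?thesis using van(2)[OF y] by simp
    qed
  qed
  have fd: "continuous_on UNIV (field_divergence W)"
    by (rule smooth_function_continuous[OF field_divergence_smooth[OF W]])
  have fd0: "field_divergence W q = 0" if "q \<notin> K" for q
    by (rule field_divergence_vanish[OF W cK(1) K(3) that])
  show "integrable \<mu> (field_divergence W)"
    by (rule integrable_patch[OF K(1,2) fd fd0])
  have "push (\<lambda>q. density_at q * field_divergence W q) = (\<lambda>y. \<Sum>k\<in>UNIV. ?u' k y)"
  proof
    fix y
    show "push (\<lambda>q. density_at q * field_divergence W q) y = (\<Sum>k\<in>UNIV. ?u' k y)"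
    proof (cases "y \<in> \<phi> ` N")
      case True
      then obtain q where q: "q \<in> N" "y = \<phi> q" by blast
      show ?thesis
        unfolding q(2) push_chart[OF q(1)] patch_divergence[OF W q(1)] by (simp add: sum_distrib_left)
    qed (simp add: push_def)
  qed
  moreover have "integrable lborel (?u' k)" for k
    by (rule compact_support_integrable[OF cpt cont(2) van(2)])
  ultimately have "(\<integral>y. push (\<lambda>q. density_at q * field_divergence W q) y \<partial>lborel) = (\<Sum>k\<in>UNIV. \<integral>y. ?u' k y \<partial>lborel)"
    by (simp add: Bochner_Integration.integral_sum)
  also have "\<dots> = 0" by (simp add: zero)
  finally show "(\<integral>q. field_divergence W q \<partial>\<mu>) = 0"
    using K(2) fd0 by (subst integral_patch(2)) (auto intro: borel_measurable_continuous_onI[OF fd])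
qed

end

context riemannian_manifold
begin

lemma levi_civita_patch_exists:
  assumes "compact K" "K \<subseteq> U" "(U, \<phi>) \<in> A"
  obtains \<eta> N where "levi_civita_patch A U \<phi> \<eta> N g \<mu> nabla" "K \<subseteq> N"
proof -
  obtain \<eta> N where "\<eta> \<in> smooth_functions A" "open N" "K \<subseteq> N" "N \<subseteq> U" "\<And>q. q \<in> N \<Longrightarrow> \<eta> q = 1" "supp \<eta> \<subseteq> U"
    by (rule smooth_bump_compact[OF assms(1,2)]) (use chart_open[OF assms(3)] in blast)+
  then have "levi_civita_patch A U \<phi> \<eta> N g \<mu> nabla"
    using assms(3) volume by unfold_locales auto
  then show thesis using that \<open>K \<subseteq> N\<close> by blast
qed

lemma compactly_supported_integrable:
  assumes "f \<in> smooth_functions A" "compact (supp f)"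
  shows "integrable \<mu> f"
  using assms
proof (rule smooth_partition_induct)
  fix f U \<phi> assume f: "f \<in> smooth_functions A" "compact (supp f)" "(U, \<phi>) \<in> A" "supp f \<subseteq> U"
  obtain \<eta> N where "levi_civita_patch A U \<phi> \<eta> N g \<mu> nabla" and N: "supp f \<subseteq> N"
    by (rule levi_civita_patch_exists[OF f(2,4,3)])
  then interpret levi_civita_patch A U \<phi> \<eta> N g \<mu> nabla by simp
  show "integrable \<mu> f"
    by (rule integrable_patch[OF f(2) N smooth_function_continuous[OF f(1)]]) (rule supp_zero)
qed simp

text \<open>
  Multiplication of \<open>W\<close> by a function that is 1 on \<open>K\<close> does not change \<open>W\<close>, and the statement for
  \<open>fscale f W\<close> is additive in \<open>f\<close>.
\<close>
theorem divergence_theorem: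
  assumes W: "W \<in> vector_fields A" and K: "compact K" "\<And>h q. q \<notin> K \<Longrightarrow> W h q = 0"
  shows "integrable \<mu> (field_divergence W) \<and> (\<integral>q. field_divergence W q \<partial>\<mu>) = 0"
proof -
  let ?P = "\<lambda>f. integrable \<mu> (field_divergence (fscale f W)) \<and> (\<integral>q. field_divergence (fscale f W) q \<partial>\<mu>) = 0"
  obtain f V where f: "f \<in> smooth_functions A" "K \<subseteq> V" "\<And>q. q \<in> V \<Longrightarrow> f q = 1" "compact (supp f)"
    by (rule smooth_bump_compact[OF K(1) subset_UNIV open_UNIV]) blast
  have "fscale f W = W"
  proof (intro ext)
    fix h q show "fscale f W h q = W h q"
      using f(2) f(3)[of q] K(2)[of q h] by (cases "q \<in> K") (auto simp: fscale_def)
  qed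
  moreover have "?P f"
    using f(1,4)
  proof (rule smooth_partition_induct)
    fix f U \<phi> assume f: "f \<in> smooth_functions A" "compact (supp f)" "(U, \<phi>) \<in> A" "supp f \<subseteq> U"
    obtain \<eta> N where "levi_civita_patch A U \<phi> \<eta> N g \<mu> nabla" and N: "supp f \<subseteq> N"
      by (rule levi_civita_patch_exists[OF f(2,4,3)])
    then interpret levi_civita_patch A U \<phi> \<eta> N g \<mu> nabla by simp
    have "fscale f W h q = 0" if "q \<notin> supp f" for h q
      using supp_zero[OF that] by (simp add: fscale_def)
    then show "?P f"
      using patch_divergence_integral[OF vector_fields_fscale[OF f(1) W] f(2) N] by blast
  next
    fix f h assume fh: "f \<in> smooth_functions A" "h \<in> smooth_functions A" "?P f" "?P h"
    have "fscale (\<lambda>p. f p + h p) W = fadd (fscale f W) (fscale h W)"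
      by (simp add: fscale_def fadd_def distrib_right)
    then have "field_divergence (fscale (\<lambda>p. f p + h p) W) =
        (\<lambda>q. field_divergence (fscale f W) q + field_divergence (fscale h W) q)"
      using field_divergence_add[OF vector_fields_fscale[OF fh(1) W] vector_fields_fscale[OF fh(2) W]]
      by presburger
    then show "?P (\<lambda>p. f p + h p)" using fh(3,4) by simp
  qed
  ultimately show ?thesis by simp
qed

section \<open>Integration by parts for tensor fields\<close>

lemma contraction_zero:
  assumes "\<And>\<alpha>s vs. (\<alpha>s, vs) \<in> tensor_args A r s \<Longrightarrow> T\<^sub>1 \<alpha>s vs p = 0"
  shows "contraction A r s T\<^sub>1 T\<^sub>2 p = 0"
proof -
  obtain N E F where F: "frame_on N E F" "p \<in> N"
    "\<forall>r s T\<^sub>1 T\<^sub>2. contraction A r s T\<^sub>1 T\<^sub>2 p = frame_contraction E F r s T\<^sub>1 T\<^sub>2 p"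
    by (rule contraction_chosen_frame[of p])
  show ?thesis
    unfolding F(3)[rule_format] frame_contraction_def
    using assms[OF frame_tensor_args[OF F(1)]] by (intro sum.neutral ballI) simp
qed

lemma tensor_support_zero:
  assumes "p \<notin> tensor_support A r s T" "(\<alpha>s, vs) \<in> tensor_args A r s"
  shows "T \<alpha>s vs p = 0"
proof (rule ccontr)
  assume "T \<alpha>s vs p \<noteq> 0"
  then have "\<exists>(\<alpha>s, vs)\<in>tensor_args A r s. T \<alpha>s vs p \<noteq> 0"
    using assms(2) by (intro bexI[of _ "(\<alpha>s, vs)"]) simp_all
  then have "p \<in> tensor_support A r s T"
    unfolding tensor_support_def by (intro subsetD[OF closure_subset] CollectI)
  then show False using assms(1) by simp
qed

lemma nabla_tensor_support:
  assumes T: "T \<in> tensor_fields A r s" and X: "X \<in> vector_fields A"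
    and p: "p \<notin> tensor_support A r s T" and a: "(\<alpha>s, vs) \<in> tensor_args A r s"
  shows "ntensor X T \<alpha>s vs p = 0"
proof -
  have o: "open (- tensor_support A r s T)" by (simp add: tensor_support_def open_Compl)
  have "X (T \<alpha>s vs) p = X (\<lambda>q. 0) p"
    by (rule vector_field_local[OF X tensor_smooth[OF T a] smooth_function_const o])
      (use p tensor_support_zero[OF _ a] in auto)
  moreover have "T (\<alpha>s[j := nform X (\<alpha>s ! j)]) vs p = 0" if "j < length \<alpha>s" for j
    using that a p tensor_argsD(1)[OF a]
    by (intro tensor_support_zero tensor_args_update_form nabla_form_one_form[OF X] tensor_args_nth(1)[OF a]) auto
  moreover have "T \<alpha>s (vs[i := nabla X (vs ! i)]) p = 0" if "i < length vs" for i
    using that a p tensor_argsD(3)[OF a]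
    by (intro tensor_support_zero tensor_args_update_vector nabla_closed[OF X] tensor_args_nth(2)[OF a]) auto
  ultimately show ?thesis
    using vector_field_const[OF X] by (simp add: nabla_tensor_def)
qed

text \<open>
  Both \<open>\<nabla>T : S\<close> and the contracted field vanish outside of the support of \<open>T\<close>. The right hand
  integrand is the difference of two integrable functions, by the pointwise identity, and the second of
  them has integral zero.
\<close>
lemma tensor_integration_by_parts:
  assumes T: "T \<in> tensor_fields A r s" "compact (tensor_support A r s T)"
    and S: "S \<in> tensor_fields A (Suc s) r"
  shows "tensor_pairing A \<mu> r (Suc s) (covariant_derivative A nabla T) S =
         tensor_pairing A \<mu> r s T (\<lambda>\<alpha>s vs p. - divergence A g nabla S \<alpha>s vs p)"
proof -
  let ?K = "tensor_support A r s T" and ?W = "contracted_field r s T S"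
  let ?c = "contraction A r (Suc s) (covariant_derivative A nabla T) S"
  have c: "?c \<in> smooth_functions A"
    by (rule contraction_smooth[OF covariant_derivative_tensor_field[OF T(1)] S])
  have c0: "p \<in> ?K" if "?c p \<noteq> 0" for p
  proof (rule ccontr)
    assume p: "p \<notin> ?K"
    have "?c p = 0"
    proof (rule contraction_zero)
      fix \<alpha>s ws assume a: "(\<alpha>s, ws) \<in> tensor_args A r (Suc s)"
      then obtain vs X where ws: "ws = vs @ [X]"
        by (metis length_Suc_conv_rev tensor_argsD(3))
      then have "X \<in> vector_fields A" "(\<alpha>s, vs) \<in> tensor_args A r s"
        using a by (auto simp: tensor_args_def)
      then show "covariant_derivative A nabla T \<alpha>s ws p = 0"
        using nabla_tensor_support[OF T(1) _ p] by (simp add: covariant_derivative_def ws)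
    qed
    then show False using that by simp
  qed
  have ci: "integrable \<mu> ?c"
    by (rule compactly_supported_integrable[OF c compact_supp[OF c0 T(2)]])
  have "?W h p = 0" if "p \<notin> ?K" for h p
    using tensor_support_zero[OF that] contraction_zero by (auto simp: contracted_field_def)
  then have d: "integrable \<mu> (field_divergence ?W)" "(\<integral>q. field_divergence ?W q \<partial>\<mu>) = 0"
    using divergence_theorem[OF contracted_field_vector_field[OF T(1) S] T(2)] by blast+
  have "contraction A r s T (\<lambda>\<alpha>s vs p. - divergence A g nabla S \<alpha>s vs p) p = ?c p - field_divergence ?W p" for p
  proof -
    have "contraction A r s T (\<lambda>\<alpha>s vs p. - divergence A g nabla S \<alpha>s vs p) p =
        - contraction A r s T (divergence A g nabla S) p"
      by (simp add: contraction_def split_def Let_def sum_negf)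
    then show ?thesis
      using contraction_covariant_derivative_divergence[OF T(1) S, of p] by simp
  qed
  then have "tensor_pairing A \<mu> r s T (\<lambda>\<alpha>s vs p. - divergence A g nabla S \<alpha>s vs p) =
      (\<integral>p. ?c p - field_divergence ?W p \<partial>\<mu>)"
    by (simp add: tensor_pairing_def)
  also have "\<dots> = (\<integral>p. ?c p \<partial>\<mu>)"
    using ci d by simp
  finally show ?thesis by (simp add: tensor_pairing_def)
qed

end

theorem lemma2:
  fixes A :: "('a::{t2_space, second_countable_topology}, 'n::finite) chart set"
    and g :: "'a tensor"
    and nabla :: "'a vfield \<Rightarrow> 'a vfield \<Rightarrow> 'a vfield"
    and \<mu> :: "'a measure"
    and r s :: nat
    and T S :: "'a tensor"
  assumes "riemannian_manifold A g nabla \<mu>"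
    and "T \<in> tensor_fields A r s" and "compact (tensor_support A r s T)"
    and "S \<in> tensor_fields A (s + 1) r" and "compact (tensor_support A (s + 1) r S)"
  shows "tensor_pairing A \<mu> r (s + 1) (covariant_derivative A nabla T) S =
         tensor_pairing A \<mu> r s T (\<lambda>\<alpha>s vs p. - divergence A g nabla S \<alpha>s vs p)"
  using riemannian_manifold.tensor_integration_by_parts[OF assms(1-3)] assms(4) by simp

end
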